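(* Let $\tau\in\mathbb{H}$, $\gamma\in(0,2)$, $Q=\frac2\gamma+\frac\gamma2$, $\mu>0$, let $z_1,\dots,z_n\in\mathbb{T}$ be distinct points and $\alpha_1,\dots,\alpha_n\in\mathbb{R}$. Let $\psi\in\mathcal{M}$ be an element of the modular group. Then $$\Pi_{\gamma,\mu}^{(z_i,\alpha_i)_i}(\hat g_{\psi(\tau)},1)=\Big(\prod_i|\psi'(\tau)|^{-\triangle_{\alpha_i}}\Big)\,\Pi_{\gamma,\mu}^{(\widetilde\psi(z_i),\alpha_i)_i}(\hat g_\tau,1),$$ where the conformal weight is defined by $\triangle_\alpha=\frac\alpha2\big(Q-\frac\alpha2\big)$.
   Context: $\mathbb{T}=\mathbb{R}^2/\mathbb{Z}^2$ with coordinates $x=(x_1,x_2)$ and Lebesgue measure $\lambda$; $\mathbb{H}=\{\tau\in\mathbb{C}:\mathrm{Im}\,\tau>0\}$. For $\tau\in\mathbb{H}$, $\hat g_\tau$ is the flat metric $|dx_1+\tau dx_2|^2$, with volume form $d\lambda_\tau=\mathrm{Im}(\tau)\,d\lambda$ and Laplacian $\triangle_\tau=\mathrm{Im}(\tau)^{-2}(|\tau|^2\partial_{11}-2\mathrm{Re}(\tau)\partial_{12}+\partial_{22})$. The modular group $\mathcal{M}$ consists of the maps $\psi(z)=\frac{az+b}{cz+d}$ of $\mathbb{H}$ with $a,b,c,d\in\mathbb{Z}$, $ad-bc=1$; $\widetilde\psi(x)=(dx_1+bx_2,cx_1+ax_2)$ is the associated map of $\mathbb{T}$ (for either choice of sign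 of $(a,b,c,d)$). Green function: $G_\tau(x,w)=G_\tau(x-w)$ solves $-\triangle_\tau G_\tau(w,\cdot)=2\pi(\delta_w-\frac1{\mathrm{Im}\,\tau})$, $\int_{\mathbb{T}}G_\tau(w,\cdot)d\lambda_\tau=0$, with $\delta_w$ the Dirac mass relative to $\lambda_\tau$. $X_\tau$ is the Gaussian Free Field: the centered Gaussian random element of $H^{-1}(\mathbb{T})$ with covariance kernel $G_\tau(x-y)$. Its $\epsilon$-circle average is $X_{\tau,\epsilon}(x)=\frac1{2\pi}\int_0^{2\pi}X_\tau(x+c_\tau(\epsilon e^{i\theta}))d\theta$ with $c_\tau(z)=\big(\mathrm{Re}\,z-\frac{\mathrm{Re}\,\tau}{\mathrm{Im}\,\tau}\mathrm{Im}\,z,\frac{\mathrm{Im}\,z}{\mathrm{Im}\,\tau}\big)$ (continuous modification). $Z^{\mathrm{FF}}(\hat g_\tau)=\frac1{\sqrt{\mathrm{Im}\,\tau}|\eta(\tau)|^2}$ with $\eta(\tau)=q^{1/12}\prod_{n\ge1}(1-q^{2n})$, $q=e^{i\pi\tau}$. The Liouville partition function is $\Pi_{\gamma,\mu}^{(z_i,\alpha_i)_i}(\hat g_\tau,1)=\lim_{\epsilon\to0}\Pi_{\gamma,\mu}^{(z_i,\alpha_i)_i}(\hat g_\tau,1,\epsilon)$ (which exists in $[0,+\infty]$), where $$\Pi_{\gamma,\mu}^{(z_i,\alpha_i)_i}(\hat g_\tau,1,\epsilon)=Z^{\mathrm{FF}}(\hat g_\tau)\int_{\mathbb{R}}\mathbb{E}\Big[\prod_i\epsilon^{\frac{\alpha_i^2}2}e^{\alpha_i(c+X_{\tau,\epsilon}(z_i)-\frac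 Q2\ln\mathrm{Im}\,\tau)}\exp\Big(-\mu\epsilon^{\frac{\gamma^2}2}\int_{\mathbb{T}}e^{\gamma(c+X_{\tau,\epsilon}-\frac Q2\ln\mathrm{Im}\,\tau)}d\lambda_\tau\Big)\Big]dc.$$ *)

theory Defs
  imports "HOL-Probability.Probability"
begin

text \<open>
  Points of the torus \<open>T = R\<^sup>2/Z\<^sup>2\<close> are given by representatives in the plane, functions on the
  torus are \<open>Z\<^sup>2\<close>-periodic functions on the plane, and Lebesgue measure on the torus is
  Lebesgue measure on the fundamental domain \<open>[0,1)\<^sup>2\<close>.
\<close>

type_synonym plane = "real \<times> real"

definition int_lattice :: "plane set" where
  "int_lattice = {(of_int i, of_int j) | i j. True}"

definition periodic :: "(plane \<Rightarrow> 'b) \<Rightarrow> bool" where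
  "periodic f \<longleftrightarrow> (\<forall>x. \<forall>v\<in>int_lattice. f (x + v) = f x)"

definition torus_leb :: "plane measure" where
  "torus_leb = restrict_space lborel ({0..<1} \<times> {0..<1})"

definition torus_vol :: "complex \<Rightarrow> plane measure" where
  "torus_vol \<tau> = density torus_leb (\<lambda>_. ennreal (Im \<tau>))"

definition pd1 :: "(plane \<Rightarrow> real) \<Rightarrow> plane \<Rightarrow> real" where
  "pd1 f = (\<lambda>x. deriv (\<lambda>s. f (s, snd x)) (fst x))"

definition pd2 :: "(plane \<Rightarrow> real) \<Rightarrow> plane \<Rightarrow> real" where
  "pd2 f = (\<lambda>x. deriv (\<lambda>s. f (fst x, s)) (snd x))"

fun Ck :: "nat \<Rightarrow> (plane \<Rightarrow> real) \<Rightarrow> bool" where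
  "Ck 0 f \<longleftrightarrow> continuous_on UNIV f"
| "Ck (Suc k) f \<longleftrightarrow> (\<forall>x. f differentiable (at x)) \<and> Ck k (pd1 f) \<and> Ck k (pd2 f)"

definition test_function :: "(plane \<Rightarrow> real) \<Rightarrow> bool" where
  "test_function f \<longleftrightarrow> periodic f \<and> (\<forall>k. Ck k f)"

definition laplacian :: "complex \<Rightarrow> (plane \<Rightarrow> real) \<Rightarrow> plane \<Rightarrow> real" where
  "laplacian \<tau> f = (\<lambda>x. ((cmod \<tau>)\<^sup>2 * pd1 (pd1 f) x - 2 * Re \<tau> * pd1 (pd2 f) x + pd2 (pd2 f) x)
                        / (Im \<tau>)\<^sup>2)"

text \<open>
  The equation \<open>-\<triangle> G(w,\<cdot>) = 2\<pi>(\<delta>\<^sub>w - 1/Im \<tau>)\<close>, with \<open>G(w,x) = G(w-x)\<close>, in the sense of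
  distributions; it determines the integrable function \<open>G\<close> almost everywhere.
\<close>

definition green_function :: "complex \<Rightarrow> (plane \<Rightarrow> real) \<Rightarrow> bool" where
  "green_function \<tau> G \<longleftrightarrow>
     periodic G \<and> integrable (torus_vol \<tau>) G \<and>
     (\<forall>w. (\<integral>x. G (w - x) \<partial>torus_vol \<tau>) = 0) \<and>
     (\<forall>w \<phi>. test_function \<phi> \<longrightarrow>
        - (\<integral>x. G (w - x) * laplacian \<tau> \<phi> x \<partial>torus_vol \<tau>)
          = 2 * pi * (\<phi> w - (\<integral>x. \<phi> x \<partial>torus_vol \<tau>) / Im \<tau>))"

definition H1_norm :: "(plane \<Rightarrow> real) \<Rightarrow> real" where
  "H1_norm f = sqrt (\<integral>x. (f x)\<^sup>2 + (pd1 f x)\<^sup>2 + (pd2 f x)\<^sup>2 \<partial>torus_leb)"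

text \<open>
  \<open>H\<^sup>-\<^sup>1(T)\<close> is the dual of \<open>H\<^sup>1(T)\<close>. Its elements are given by their restriction to the dense
  subspace of smooth functions; a function \<open>u\<close> is identified with \<open>f \<mapsto> \<integral> u f d\<lambda>\<close>.
\<close>

definition H_minus_1 :: "((plane \<Rightarrow> real) \<Rightarrow> real) set" where
  "H_minus_1 = {u.
     (\<forall>f g a b. test_function f \<longrightarrow> test_function g \<longrightarrow>
        u (\<lambda>x. a * f x + b * g x) = a * u f + b * u g) \<and>
     (\<exists>C. \<forall>f. test_function f \<longrightarrow> \<bar>u f\<bar> \<le> C * H1_norm f)}"

text \<open>The Dirac mass at 0 is included as the degenerate Gaussian law.\<close>

definition centered_gaussian :: "'w measure \<Rightarrow> ('w \<Rightarrow> real) \<Rightarrow> bool" where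
  "centered_gaussian M Z \<longleftrightarrow> Z \<in> borel_measurable M \<and>
     ((AE \<omega> in M. Z \<omega> = 0) \<or> (\<exists>\<sigma>>0. distributed M lborel Z (normal_density 0 \<sigma>)))"

text \<open>
  The pairings with smooth functions generate the Borel sigma-algebra of \<open>H\<^sup>-\<^sup>1(T)\<close>, and by linearity
  their joint laws are Gaussian as soon as each of them is.
\<close>

definition gff :: "complex \<Rightarrow> 'w measure \<Rightarrow> ('w \<Rightarrow> (plane \<Rightarrow> real) \<Rightarrow> real) \<Rightarrow> bool" where
  "gff \<tau> M X \<longleftrightarrow>
     prob_space M \<and>
     (\<forall>\<omega>\<in>space M. X \<omega> \<in> H_minus_1) \<and>
     (\<forall>f. test_function f \<longrightarrow> centered_gaussian M (\<lambda>\<omega>. X \<omega> f)) \<and>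
     (\<exists>G. green_function \<tau> G \<and>
        (\<forall>f g. test_function f \<longrightarrow> test_function g \<longrightarrow>
           (\<integral>\<omega>. X \<omega> f * X \<omega> g \<partial>M)
             = (\<integral>x. (\<integral>y. f x * g y * G (x - y) \<partial>torus_leb) \<partial>torus_leb)))"

definition circ :: "complex \<Rightarrow> complex \<Rightarrow> plane" where
  "circ \<tau> z = (Re z - Re \<tau> / Im \<tau> * Im z, Im z / Im \<tau>)"

text \<open>Nonnegative smooth functions of mass one converging weakly to the Dirac mass at the origin.\<close>

definition mollifier :: "(nat \<Rightarrow> plane \<Rightarrow> real) \<Rightarrow> bool" where
  "mollifier \<rho> \<longleftrightarrow>
     (\<forall>k. test_function (\<rho> k) \<and> (\<forall>x. 0 \<le> \<rho> k x) \<and> (\<integral>x. \<rho> k x \<partial>torus_leb) = 1) \<and>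
     (\<forall>\<phi>. test_function \<phi> \<longrightarrow> (\<lambda>k. \<integral>x. \<phi> x * \<rho> k x \<partial>torus_leb) \<longlonglongrightarrow> \<phi> 0)"

definition convolve :: "((plane \<Rightarrow> real) \<Rightarrow> real) \<Rightarrow> (plane \<Rightarrow> real) \<Rightarrow> plane \<Rightarrow> real" where
  "convolve u \<rho> = (\<lambda>x. u (\<lambda>y. \<rho> (x - y)))"

text \<open>
  \<open>Y \<epsilon> x\<close> is the circle average \<open>X\<^sub>\<epsilon>(x)\<close>, jointly for all \<open>\<epsilon> > 0\<close>. An element of \<open>H\<^sup>-\<^sup>1(T)\<close> has no
  values on circles, so the average over a circle is the \<open>L\<^sup>2\<close>-limit of the averages of the smooth
  fields \<open>X * \<rho>\<^sub>k\<close>, for any mollifier; \<open>Y \<epsilon>\<close> is a continuous modification of this process on the torus.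
\<close>

definition circle_average ::
  "complex \<Rightarrow> 'w measure \<Rightarrow> ('w \<Rightarrow> (plane \<Rightarrow> real) \<Rightarrow> real) \<Rightarrow> (real \<Rightarrow> plane \<Rightarrow> 'w \<Rightarrow> real) \<Rightarrow> bool" where
  "circle_average \<tau> M X Y \<longleftrightarrow> (\<forall>\<epsilon>>0.
     (\<forall>\<omega>\<in>space M. continuous_on UNIV (\<lambda>x. Y \<epsilon> x \<omega>) \<and> periodic (\<lambda>x. Y \<epsilon> x \<omega>)) \<and>
     (\<forall>x. Y \<epsilon> x \<in> borel_measurable M \<and>
        (\<forall>\<rho>. mollifier \<rho> \<longrightarrow>
           (\<lambda>k. \<integral>\<^sup>+\<omega>. ennreal ((Y \<epsilon> x \<omega>
                - 1 / (2 * pi) * (LBINT \<theta>:{0..2 * pi}.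
                     convolve (X \<omega>) (\<rho> k) (x + circ \<tau> (of_real \<epsilon> * cis \<theta>))))\<^sup>2) \<partial>M)
           \<longlonglongrightarrow> 0)))"

definition eta :: "complex \<Rightarrow> complex" where
  "eta \<tau> = exp (\<i> * pi * \<tau> / 12) * (\<Prod>n. 1 - exp (\<i> * pi * \<tau>) ^ (2 * (n + 1)))"

definition Z_FF :: "complex \<Rightarrow> real" where
  "Z_FF \<tau> = 1 / (sqrt (Im \<tau>) * (cmod (eta \<tau>))\<^sup>2)"

definition Q_of :: "real \<Rightarrow> real" where
  "Q_of \<gamma> = 2 / \<gamma> + \<gamma> / 2"

definition conformal_weight :: "real \<Rightarrow> real \<Rightarrow> real" where
  "conformal_weight \<gamma> \<alpha> = \<alpha> / 2 * (Q_of \<gamma> - \<alpha> / 2)"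

definition liouville_partition_eps ::
  "real \<Rightarrow> real \<Rightarrow> nat \<Rightarrow> (nat \<Rightarrow> plane) \<Rightarrow> (nat \<Rightarrow> real) \<Rightarrow> complex
    \<Rightarrow> 'w measure \<Rightarrow> (real \<Rightarrow> plane \<Rightarrow> 'w \<Rightarrow> real) \<Rightarrow> real \<Rightarrow> ennreal" where
  "liouville_partition_eps \<gamma> \<mu> n z \<alpha> \<tau> M Y \<epsilon> =
     ennreal (Z_FF \<tau>) *
     (\<integral>\<^sup>+c. (\<integral>\<^sup>+\<omega>. ennreal (
         (\<Prod>i<n. \<epsilon> powr ((\<alpha> i)\<^sup>2 / 2) *
            exp (\<alpha> i * (c + Y \<epsilon> (z i) \<omega> - Q_of \<gamma> / 2 * ln (Im \<tau>)))) *
         exp (- \<mu> * \<epsilon> powr (\<gamma>\<^sup>2 / 2) *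
            (\<integral>x. exp (\<gamma> * (c + Y \<epsilon> x \<omega> - Q_of \<gamma> / 2 * ln (Im \<tau>))) \<partial>torus_vol \<tau>)))
       \<partial>M) \<partial>lborel)"

text \<open>
  The limit depends on \<open>(M, Y)\<close> only through the law of the field. It is a theorem, not encoded
  here, that it exists in \<open>[0,\<infinity>]\<close>; the value 0 otherwise is a convention.
\<close>

definition liouville_partition ::
  "real \<Rightarrow> real \<Rightarrow> nat \<Rightarrow> (nat \<Rightarrow> plane) \<Rightarrow> (nat \<Rightarrow> real) \<Rightarrow> complex
    \<Rightarrow> 'w measure \<Rightarrow> (real \<Rightarrow> plane \<Rightarrow> 'w \<Rightarrow> real) \<Rightarrow> ennreal" where
  "liouville_partition \<gamma> \<mu> n z \<alpha> \<tau> M Y =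
     (if \<exists>L. (liouville_partition_eps \<gamma> \<mu> n z \<alpha> \<tau> M Y \<longlongrightarrow> L) (at_right 0)
      then Lim (at_right 0) (liouville_partition_eps \<gamma> \<mu> n z \<alpha> \<tau> M Y) else 0)"

definition moebius_map :: "int \<Rightarrow> int \<Rightarrow> int \<Rightarrow> int \<Rightarrow> complex \<Rightarrow> complex" where
  "moebius_map a b c d z = (of_int a * z + of_int b) / (of_int c * z + of_int d)"

definition torus_map :: "int \<Rightarrow> int \<Rightarrow> int \<Rightarrow> int \<Rightarrow> plane \<Rightarrow> plane" where
  "torus_map a b c d x =
     (of_int d * fst x + of_int b * snd x, of_int c * fst x + of_int a * snd x)"

end

theory Submission
  imports Defs "HOL-Complex_Analysis.Complex_Analysis"
begin

text \<open>
  Write \<open>\<tau>' = \<psi>(\<tau>)\<close>, \<open>r = |c\<tau> + d|\<close>, and let \<open>A\<close> be the linear map of the torus associated with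
  \<open>\<psi>\<close>. In the complex coordinates \<open>x\<^sub>1 + \<tau>' x\<^sub>2\<close> and \<open>x\<^sub>1 + \<tau> x\<^sub>2\<close> the map \<open>A\<close> is multiplication by
  \<open>c\<tau> + d\<close> (\<open>torus_map_circ\<close>). So \<open>A\<close> is an isometry up to the factor \<open>r\<close>, it maps circles of
  radius \<open>\<epsilon>\<close> to circles of radius \<open>r\<epsilon>\<close>, and \<open>Im \<tau>' = Im \<tau> / r\<^sup>2\<close>, \<open>|\<psi>'(\<tau>)| = r\<^sup>-\<^sup>2\<close>.

  The Green function is determined almost everywhere by its Fourier coefficients, which are
  invariant under \<open>A\<close>. Hence the free field for \<open>\<tau>'\<close> has the law of the free field for \<open>\<tau>\<close>
  composed with \<open>A\<close>, and its \<open>\<epsilon>\<close>-circle averages at \<open>x\<close> have jointly the law of the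
  \<open>r\<epsilon>\<close>-circle averages of the latter at \<open>A x\<close>. As circle averages are \<open>L\<^sup>2\<close>-limits only,
  this is shown for joint characteristic functions: these are limits of explicit Gaussian
  characteristic functions, obtained from Riemann sums of mollified fields
  (\<open>circle_average_charfun_transport\<close>). Characteristic functions of finite families determine
  the law on path space (\<open>law_eqI\<close>), and the integrand of the regularised partition function is
  a measurable function of the path.

  It remains to collect powers of \<open>r\<close>. An insertion of weight \<open>\<alpha>\<close> contributes
  \<open>r\<^sup>\<alpha>\<^sup>Q\<close> from the shift of the field by \<open>-(Q/2) ln (Im \<tau>')\<close>, and \<open>r\<close> to the power \<open>-\<alpha>\<^sup>2/2\<close> from the
  change of \<open>\<epsilon>\<close> to \<open>r\<epsilon>\<close>, together \<open>|\<psi>'(\<tau>)|\<close> to the power minus the conformal weight. In the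
  potential term the exponent of \<open>r\<close> is \<open>\<gamma>Q - \<gamma>\<^sup>2/2 - 2 = 0\<close>. Finally the partition function of
  the free field is modular invariant (\<open>Z_FF_S\<close>, \<open>Z_FF_T\<close>), which amounts to
  \<open>|\<eta>(-1/\<tau>)|\<^sup>2 = |\<tau>| |\<eta>(\<tau>)|\<^sup>2\<close>. This is derived from Liouville's theorem: after rescaling
  the variable by \<open>\<tau>\<close> and multiplying by a Gaussian factor, the theta function for \<open>-1/\<tau>\<close> has the zeros
  and the quasi-periods of the theta function for \<open>\<tau>\<close>. Their quotient is therefore constant; the constant is found by multiplying the values at the
  three half-periods, whose product is explicit by an identity of Euler.
\<close>

section \<open>Infinite products and the theta function\<close>

text \<open>
  The \<open>q\<close>-Pochhammer symbol \<open>(w; q)\<close> with infinitely many factors.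
\<close>
definition qprod :: "complex \<Rightarrow> complex \<Rightarrow> complex" where
  "qprod q w = (\<Prod>n. 1 - w * q ^ n)"

lemma qprod_convergent:
  assumes "cmod q < 1"
  shows "convergent_prod (\<lambda>n. 1 - w * q ^ n)"
proof -
  have "summable (\<lambda>n. cmod w * cmod q ^ n)"
    using assms by (intro summable_mult summable_geometric) auto
  then have "summable (\<lambda>n. cmod ((1 - w * q ^ n) - 1))"
    by (simp add: norm_mult norm_power)
  then show ?thesis
    by (intro abs_convergent_prod_imp_convergent_prod summable_imp_abs_convergent_prod)
qed

lemma qprod_LIMSEQ:
  assumes "cmod q < 1"
  shows "(\<lambda>n. \<Prod>i<n. 1 - w * q ^ i) \<longlonglongrightarrow> qprod q w"
  using convergent_prod_LIMSEQ[OF qprod_convergent[OF assms, of w]]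
  by (simp add: LIMSEQ_lessThan_iff_atMost qprod_def)

lemma qprod_shift:
  assumes "cmod q < 1"
  shows "qprod q w = (1 - w) * qprod q (w * q)"
proof (rule LIMSEQ_unique)
  show "(\<lambda>n. \<Prod>i<Suc n. 1 - w * q ^ i) \<longlonglongrightarrow> qprod q w"
    using qprod_LIMSEQ[OF assms] LIMSEQ_Suc by blast
  have "(\<Prod>i<Suc n. 1 - w * q ^ i) = (1 - w) * (\<Prod>i<n. 1 - w * q * q ^ i)" for n
    by (subst prod.lessThan_Suc_shift) (simp add: mult.assoc)
  then show "(\<lambda>n. \<Prod>i<Suc n. 1 - w * q ^ i) \<longlonglongrightarrow> (1 - w) * qprod q (w * q)"
    using qprod_LIMSEQ[OF assms, of "w * q"] by (auto intro: tendsto_mult)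
qed

lemma qprod_eq_0_iff:
  assumes "cmod q < 1"
  shows "qprod q w = 0 \<longleftrightarrow> (\<exists>n. w * q ^ n = 1)"
proof -
  have "(\<lambda>n. \<Prod>i\<le>n. 1 - w * q ^ i) \<longlonglongrightarrow> qprod q w"
    using qprod_LIMSEQ[OF assms] by (simp add: LIMSEQ_lessThan_iff_atMost)
  then show ?thesis
    using convergent_prod_to_zero_iff[OF qprod_convergent[OF assms, of w]] LIMSEQ_unique
    by (metis eq_iff_diff_eq_0)
qed

lemma qprod_nonzero:
  assumes "cmod q < 1" "cmod w < 1"
  shows "qprod q w \<noteq> 0"
proof
  assume "qprod q w = 0"
  then obtain n where "w * q ^ n = 1"
    using qprod_eq_0_iff assms by blast
  then have "cmod w * cmod q ^ n = 1"
    by (metis norm_mult norm_one norm_power)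
  moreover have "cmod w * cmod q ^ n \<le> cmod w * 1"
    using assms by (intro mult_left_mono power_le_one) auto
  ultimately show False using assms by simp
qed

lemma qprod_holomorphic:
  assumes "cmod q < 1"
  shows "qprod q holomorphic_on UNIV"
proof (rule holomorphic_uniform_sequence[where f = "\<lambda>n w. \<Prod>i<n. 1 - w * q ^ i"])
  fix x :: complex
  have cmp: "compact (cball x 1)" by simp
  have "uniformly_convergent_on (cball x 1) (\<lambda>N w. \<Sum>n<N. norm ((1 - w * q ^ n) - 1))"
  proof (rule Weierstrass_m_test')
    show "norm (norm (1 - w * q ^ n - 1)) \<le> (cmod x + 1) * cmod q ^ n" if "w \<in> cball x 1" for n w
    proof -
      have "cmod w \<le> cmod x + 1"
        using that norm_triangle_sub[of w x] by (auto simp: dist_norm norm_minus_commute)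
      then show ?thesis by (simp add: norm_mult norm_power mult_right_mono)
    qed
    show "summable (\<lambda>n. (cmod x + 1) * cmod q ^ n)"
      using assms by (intro summable_mult summable_geometric) auto
  qed
  then have "uniformly_convergent_on (cball x 1) (\<lambda>n w. \<Prod>i<n. 1 - w * q ^ i)"
    by (intro uniformly_convergent_on_prod' cmp) (auto intro!: continuous_intros)
  then have "uniform_limit (cball x 1) (\<lambda>n w. \<Prod>i<n. 1 - w * q ^ i)
      (\<lambda>w. lim (\<lambda>n. \<Prod>i<n. 1 - w * q ^ i)) sequentially"
    by (simp add: uniformly_convergent_uniform_limit_iff)
  moreover have "lim (\<lambda>n. \<Prod>i<n. 1 - w * q ^ i) = qprod q w" for w
    using qprod_LIMSEQ[OF assms] by (rule limI)
  ultimately have "uniform_limit (cball x 1) (\<lambda>n w. \<Prod>i<n. 1 - w * q ^ i) (qprod q) sequentially"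
    by simp
  then show "\<exists>d>0. cball x d \<subseteq> UNIV \<and>
      uniform_limit (cball x d) (\<lambda>n w. \<Prod>i<n. 1 - w * q ^ i) (qprod q) sequentially"
    by (intro exI[of _ 1]) auto
qed (auto intro!: holomorphic_intros)

lemma qprod_holomorphic_compose:
  assumes "cmod q < 1" "f holomorphic_on A"
  shows "(\<lambda>z. qprod q (f z)) holomorphic_on A"
  using holomorphic_on_compose_gen[OF assms(2) qprod_holomorphic[OF assms(1)]] by (simp add: o_def)

lemma qprod_even_odd:
  assumes "cmod q < 1"
  shows "qprod (q\<^sup>2) w * qprod (q\<^sup>2) (w * q) = qprod q w"
proof (rule LIMSEQ_unique)
  have q2: "cmod (q\<^sup>2) < 1"
    using assms by (simp add: norm_power power_less_one_iff)
  show "(\<lambda>n. (\<Prod>i<n. 1 - w * (q\<^sup>2) ^ i) * (\<Prod>i<n. 1 - w * q * (q\<^sup>2) ^ i))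
      \<longlonglongrightarrow> qprod (q\<^sup>2) w * qprod (q\<^sup>2) (w * q)"
    by (intro tendsto_mult qprod_LIMSEQ q2)
  have "(\<Prod>i<2 * n. 1 - w * q ^ i)
      = (\<Prod>i<n. 1 - w * (q\<^sup>2) ^ i) * (\<Prod>i<n. 1 - w * q * (q\<^sup>2) ^ i)" for n
    by (induction n) (simp_all add: power_mult[symmetric] mult_ac)
  then show "(\<lambda>n. (\<Prod>i<n. 1 - w * (q\<^sup>2) ^ i) * (\<Prod>i<n. 1 - w * q * (q\<^sup>2) ^ i))
      \<longlonglongrightarrow> qprod q w"
    using LIMSEQ_subseq_LIMSEQ[OF qprod_LIMSEQ[OF assms, of w], of "\<lambda>n. 2 * n"]
    by (simp add: o_def strict_mono_def)
qed

lemma qprod_plus_minus: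
  assumes "cmod q < 1"
  shows "qprod q w * qprod q (- w) = qprod (q\<^sup>2) (w\<^sup>2)"
proof -
  have "qprod q w * qprod q (- w) = (\<Prod>n. (1 - w * q ^ n) * (1 - (- w) * q ^ n))"
    unfolding qprod_def by (intro prodinf_mult qprod_convergent assms)
  also have "(\<lambda>n. (1 - w * q ^ n) * (1 - (- w) * q ^ n)) = (\<lambda>n. 1 - w\<^sup>2 * (q\<^sup>2) ^ n)"
    by (auto simp: fun_eq_iff algebra_simps power2_eq_square power_mult_distrib)
  finally show ?thesis by (simp add: qprod_def)
qed

text \<open>
  With \<open>q = s\<^sup>2\<close> this is Euler's identity \<open>(-q; q) (q; q\<^sup>2) = 1\<close>, in which \<open>(q; q\<^sup>2)\<close> is split
  as \<open>(s; q) (-s; q)\<close>. It follows by multiplying with \<open>(q; q) (q\<^sup>2; q\<^sup>2)\<close>: factors with opposite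
  arguments combine to a product in \<open>q\<^sup>2\<close>, and even and odd exponents combine to a product in
  \<open>q\<close>.
\<close>
lemma qprod_half_periods:
  assumes "cmod s < 1" "s \<noteq> 0"
  shows "qprod (s\<^sup>2) (- (s\<^sup>2)) * (qprod (s\<^sup>2) s * qprod (s\<^sup>2) (- s)) = 1"
proof -
  define q where "q = s\<^sup>2"
  have q: "cmod q < 1" and q2: "cmod (q\<^sup>2) < 1"
    using assms by (simp_all add: q_def norm_power power_less_one_iff)
  have a: "qprod q s * qprod q (- s) = qprod (q\<^sup>2) q"
    using qprod_plus_minus[OF q, of s] by (simp add: q_def)
  have b: "qprod q q * qprod q (- q) = qprod (q\<^sup>2) (q\<^sup>2)"
    by (rule qprod_plus_minus[OF q])
  have c: "qprod (q\<^sup>2) q * qprod (q\<^sup>2) (q\<^sup>2) = qprod q q"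
    using qprod_even_odd[OF q, of q] by (simp add: power2_eq_square)
  have nz: "qprod q q \<noteq> 0" "qprod (q\<^sup>2) (q\<^sup>2) \<noteq> 0"
    using qprod_nonzero q q2 by auto
  have "qprod q (- q) * qprod (q\<^sup>2) q * qprod q q * qprod (q\<^sup>2) (q\<^sup>2)
      = qprod q q * qprod (q\<^sup>2) (q\<^sup>2)"
    using b c by (metis (no_types, lifting) mult.assoc mult.commute)
  then have "qprod q (- q) * qprod (q\<^sup>2) q = 1"
    using nz by (simp add: mult.assoc)
  then show ?thesis unfolding a q_def[symmetric] by simp
qed

text \<open>
  Jacobi's first theta function in product form, without its constant factors and normalised to
  be odd. With \<open>w\<close> for \<open>exp (2 \<pi> i z)\<close>, its factors are \<open>1 - w q\<^sup>n\<close> for \<open>n \<ge> 0\<close> and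
  \<open>1 - q\<^sup>n / w\<close> for \<open>n \<ge> 1\<close>.
\<close>
definition theta :: "complex \<Rightarrow> complex \<Rightarrow> complex" where
  "theta \<tau> z = exp (- (\<i> * pi * z)) * qprod (exp (2 * pi * \<i> * \<tau>)) (exp (2 * pi * \<i> * z))
     * qprod (exp (2 * pi * \<i> * \<tau>)) (exp (2 * pi * \<i> * (\<tau> - z)))"

lemma norm_nome:
  assumes "Im \<tau> > 0"
  shows "cmod (exp (2 * pi * \<i> * \<tau>)) < 1"
  using assms by simp

lemma theta_holomorphic:
  assumes "Im \<tau> > 0"
  shows "theta \<tau> holomorphic_on UNIV"
proof -
  let ?q = "exp (2 * pi * \<i> * \<tau>)"
  have "(\<lambda>z. qprod ?q (exp (2 * pi * \<i> * z))) holomorphic_on UNIV"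
       "(\<lambda>z. qprod ?q (exp (2 * pi * \<i> * (\<tau> - z)))) holomorphic_on UNIV"
    by (intro qprod_holomorphic_compose norm_nome[OF assms] holomorphic_intros)+
  then show ?thesis
    unfolding theta_def[abs_def] by (intro holomorphic_intros)
qed

lemma theta_plus_1: "theta \<tau> (z + 1) = - theta \<tau> z"
proof -
  have "exp (2 * pi * \<i> * (z + 1)) = exp (2 * pi * \<i> * z)"
    by (simp add: distrib_left exp_add)
  moreover have "exp (2 * pi * \<i> * (\<tau> - (z + 1))) = exp (2 * pi * \<i> * (\<tau> - z))"
    by (simp add: algebra_simps exp_add exp_diff)
  moreover have "exp (- (\<i> * pi * (z + 1))) = - exp (- (\<i> * pi * z))"
    by (simp add: algebra_simps exp_diff exp_minus divide_inverse)
  ultimately show ?thesis by (simp add: theta_def)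
qed

lemma theta_uminus:
  assumes "Im \<tau> > 0"
  shows "theta \<tau> (- z) = - theta \<tau> z"
proof -
  let ?q = "exp (2 * pi * \<i> * \<tau>)" and ?w = "exp (2 * pi * \<i> * z)" 
  have a: "exp (2 * pi * \<i> * - z) = inverse ?w" "exp (2 * pi * \<i> * (\<tau> - - z)) = ?w * ?q"
       "exp (2 * pi * \<i> * (\<tau> - z)) = inverse ?w * ?q"
    by (simp_all add: algebra_simps exp_add exp_minus exp_diff field_simps)
  have b: "exp (- (\<i> * pi * - z)) = exp (- (\<i> * pi * z)) * ?w"
    by (simp add: exp_add[symmetric] algebra_simps)
  have c: "?w * (1 - inverse ?w) = - (1 - ?w)"
    by (simp add: algebra_simps)
  have gen: "u * x * A * B = - (u * (y * B) * A)" if "x = - y" for u x y A B :: complex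
    by (simp add: that mult_ac)
  have "theta \<tau> (- z) = exp (- (\<i> * pi * z)) * (?w * (1 - inverse ?w)) * qprod ?q (inverse ?w * ?q) * qprod ?q (?w * ?q)"
    unfolding theta_def a b using qprod_shift[OF norm_nome[OF assms], of "inverse ?w"] by simp
  also have "\<dots> = - theta \<tau> z"
    unfolding theta_def a using qprod_shift[OF norm_nome[OF assms], of ?w] gen[OF c] by simp
  finally show ?thesis .
qed

lemma theta_plus_tau:
  assumes "Im \<tau> > 0"
  shows "theta \<tau> (z + \<tau>) = - exp (- (\<i> * pi * \<tau>) - 2 * pi * \<i> * z) * theta \<tau> z"
proof -
  let ?q = "exp (2 * pi * \<i> * \<tau>)" and ?w = "exp (2 * pi * \<i> * z)" 
  have a: "exp (2 * pi * \<i> * (z + \<tau>)) = ?w * ?q" "exp (2 * pi * \<i> * (\<tau> - (z + \<tau>))) = inverse ?w"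
       "exp (2 * pi * \<i> * (\<tau> - z)) = inverse ?w * ?q"
    by (simp_all add: algebra_simps exp_add exp_minus exp_diff field_simps)
  have b: "exp (- (\<i> * pi * (z + \<tau>))) = exp (- (\<i> * pi * \<tau>)) * exp (- (\<i> * pi * z))"
          "exp (- (\<i> * pi * \<tau>) - 2 * pi * \<i> * z) = exp (- (\<i> * pi * \<tau>)) * inverse ?w"
    by (simp_all add: exp_add[symmetric] exp_minus[symmetric] algebra_simps)
  have c: "1 - inverse ?w = - (inverse ?w * (1 - ?w))"
    by (simp add: algebra_simps)
  have "theta \<tau> (z + \<tau>) = exp (- (\<i> * pi * \<tau>)) * exp (- (\<i> * pi * z)) * qprod ?q (?w * ?q) * ((1 - inverse ?w) * qprod ?q (inverse ?w * ?q))"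
    unfolding theta_def a b using qprod_shift[OF norm_nome[OF assms], of "inverse ?w"] by simp
  also have "\<dots> = - exp (- (\<i> * pi * \<tau>) - 2 * pi * \<i> * z) * theta \<tau> z"
    unfolding theta_def a b c using qprod_shift[OF norm_nome[OF assms], of ?w] by (simp add: mult_ac)
  finally show ?thesis .
qed

lemma theta_zeros:
  assumes "Im \<tau> > 0" "theta \<tau> z = 0"
  shows "\<exists>m k. z = of_int m + of_int k * \<tau>"
proof -
  let ?q = "exp (2 * pi * \<i> * \<tau>)"
  have *: "\<exists>m. x = of_int m" if "exp (2 * pi * \<i> * x) = 1" for x :: complex
  proof -
    from that obtain n :: int where "Re x = of_int n" "Im x = 0"
      by (auto simp: exp_eq_1)
    then have "x = of_int n" by (simp add: complex_eq_iff)
    then show ?thesis by blast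
  qed
  consider n where "exp (2 * pi * \<i> * z) * ?q ^ n = 1" | n where "exp (2 * pi * \<i> * (\<tau> - z)) * ?q ^ n = 1"
    using assms unfolding theta_def mult_eq_0_iff qprod_eq_0_iff[OF norm_nome[OF assms(1)]] by auto
  then show ?thesis
  proof cases
    case 1
    then have "exp (2 * pi * \<i> * (z + of_nat n * \<tau>)) = 1"
      by (simp add: exp_add[symmetric] exp_of_nat_mult[symmetric] algebra_simps)
    from *[OF this] obtain m where "z + of_nat n * \<tau> = of_int m" by blast
    then have "z = of_int m + of_int (- int n) * \<tau>" by (simp add: algebra_simps)
    then show ?thesis by blast
  next
    case 2
    then have "exp (2 * pi * \<i> * (\<tau> - z + of_nat n * \<tau>)) = 1"
      by (simp add: exp_add[symmetric] exp_of_nat_mult[symmetric] algebra_simps)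
    from *[OF this] obtain m where "\<tau> - z + of_nat n * \<tau> = of_int m" by blast
    then have "z = of_int (- m) + of_int (int n + 1) * \<tau>" by (simp add: algebra_simps)
    then show ?thesis by blast
  qed
qed

lemma theta_0 [simp]: "theta \<tau> 0 = 0"
  if "Im \<tau> > 0"
  using theta_uminus[OF that, of 0] by simp

text \<open>
  The zero at \<open>0\<close> comes from the single factor \<open>1 - exp (2 \<pi> i z)\<close>; the other factors have at
  \<open>0\<close> the product \<open>(q; q)\<^sup>2\<close>. In this way the eta product is recovered from the theta function.
\<close>
lemma theta_deriv_0:
  assumes "Im \<tau> > 0"
  shows "(theta \<tau> has_field_derivative - (2 * pi * \<i>) * (qprod (exp (2 * pi * \<i> * \<tau>)) (exp (2 * pi * \<i> * \<tau>)))\<^sup>2) (at 0)"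
proof -
  let ?q = "exp (2 * pi * \<i> * \<tau>)"
  define g where "g = (\<lambda>z. exp (- (\<i> * pi * z)) * qprod ?q (exp (2 * pi * \<i> * z) * ?q)
     * qprod ?q (exp (2 * pi * \<i> * (\<tau> - z))))"
  have eq: "theta \<tau> z = (1 - exp (2 * pi * \<i> * z)) * g z" for z
    unfolding theta_def g_def using qprod_shift[OF norm_nome[OF assms], of "exp (2 * pi * \<i> * z)"] by simp
  have "(\<lambda>z. qprod ?q (exp (2 * pi * \<i> * z) * ?q)) holomorphic_on UNIV"
       "(\<lambda>z. qprod ?q (exp (2 * pi * \<i> * (\<tau> - z)))) holomorphic_on UNIV"
    by (intro qprod_holomorphic_compose norm_nome[OF assms] holomorphic_intros)+
  then have "g holomorphic_on UNIV"
    unfolding g_def by (intro holomorphic_intros)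
  then have "(g has_field_derivative deriv g 0) (at 0)"
    by (intro holomorphic_derivI[of _ UNIV]) auto
  then have "((\<lambda>z. (1 - exp (2 * pi * \<i> * z)) * g z) has_field_derivative - (2 * pi * \<i>) * g 0) (at 0)"
    by (auto intro!: derivative_eq_intros)
  then show ?thesis by (simp add: eq[abs_def] g_def power2_eq_square mult_ac)
qed

section \<open>Inversion of the eta function\<close>

lemma period_int_multiple:
  fixes g :: "complex \<Rightarrow> complex"
  assumes "\<And>z. g (z + p) = g z"
  shows "g (z + of_int k * p) = g z"
proof (induction k rule: int_induct[where k = 0])
  case (step1 i)
  then show ?case using assms[of "z + of_int i * p"] by (simp add: algebra_simps)
next
  case (step2 i)
  then show ?case using assms[of "z + of_int (i - 1) * p"] by (simp add: algebra_simps)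
qed simp

text \<open>
  The quotient \<open>\<phi> / \<theta>\<close> is doubly periodic. Its only possible singularities are the lattice
  points; there \<open>\<theta>\<close> has simple zeros and \<open>\<phi>\<close> vanishes, so they are removable. Being entire and
  bounded, the quotient is constant by Liouville's theorem.
\<close>
lemma theta_quotient_constant:
  assumes \<tau>: "Im \<tau> > 0" and holo: "\<phi> holomorphic_on UNIV" and zero: "\<phi> 0 = 0"
    and p1: "\<And>z. \<phi> (z + 1) = - \<phi> z"
    and p\<tau>: "\<And>z. \<phi> (z + \<tau>) = - exp (- (\<i> * pi * \<tau>) - 2 * pi * \<i> * z) * \<phi> z"
  shows "\<exists>C. \<forall>z. \<phi> z = C * theta \<tau> z"
proof -
  let ?q = "exp (2 * pi * \<i> * \<tau>)"
  define D where "D = - (2 * pi * \<i>) * (qprod ?q ?q)\<^sup>2"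
  have D: "(theta \<tau> has_field_derivative D) (at 0)"
    unfolding D_def by (rule theta_deriv_0[OF \<tau>])
  have "D \<noteq> 0"
    using qprod_nonzero[OF norm_nome[OF \<tau>] norm_nome[OF \<tau>]] by (simp add: D_def)
  define L where "L = deriv \<phi> 0 / D"
  define g where "g = (\<lambda>z. if theta \<tau> z = 0 then L else \<phi> z / theta \<tau> z)"
  have g1: "g (z + 1) = g z" for z
    by (simp add: g_def theta_plus_1 p1)
  have g\<tau>: "g (z + \<tau>) = g z" for z
    by (simp add: g_def theta_plus_tau[OF \<tau>] p\<tau>)
  have glat: "g (z + (of_int m + of_int k * \<tau>)) = g z" for z m k
    using period_int_multiple[of g 1 z m, OF g1] period_int_multiple[of g \<tau> "z + of_int m" k, OF g\<tau>]
    by (simp add: add.assoc)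
  have cont: "continuous_on UNIV (theta \<tau>)"
    by (intro holomorphic_on_imp_continuous_on theta_holomorphic \<tau>)
  have op: "open {z. theta \<tau> z \<noteq> 0}"
    using open_Collect_neq[OF cont, of "\<lambda>_. 0"] by simp
  have holo_off: "g holomorphic_on {z. theta \<tau> z \<noteq> 0}"
  proof (rule holomorphic_transform)
    show "(\<lambda>z. \<phi> z / theta \<tau> z) holomorphic_on {z. theta \<tau> z \<noteq> 0}"
      using holo theta_holomorphic[OF \<tau>]
      by (intro holomorphic_intros) (auto intro: holomorphic_on_subset)
  qed (simp add: g_def)
  have lim\<theta>: "((\<lambda>z. theta \<tau> z / z) \<longlongrightarrow> D) (at 0)"
    using D \<tau> by (simp add: has_field_derivative_iff)
  have "(\<phi> has_field_derivative deriv \<phi> 0) (at 0)"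
    using holo by (intro holomorphic_derivI[of _ UNIV]) auto
  then have lim\<phi>: "((\<lambda>z. \<phi> z / z) \<longlongrightarrow> deriv \<phi> 0) (at 0)"
    by (simp add: has_field_derivative_iff zero)
  have ev: "\<forall>\<^sub>F z in at 0. theta \<tau> z \<noteq> 0"
    using tendsto_imp_eventually_ne[OF lim\<theta> \<open>D \<noteq> 0\<close>] by eventually_elim auto
  have lim0: "(g \<longlongrightarrow> g 0) (at 0)"
  proof -
    have "((\<lambda>z. (\<phi> z / z) / (theta \<tau> z / z)) \<longlongrightarrow> L) (at 0)"
      unfolding L_def by (intro tendsto_divide lim\<phi> lim\<theta> \<open>D \<noteq> 0\<close>)
    moreover have "\<forall>\<^sub>F z in at 0. (\<phi> z / z) / (theta \<tau> z / z) = g z"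
      using ev eventually_neq_at_within[of 0] by eventually_elim (auto simp: g_def)
    ultimately have "(g \<longlongrightarrow> L) (at 0)"
      by (rule Lim_transform_eventually)
    then show ?thesis using \<tau> by (simp add: g_def)
  qed
  obtain e where e: "e > 0" "\<And>z. z \<noteq> 0 \<Longrightarrow> dist z 0 < e \<Longrightarrow> theta \<tau> z \<noteq> 0"
    using ev unfolding eventually_at by auto
  have "g holomorphic_on ball 0 e"
  proof (rule no_isolated_singularity'[where K = "{0}"])
    show "(g \<longlongrightarrow> g z) (at z within ball 0 e)" if "z \<in> {0}" for z
      using lim0 that by (auto intro: tendsto_within_subset)
    show "g holomorphic_on ball 0 e - {0}"
      by (rule holomorphic_on_subset[OF holo_off]) (use e in \<open>auto simp: dist_commute\<close>)
  qed auto
  then have diff0: "g field_differentiable at 0"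
    using e by (meson centre_in_ball holomorphic_on_imp_differentiable_at open_ball)
  have "g field_differentiable at z" for z
  proof (cases "theta \<tau> z = 0")
    case False
    then show ?thesis
      using holomorphic_on_imp_differentiable_at[OF holo_off op] by simp
  next
    case True
    then obtain m k where z: "z = of_int m + of_int k * \<tau>"
      using theta_zeros[OF \<tau>] by blast
    have "g = g \<circ> (\<lambda>w. w - z)"
      using glat[of "w - z" m k for w] by (auto simp: fun_eq_iff z)
    moreover have "(g \<circ> (\<lambda>w. w - z)) field_differentiable at z"
      by (rule field_differentiable_compose) (use diff0 in \<open>auto intro!: derivative_intros\<close>)
    ultimately show ?thesis by simp
  qed
  then have gholo: "g holomorphic_on UNIV"
    by (simp add: holomorphic_on_def field_differentiable_at_within)
  define K where "K = (\<lambda>(s, t). of_real s + of_real t * \<tau>) ` ({0..1::real} \<times> {0..1::real})"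
  have "compact K"
    unfolding K_def by (intro compact_continuous_image compact_Times)
      (auto intro!: continuous_intros simp: split_beta)
  then have "compact (g ` K)"
    by (intro compact_continuous_image holomorphic_on_imp_continuous_on)
      (auto intro: holomorphic_on_subset[OF gholo])
  moreover have "range g \<subseteq> g ` K"
  proof (rule image_subsetI)
    fix z :: complex
    define t where "t = Im z / Im \<tau>"
    define s where "s = Re z - t * Re \<tau>"
    have z: "z = of_real s + of_real t * \<tau>"
      using \<tau> by (simp add: complex_eq_iff s_def t_def)
    have "z = (of_real (frac s) + of_real (frac t) * \<tau>) + (of_int \<lfloor>s\<rfloor> + of_int \<lfloor>t\<rfloor> * \<tau>)"
      unfolding z by (simp add: frac_def complex_eq_iff algebra_simps)
    then have "g z = g (of_real (frac s) + of_real (frac t) * \<tau>)"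
      using glat by metis
    moreover have "of_real (frac s) + of_real (frac t) * \<tau> \<in> K"
      unfolding K_def image_iff
      by (rule bexI[of _ "(frac s, frac t)"]) (auto simp: frac_lt_1 less_imp_le)
    ultimately show "g z \<in> g ` K" by simp
  qed
  ultimately have "bounded (range g)"
    using bounded_subset compact_imp_bounded by blast
  then obtain C where C: "g z = C" for z
    using Liouville_theorem[OF gholo] by (auto simp: constant_on_def)
  have "\<phi> z = C * theta \<tau> z" for z
  proof (cases "theta \<tau> z = 0")
    case False
    then show ?thesis using C[of z] by (auto simp: g_def field_simps)
  next
    case True
    then obtain m k where z: "z = of_int m + of_int k * \<tau>"
      using theta_zeros[OF \<tau>] by blast
    \<comment> \<open>The zero set of \<open>\<phi>\<close> is periodic, although \<open>\<phi>\<close> itself is not; the zero at \<open>0\<close> spreads to the lattice.\<close>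
    have *: "\<phi> (w + p) = 0 \<longleftrightarrow> \<phi> w = 0" if "p = 1 \<or> p = \<tau>" for w p
      using that p1 p\<tau> by auto
    define h where "h = (\<lambda>w. if \<phi> w = 0 then 0 else 1 :: complex)"
    have "h (w + 1) = h w" "h (w + \<tau>) = h w" for w
      using * by (simp_all add: h_def)
    then have "h (0 + of_int m * 1 + of_int k * \<tau>) = h 0"
      using period_int_multiple by metis
    then show ?thesis using True zero by (simp add: h_def z split: if_splits)
  qed
  then show ?thesis by blast
qed

text \<open>
  That the product over the half-periods is elementary is what determines the constant in the
  inversion formula for theta: the individual values are infinite products, but these cancel by
  Euler's identity.
\<close>
lemma theta_half_periods:
  assumes "Im \<tau> > 0"
  shows "theta \<tau> (1 / 2) * theta \<tau> (\<tau> / 2) * theta \<tau> ((1 + \<tau>) / 2) = - 2 * exp (- (\<i> * pi * \<tau>))"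
proof -
  let ?q = "exp (2 * pi * \<i> * \<tau>)"
  define s where "s = exp (\<i> * pi * \<tau>)"
  have q: "?q = s\<^sup>2"
    by (simp add: s_def exp_double[symmetric] mult_ac)
  have s: "cmod s < 1" "s \<noteq> 0"
    using assms by (simp_all add: s_def)
  have q1: "cmod (s\<^sup>2) < 1"
    using norm_nome[OF assms] by (simp only: q)
  have ei: "exp (\<i> * pi) = -1" "exp (- (\<i> * pi / 2)) = - \<i>"
  proof -
    show "exp (\<i> * pi) = -1" by (simp add: exp_pi_i')
    have "exp (- (\<i> * pi / 2)) = cis (- (pi / 2))"
      by (simp add: cis_conv_exp)
    then show "exp (- (\<i> * pi / 2)) = - \<i>"
      by (simp add: cis.ctr complex_eq_iff)
  qed
  have e1: "exp (2 * pi * \<i> * (1 / 2)) = -1" "exp (2 * pi * \<i> * (\<tau> - 1 / 2)) = - (s\<^sup>2)"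
    using ei(1) by (simp_all add: q[symmetric] right_diff_distrib exp_diff mult_ac)
  have e2: "exp (2 * pi * \<i> * (\<tau> / 2)) = s" "exp (2 * pi * \<i> * (\<tau> - \<tau> / 2)) = s"
    by (simp_all add: s_def mult_ac)
  have "2 * pi * \<i> * ((1 + \<tau>) / 2) = \<i> * pi + \<i> * pi * \<tau>"
       "2 * pi * \<i> * (\<tau> - (1 + \<tau>) / 2) = \<i> * pi * \<tau> - \<i> * pi"
    by (simp_all add: field_simps)
  then have e3: "exp (2 * pi * \<i> * ((1 + \<tau>) / 2)) = - s" "exp (2 * pi * \<i> * (\<tau> - (1 + \<tau>) / 2)) = - s"
    by (simp_all add: s_def exp_add exp_diff ei)
  have t1: "theta \<tau> (1 / 2) = - \<i> * (2 * (qprod (s\<^sup>2) (- (s\<^sup>2)))\<^sup>2)"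
    using qprod_shift[OF q1, of "-1"] ei unfolding theta_def e1 unfolding q
    by (simp add: power2_eq_square mult_ac)
  have t2: "theta \<tau> (\<tau> / 2) = exp (- (\<i> * pi * \<tau> / 2)) * (qprod (s\<^sup>2) s)\<^sup>2"
    unfolding theta_def e2 unfolding q by (simp add: power2_eq_square mult_ac)
  have "- (\<i> * pi * ((1 + \<tau>) / 2)) = - (\<i> * pi / 2) + - (\<i> * pi * \<tau> / 2)"
    by (simp add: field_simps)
  then have "exp (- (\<i> * pi * ((1 + \<tau>) / 2))) = - \<i> * exp (- (\<i> * pi * \<tau> / 2))"
    by (simp only: exp_add ei)
  then have t3: "theta \<tau> ((1 + \<tau>) / 2) = - \<i> * exp (- (\<i> * pi * \<tau> / 2)) * (qprod (s\<^sup>2) (- s))\<^sup>2"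
    unfolding theta_def e3 unfolding q by (simp add: power2_eq_square mult_ac)
  have "theta \<tau> (1 / 2) * theta \<tau> (\<tau> / 2) * theta \<tau> ((1 + \<tau>) / 2)
     = - 2 * (exp (- (\<i> * pi * \<tau> / 2)))\<^sup>2 *
       (qprod (s\<^sup>2) (- (s\<^sup>2)) * (qprod (s\<^sup>2) s * qprod (s\<^sup>2) (- s)))\<^sup>2"
    unfolding t1 t2 t3 by (simp add: power2_eq_square mult_ac)
  also have "\<dots> = - 2 * exp (- (\<i> * pi * \<tau>))"
    using qprod_half_periods[OF s] by (simp add: exp_double[symmetric])
  finally show ?thesis .
qed

text \<open>
  Put \<open>\<sigma> = -1/\<tau>\<close>. The function \<open>\<phi>(z) = exp (\<pi> i \<sigma> z\<^sup>2) \<theta>(z/\<tau>)\<close>, with the theta function for \<open>\<sigma>\<close>,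
  has the quasi-periods of the theta function for \<open>\<tau>\<close>, and is therefore a multiple \<open>C \<theta>\<close> of it.
  Division by \<open>\<tau>\<close> permutes the half-periods up to sign and periods, so that the products over
  the half-periods yield \<open>C\<^sup>3\<close> and thereby \<open>|C|\<close>. The derivatives at \<open>0\<close> then relate the two eta
  products.
\<close>
lemma qprod_S:
  assumes \<tau>: "Im \<tau> > 0"
  defines "q \<equiv> exp (2 * pi * \<i> * \<tau>)" and "q' \<equiv> exp (2 * pi * \<i> * (-1 / \<tau>))"
  shows "(cmod (qprod q' q'))\<^sup>2 = cmod \<tau> * exp (- pi * (Im \<tau> - Im (-1 / \<tau>)) / 6) * (cmod (qprod q q))\<^sup>2"
proof -
  define \<sigma> where "\<sigma> = -1 / \<tau>"
  have \<tau>0: "\<tau> \<noteq> 0" using \<tau> by auto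
  have q': "q' = exp (2 * pi * \<i> * \<sigma>)"
    by (simp add: q'_def \<sigma>_def)
  have \<sigma>: "Im \<sigma> > 0"
    using \<tau> \<tau>0 by (simp add: \<sigma>_def Im_divide zero_less_divide_iff sum_power2_gt_zero_iff complex_eq_iff)
  have \<tau>\<sigma>: "\<tau> * \<sigma> = -1" "1 / \<tau> = - \<sigma>" using \<tau>0 by (simp_all add: \<sigma>_def)
  define \<phi> where "\<phi> = (\<lambda>z. exp (\<i> * pi * \<sigma> * z\<^sup>2) * theta \<sigma> (- (\<sigma> * z)))"
  have "(\<lambda>z. theta \<sigma> (- (\<sigma> * z))) holomorphic_on UNIV"
    using holomorphic_on_compose_gen[OF _ theta_holomorphic[OF \<sigma>], of "\<lambda>z. - (\<sigma> * z)" UNIV]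
    by (auto simp: o_def intro!: holomorphic_intros)
  then have holo: "\<phi> holomorphic_on UNIV"
    unfolding \<phi>_def by (intro holomorphic_intros)
  have p\<tau>: "\<phi> (z + \<tau>) = - exp (- (\<i> * pi * \<tau>) - 2 * pi * \<i> * z) * \<phi> z" for z
  proof -
    have a: "- (\<sigma> * (z + \<tau>)) = - (\<sigma> * z) + 1" using \<tau>\<sigma> by (simp add: algebra_simps)
    have "\<sigma> * (z + \<tau>)\<^sup>2 = \<sigma> * z\<^sup>2 + 2 * (\<tau> * \<sigma>) * z + (\<tau> * \<sigma>) * \<tau>"
      by (simp add: algebra_simps power2_eq_square)
    then have "\<sigma> * (z + \<tau>)\<^sup>2 = \<sigma> * z\<^sup>2 - 2 * z - \<tau>"
      using \<tau>\<sigma> by simp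
    then have b: "\<i> * pi * \<sigma> * (z + \<tau>)\<^sup>2 = (- (\<i> * pi * \<tau>) - 2 * pi * \<i> * z) + \<i> * pi * \<sigma> * z\<^sup>2"
      by (simp only: mult.assoc) (simp add: algebra_simps)
    show ?thesis
      unfolding \<phi>_def a b theta_plus_1 exp_add by simp
  qed
  have p1: "\<phi> (z + 1) = - \<phi> z" for z
  proof -
    have "theta \<sigma> (- (\<sigma> * z)) = theta \<sigma> (- (\<sigma> * (z + 1)) + \<sigma>)"
      by (simp add: algebra_simps)
    also have "\<dots> = - exp (- (\<i> * pi * \<sigma>) - 2 * pi * \<i> * - (\<sigma> * (z + 1))) * theta \<sigma> (- (\<sigma> * (z + 1)))"
      by (rule theta_plus_tau[OF \<sigma>])
    finally have "\<phi> z = - (exp (\<i> * pi * \<sigma> * z\<^sup>2) * exp (- (\<i> * pi * \<sigma>) - 2 * pi * \<i> * - (\<sigma> * (z + 1)))) * theta \<sigma> (- (\<sigma> * (z + 1)))"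
      by (simp add: \<phi>_def)
    also have "exp (\<i> * pi * \<sigma> * z\<^sup>2) * exp (- (\<i> * pi * \<sigma>) - 2 * pi * \<i> * - (\<sigma> * (z + 1)))
        = exp (\<i> * pi * \<sigma> * (z + 1)\<^sup>2)"
      by (simp add: exp_add[symmetric] algebra_simps power2_eq_square)
    finally show ?thesis by (simp add: \<phi>_def)
  qed
  obtain C where C: "\<And>z. \<phi> z = C * theta \<tau> z"
    using theta_quotient_constant[OF \<tau> holo _ p1 p\<tau>] \<sigma> by (auto simp: \<phi>_def)
  have h1: "\<phi> (1 / 2) = - exp (\<i> * pi * \<sigma> / 4) * theta \<sigma> (\<sigma> / 2)"
    using theta_uminus[OF \<sigma>, of "\<sigma> / 2"] by (simp add: \<phi>_def power2_eq_square)
  have h2: "\<phi> (\<tau> / 2) = exp (- (\<i> * pi * \<tau> / 4)) * theta \<sigma> (1 / 2)"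
  proof -
    have "\<sigma> * (\<tau> / 2) = - (1 / 2)" using \<tau>\<sigma> by (simp add: mult_ac)
    moreover have "\<sigma> * (\<tau> / 2)\<^sup>2 = (\<tau> * \<sigma>) * \<tau> / 4" by (simp add: power2_eq_square)
    ultimately show ?thesis unfolding \<phi>_def mult.assoc using \<tau>\<sigma> by (simp add: mult.assoc)
  qed
  have h3: "\<phi> ((1 + \<tau>) / 2) = exp (\<i> * pi * (\<sigma> - 2 - \<tau>) / 4) * theta \<sigma> ((1 + \<sigma>) / 2)"
  proof -
    have a: "- (\<sigma> * ((1 + \<tau>) / 2)) = (1 - \<sigma>) / 2" using \<tau>\<sigma> by (simp add: field_simps)
    have "\<sigma> * ((1 + \<tau>) / 2)\<^sup>2 = (\<sigma> + 2 * (\<tau> * \<sigma>) + (\<tau> * \<sigma>) * \<tau>) / 4"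
      by (simp add: field_simps power2_eq_square)
    then have b: "\<i> * pi * \<sigma> * ((1 + \<tau>) / 2)\<^sup>2 = \<i> * pi * (\<sigma> - 2 - \<tau>) / 4"
      unfolding \<tau>\<sigma> by (simp add: mult.assoc)
    have "theta \<sigma> ((1 + \<sigma>) / 2) = theta \<sigma> ((1 - \<sigma>) / 2 + \<sigma>)"
      by (simp add: field_simps)
    also have "\<dots> = - exp (- (\<i> * pi * \<sigma>) - 2 * pi * \<i> * ((1 - \<sigma>) / 2)) * theta \<sigma> ((1 - \<sigma>) / 2)"
      by (rule theta_plus_tau[OF \<sigma>])
    also have "- (\<i> * pi * \<sigma>) - 2 * pi * \<i> * ((1 - \<sigma>) / 2) = - (\<i> * pi)"
      by (simp add: field_simps)
    finally have "theta \<sigma> ((1 - \<sigma>) / 2) = theta \<sigma> ((1 + \<sigma>) / 2)"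
      by (simp add: exp_minus exp_pi_i')
    then show ?thesis unfolding \<phi>_def a b by simp
  qed
  have "C ^ 3 * (- 2 * exp (- (\<i> * pi * \<tau>))) = \<phi> (1 / 2) * \<phi> (\<tau> / 2) * \<phi> ((1 + \<tau>) / 2)"
    unfolding C theta_half_periods[OF \<tau>, symmetric] by (simp add: power3_eq_cube mult_ac)
  also have "\<dots> = - (exp (\<i> * pi * \<sigma> / 4) * exp (- (\<i> * pi * \<tau> / 4)) * exp (\<i> * pi * (\<sigma> - 2 - \<tau>) / 4))
      * (theta \<sigma> (1 / 2) * theta \<sigma> (\<sigma> / 2) * theta \<sigma> ((1 + \<sigma>) / 2))"
    unfolding h1 h2 h3 by (simp add: mult_ac)
  finally have "cmod (C ^ 3 * (- 2 * exp (- (\<i> * pi * \<tau>)))) =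
      cmod (- (exp (\<i> * pi * \<sigma> / 4) * exp (- (\<i> * pi * \<tau> / 4)) * exp (\<i> * pi * (\<sigma> - 2 - \<tau>) / 4))
      * (- 2 * exp (- (\<i> * pi * \<sigma>))))"
    unfolding theta_half_periods[OF \<sigma>] by (rule arg_cong)
  then have "cmod C ^ 3 * (2 * exp (pi * Im \<tau>)) =
      2 * (exp (- (pi * Im \<sigma> / 4)) * exp (pi * Im \<tau> / 4) * exp (- (pi * (Im \<sigma> - Im \<tau>) / 4)) * exp (pi * Im \<sigma>))"
    by (simp add: norm_mult norm_power)
  also have "exp (- (pi * Im \<sigma> / 4)) * exp (pi * Im \<tau> / 4) * exp (- (pi * (Im \<sigma> - Im \<tau>) / 4)) * exp (pi * Im \<sigma>)
      = exp (pi * (Im \<sigma> + Im \<tau>) / 2)"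
    by (simp add: exp_add[symmetric] field_simps)
  finally have "cmod C ^ 3 = exp (pi * (Im \<sigma> + Im \<tau>) / 2) / exp (pi * Im \<tau>)"
    by (simp add: field_simps)
  also have "\<dots> = exp (pi * (Im \<sigma> - Im \<tau>) / 6) ^ 3"
    by (simp add: exp_diff[symmetric] exp_of_nat_mult[symmetric] field_simps)
  finally have normC: "cmod C = exp (pi * (Im \<sigma> - Im \<tau>) / 6)"
    by (metis exp_ge_zero norm_ge_zero power_eq_imp_eq_base zero_less_numeral)
  define K where "K = - (2 * pi * \<i>) * (qprod q' q')\<^sup>2"
  have "(\<phi> has_field_derivative - \<sigma> * K) (at 0)"
  proof -
    have th: "((\<lambda>z. theta \<sigma> (- (\<sigma> * z))) has_field_derivative K * - \<sigma>) (at 0)"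
      by (rule DERIV_chain2[of "theta \<sigma>"])
        (use theta_deriv_0[OF \<sigma>] in \<open>auto simp: q' K_def intro!: derivative_eq_intros\<close>)
    have e: "((\<lambda>z. exp (\<i> * pi * \<sigma> * z\<^sup>2)) has_field_derivative 0) (at 0)"
      by (auto intro!: derivative_eq_intros)
    show ?thesis
      unfolding \<phi>_def by (rule DERIV_cong[OF DERIV_mult[OF e th]]) simp
  qed
  moreover have "(\<phi> has_field_derivative C * (- (2 * pi * \<i>) * (qprod q q)\<^sup>2)) (at 0)"
    unfolding C[abs_def] q_def by (intro DERIV_cmult theta_deriv_0 \<tau>)
  ultimately have "- \<sigma> * K = C * (- (2 * pi * \<i>) * (qprod q q)\<^sup>2)"
    by (rule DERIV_unique)
  then have "- (2 * pi * \<i>) * (- \<sigma> * (qprod q' q')\<^sup>2) = - (2 * pi * \<i>) * (C * (qprod q q)\<^sup>2)"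
    by (simp only: mult_ac K_def)
  moreover have "- (2 * pi * \<i>) \<noteq> (0 :: complex)" by simp
  ultimately have "- \<sigma> * (qprod q' q')\<^sup>2 = C * (qprod q q)\<^sup>2"
    using mult_left_cancel by blast
  then have "(qprod q' q')\<^sup>2 = \<tau> * C * (qprod q q)\<^sup>2"
    using \<tau>0 by (simp add: \<sigma>_def field_simps)
  then have "cmod ((qprod q' q')\<^sup>2) = cmod (\<tau> * C * (qprod q q)\<^sup>2)" by simp
  moreover have "- pi * (Im \<tau> - Im (-1 / \<tau>)) / 6 = pi * (Im \<sigma> - Im \<tau>) / 6"
    unfolding \<sigma>_def by (simp add: field_simps)
  ultimately show ?thesis
    by (simp only: norm_mult norm_power normC)
qed

lemma eta_eq_qprod: "eta \<tau> = exp (\<i> * pi * \<tau> / 12) * qprod (exp (2 * pi * \<i> * \<tau>)) (exp (2 * pi * \<i> * \<tau>))"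
proof -
  have "exp (\<i> * pi * \<tau>) ^ (2 * (n + 1)) = exp (2 * pi * \<i> * \<tau>) * exp (2 * pi * \<i> * \<tau>) ^ n" for n
  proof -
    have "(exp (\<i> * pi * \<tau>))\<^sup>2 = exp (2 * pi * \<i> * \<tau>)"
      by (simp add: exp_double[symmetric] mult_ac)
    then show ?thesis by (simp only: power_mult) simp
  qed
  then show ?thesis by (simp add: eta_def qprod_def)
qed

lemma Im_inversion: "Im (-1 / \<tau>) = Im \<tau> / (cmod \<tau>)\<^sup>2"
  by (simp add: Im_divide cmod_power2)

theorem norm_eta_S:
  assumes "Im \<tau> > 0"
  shows "(cmod (eta (-1 / \<tau>)))\<^sup>2 = cmod \<tau> * (cmod (eta \<tau>))\<^sup>2"
proof -
  have e: "(cmod (eta \<tau>))\<^sup>2 = exp (- (pi * Im \<tau> / 6)) * (cmod (qprod (exp (2 * pi * \<i> * \<tau>)) (exp (2 * pi * \<i> * \<tau>))))\<^sup>2" for \<tau>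
    by (simp add: eta_eq_qprod norm_mult power_mult_distrib exp_double[symmetric])
  show ?thesis
    unfolding e qprod_S[OF assms]
    by (simp add: exp_add[symmetric] algebra_simps exp_minus exp_diff field_simps)
qed

lemma Z_FF_S:
  assumes "Im \<tau> > 0"
  shows "Z_FF (-1 / \<tau>) = Z_FF \<tau>"
proof -
  have "cmod \<tau> > 0" using assms by auto
  then show ?thesis
    unfolding Z_FF_def norm_eta_S[OF assms] Im_inversion by (simp add: real_sqrt_divide)
qed

lemma Z_FF_T: "Z_FF (\<tau> + 1) = Z_FF \<tau>"
proof -
  have "exp (2 * pi * \<i> * (\<tau> + 1)) = exp (2 * pi * \<i> * \<tau>)"
    by (simp add: distrib_left exp_add)
  moreover have "cmod (exp (\<i> * pi * (\<tau> + 1) / 12)) = cmod (exp (\<i> * pi * \<tau> / 12))"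
    by simp
  ultimately show ?thesis by (simp add: Z_FF_def eta_eq_qprod norm_mult)
qed

section \<open>The modular group\<close>

text \<open>
  Euclid's algorithm on the left column \<open>(a, c)\<close>: powers of \<open>T\<close>, acting from the left, reduce
  \<open>a\<close> modulo \<open>c\<close>, and \<open>S\<close> exchanges the two entries up to sign.
\<close>
lemma SL2_induct [case_names det one T S]:
  fixes P :: "int \<Rightarrow> int \<Rightarrow> int \<Rightarrow> int \<Rightarrow> bool"
  assumes det: "a * d - b * c = 1"
    and one: "P 1 0 0 1"
    and T: "\<And>a b c d k. a * d - b * c = 1 \<Longrightarrow> P a b c d \<Longrightarrow> P (a + k * c) (b + k * d) c d"
    and S: "\<And>a b c d. a * d - b * c = 1 \<Longrightarrow> P a b c d \<Longrightarrow> P (- c) (- d) a b"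
  shows "P a b c d"
  using det
proof (induction "nat \<bar>c\<bar>" arbitrary: a b c d rule: less_induct)
  case less
  show ?case
  proof (cases "c = 0")
    case False
    define k where "k = a div c"
    let ?a = "a - k * c" and ?b = "b - k * d"
    have a: "?a = a mod c"
      by (simp add: k_def minus_div_mult_eq_mod)
    have det1: "c * - ?b - d * - ?a = 1" and det2: "?a * d - ?b * c = 1"
      using less.prems by (simp_all add: algebra_simps)
    have "nat \<bar>- ?a\<bar> < nat \<bar>c\<bar>"
      unfolding a using False abs_mod_less[of c a] by simp
    from less.hyps[OF this det1] have "P c d (- ?a) (- ?b)" .
    from S[OF det1 this] have "P ?a ?b c d" by simp
    from T[OF det2 this, of k] show ?thesis by simp
  next
    case True
    then have "a * d = 1" using less.prems by simp
    then have ad: "(a = 1 \<and> d = 1) \<or> (a = -1 \<and> d = -1)"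
      by (auto simp: zmult_eq_1_iff)
    have "P (- 1) 0 0 (- 1)"
      using S[OF _ S[OF _ one]] by simp
    from T[OF _ this, of "- b"] have "P (- 1) b 0 (- 1)" by simp
    moreover have "P 1 b 0 1"
      using T[OF _ one, of b] by simp
    ultimately show ?thesis using ad True by auto
  qed
qed

lemma moebius_denominator_nonzero:
  assumes "Im \<tau> > 0" "a * d - b * c = (1::int)"
  shows "of_int c * \<tau> + of_int d \<noteq> 0"
proof
  assume *: "of_int c * \<tau> + of_int d = 0"
  then have "Im (of_int c * \<tau> + of_int d) = 0" by simp
  then have "c = 0" using assms by simp
  with * have "d = 0" by simp
  with \<open>c = 0\<close> assms(2) show False by simp
qed

lemma Im_moebius_map:
  assumes "Im \<tau> > 0" "a * d - b * c = 1"
  shows "Im (moebius_map a b c d \<tau>) = Im \<tau> / (cmod (of_int c * \<tau> + of_int d))\<^sup>2"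
proof -
  have "real_of_int a * real_of_int d - real_of_int b * real_of_int c = 1"
    using assms(2) by (metis of_int_1 of_int_diff of_int_mult)
  then have *: "x * (real_of_int a * real_of_int d - real_of_int b * real_of_int c) = x" for x by simp
  show ?thesis
    unfolding moebius_map_def Im_divide cmod_power2 using *[of "Im \<tau>"] 
    by (simp add: algebra_simps)
qed

lemma Im_moebius_map_pos:
  assumes "Im \<tau> > 0" "a * d - b * c = 1"
  shows "Im (moebius_map a b c d \<tau>) > 0"
  using Im_moebius_map[OF assms] moebius_denominator_nonzero[OF assms] assms(1) by simp

lemma deriv_moebius_map:
  assumes "Im \<tau> > 0" "a * d - b * c = 1"
  shows "deriv (moebius_map a b c d) \<tau> = 1 / (of_int c * \<tau> + of_int d)\<^sup>2"
proof (rule DERIV_imp_deriv)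
  have nz: "of_int c * \<tau> + of_int d \<noteq> 0"
    by (rule moebius_denominator_nonzero[OF assms])
  have "(of_int a * of_int d - of_int b * of_int c :: complex) = 1"
    using assms(2) by (metis of_int_1 of_int_diff of_int_mult)
  then have *: "of_int a * (of_int c * \<tau> + of_int d) - (of_int a * \<tau> + of_int b) * of_int c = (1 :: complex)"
    by (simp add: algebra_simps)
  have "((\<lambda>z. (of_int a * z + of_int b) / (of_int c * z + of_int d)) has_field_derivative
       (of_int a * (of_int c * \<tau> + of_int d) - (of_int a * \<tau> + of_int b) * of_int c) /
       ((of_int c * \<tau> + of_int d) * (of_int c * \<tau> + of_int d))) (at \<tau>)"
    by (rule DERIV_divide) (use nz in \<open>auto intro!: derivative_eq_intros\<close>)
  then show "(moebius_map a b c d has_field_derivative 1 / (of_int c * \<tau> + of_int d)\<^sup>2) (at \<tau>)"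
    unfolding * by (simp add: moebius_map_def[abs_def] power2_eq_square)
qed

lemma SL2_invariant:
  assumes "Im \<tau> > 0" "a * d - b * c = 1"
    and T: "\<And>\<tau>. F (\<tau> + 1) = F \<tau>" and S: "\<And>\<tau>. Im \<tau> > 0 \<Longrightarrow> F (-1 / \<tau>) = F \<tau>"
  shows "F (moebius_map a b c d \<tau>) = F \<tau>"
proof (induction rule: SL2_induct)
  case det
  show ?case by (rule assms(2))
next
  case one
  show ?case by (simp add: moebius_map_def)
next
  case (T a b c d k)
  have Tk: "F (\<tau> + of_int k) = F \<tau>" for \<tau> k
  proof (induction k rule: int_induct[where k = 0])
    case (step1 i)
    then show ?case using assms(3)[of "\<tau> + of_int i"] by (simp add: add.assoc)
  next
    case (step2 i)
    then show ?case using assms(3)[of "\<tau> + of_int (i - 1)"] by (simp add: add.assoc)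
  qed simp
  have "moebius_map (a + k * c) (b + k * d) c d \<tau> = moebius_map a b c d \<tau> + of_int k"
    using moebius_denominator_nonzero[OF assms(1) T(1)]
    by (simp add: moebius_map_def field_simps)
  then show ?case using T(2) Tk by simp
next
  case (S a b c d)
  have "moebius_map (- c) (- d) a b \<tau> = -1 / moebius_map a b c d \<tau>"
    using moebius_denominator_nonzero[OF assms(1) S(1)]
    by (simp add: moebius_map_def divide_simps)
  then show ?case using S(2) assms(4) Im_moebius_map_pos[OF assms(1) S(1)] by simp
qed

section \<open>Integration over the torus\<close>

lemma periodicD:
  assumes "periodic f"
  shows "f (x + (of_int i, of_int j)) = f x"
  using assms unfolding periodic_def int_lattice_def by blast

lemma periodicI:
  assumes "\<And>x i j. f (x + (of_int i, of_int j)) = f x"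
  shows "periodic f"
  using assms by (auto simp: periodic_def int_lattice_def)

lemma periodic_compose:
  assumes "periodic f" shows "periodic (\<lambda>x. g (f x))"
  using assms by (simp add: periodic_def)

lemma torus_map_add: "torus_map a b c d (x + y) = torus_map a b c d x + torus_map a b c d y"
  by (simp add: torus_map_def algebra_simps)

lemma torus_map_diff: "torus_map a b c d (x - y) = torus_map a b c d x - torus_map a b c d y"
  by (simp add: torus_map_def algebra_simps)

lemma periodic_torus_map:
  assumes "periodic f"
  shows "periodic (\<lambda>x. f (torus_map a b c d x + w))"
proof (rule periodicI)
  fix x :: plane and i j
  have "torus_map a b c d (x + (of_int i, of_int j)) + w
      = (torus_map a b c d x + w) + (of_int (d * i + b * j), of_int (c * i + a * j))"
    by (simp add: torus_map_def prod_eq_iff algebra_simps)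
  then show "f (torus_map a b c d (x + (of_int i, of_int j)) + w) = f (torus_map a b c d x + w)"
    using periodicD[OF assms] by metis
qed

lemma continuous_torus_map [continuous_intros]:
  "continuous_on A f \<Longrightarrow> continuous_on A (\<lambda>x. torus_map a b c d (f x))"
  unfolding torus_map_def by (intro continuous_intros)

lemma measurable_torus_map [measurable]: "torus_map a b c d \<in> borel_measurable borel"
  by (intro borel_measurable_continuous_onI continuous_intros)

lemma unit_square_borel [measurable]: "{0..<1} \<times> {0..<1} \<in> sets (borel :: plane measure)"
  by (subst borel_prod[symmetric]) (intro pair_measureI; simp)

lemma periodic_frac:
  assumes "periodic f"
  shows "f (frac (fst x), frac (snd x)) = f x"
proof -
  have "x = (frac (fst x), frac (snd x)) + (of_int \<lfloor>fst x\<rfloor>, of_int \<lfloor>snd x\<rfloor>)"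
    by (simp add: prod_eq_iff frac_def)
  then show ?thesis using periodicD[OF assms] by metis
qed

lemma borel_measurable_periodic:
  assumes "periodic f" "f \<in> borel_measurable torus_leb"
  shows "f \<in> borel_measurable borel"
proof -
  have "frac \<in> borel_measurable (borel :: real measure)"
    unfolding frac_def[abs_def] by measurable
  then have "(\<lambda>x::plane. (frac (fst x), frac (snd x))) \<in> borel \<rightarrow>\<^sub>M torus_leb"
    unfolding torus_leb_def
    by (intro measurable_restrict_space2) (auto simp: frac_lt_1 borel_prod[symmetric])
  from measurable_compose[OF this assms(2)] show ?thesis
    using periodic_frac[OF assms(1)] by simp
qed

lemma borel_measurable_torus_leb [measurable (raw)]:
  "f \<in> borel_measurable borel \<Longrightarrow> f \<in> borel_measurable torus_leb"
  unfolding torus_leb_def by (rule measurable_restrict_space1) simp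

lemma space_torus_leb: "space torus_leb = {0..<1} \<times> {0..<1}"
  by (simp add: torus_leb_def space_restrict_space)

text \<open>
  After reduction of the shift to \<open>t \<in> [0, 1)\<close>, the interval \<open>[t, 1 + t)\<close> is cut at \<open>1\<close> and its
  right part is moved back by one period.
\<close>
lemma nn_integral_periodic_shift:
  fixes h :: "real \<Rightarrow> ennreal"
  assumes h[measurable]: "h \<in> borel_measurable borel" and p: "\<And>x. h (x + 1) = h x"
  shows "(\<integral>\<^sup>+x\<in>{0..<1}. h (x + s) \<partial>lborel) = (\<integral>\<^sup>+x\<in>{0..<1}. h x \<partial>lborel)"
proof -
  have pz: "h (x + of_int k) = h x" for x k
  proof (induction k rule: int_induct[where k = 0])
    case (step1 i)
    then show ?case using p[of "x + of_int i"] by (simp add: algebra_simps)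
  next
    case (step2 i)
    then show ?case using p[of "x + of_int (i - 1)"] by (simp add: algebra_simps)
  qed simp
  define t where "t = frac s"
  have t: "0 \<le> t" "t < 1" by (simp_all add: t_def frac_lt_1)
  have hs: "h (x + s) = h (t + 1 * x)" for x
    using pz[of "x + t" "\<lfloor>s\<rfloor>"] by (simp add: t_def frac_def add_ac)
  have "(\<integral>\<^sup>+x\<in>{0..<1}. h (x + s) \<partial>lborel)
      = (\<integral>\<^sup>+x. h (t + 1 * x) * indicator {t..<1 + t} (t + 1 * x) \<partial>lborel)"
    by (intro nn_integral_cong) (auto simp: hs indicator_def)
  also have "\<dots> = (\<integral>\<^sup>+x. h x * indicator {t..<1 + t} x \<partial>lborel)"
    using nn_integral_real_affine[of "\<lambda>x. h x * indicator {t..<1 + t} x" 1 t] by simp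
  also have "\<dots> = (\<integral>\<^sup>+x. h x * indicator {t..<1} x + h x * indicator {1..<1 + t} x \<partial>lborel)"
    using t by (intro nn_integral_cong) (auto simp: indicator_def)
  also have "\<dots> = (\<integral>\<^sup>+x. h x * indicator {t..<1} x \<partial>lborel) + (\<integral>\<^sup>+x. h x * indicator {1..<1 + t} x \<partial>lborel)"
    by (intro nn_integral_add) auto
  also have "(\<integral>\<^sup>+x. h x * indicator {1..<1 + t} x \<partial>lborel)
      = (\<integral>\<^sup>+x. h (1 + 1 * x) * indicator {1..<1 + t} (1 + 1 * x) \<partial>lborel)"
    using nn_integral_real_affine[of "\<lambda>x. h x * indicator {1..<1 + t} x" 1 1] by simp
  also have "\<dots> = (\<integral>\<^sup>+x. h x * indicator {0..<t} x \<partial>lborel)"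
    using p by (intro nn_integral_cong) (auto simp: indicator_def add.commute)
  also have "(\<integral>\<^sup>+x. h x * indicator {t..<1} x \<partial>lborel) + \<dots>
      = (\<integral>\<^sup>+x. h x * indicator {t..<1} x + h x * indicator {0..<t} x \<partial>lborel)"
    by (intro nn_integral_add[symmetric]) auto
  also have "\<dots> = (\<integral>\<^sup>+x\<in>{0..<1}. h x \<partial>lborel)"
    using t by (intro nn_integral_cong) (auto simp: indicator_def)
  finally show ?thesis .
qed

lemma nn_integral_periodic_reflect:
  fixes h :: "real \<Rightarrow> ennreal"
  assumes h[measurable]: "h \<in> borel_measurable borel" and p: "\<And>x. h (x + 1) = h x"
  shows "(\<integral>\<^sup>+x\<in>{0..<1}. h (- x) \<partial>lborel) = (\<integral>\<^sup>+x\<in>{0..<1}. h x \<partial>lborel)"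
proof -
  have "(\<integral>\<^sup>+x\<in>{0..<1}. h x \<partial>lborel)
      = (\<integral>\<^sup>+x. h (1 + -1 * x) * indicator {0..<1} (1 + -1 * x) \<partial>lborel)"
    using nn_integral_real_affine[of "\<lambda>x. h x * indicator {0..<1} x" "-1" 1] by simp
  also have "\<dots> = (\<integral>\<^sup>+x\<in>{0..<1}. h (- x) \<partial>lborel)"
  proof (rule nn_integral_cong_AE)
    have "AE x in lborel. x \<noteq> (0::real)" "AE x in lborel. x \<noteq> (1::real)"
      by (simp_all add: AE_lborel_singleton)
    then show "AE x in lborel. h (1 + -1 * x) * indicator {0..<1} (1 + -1 * x) = h (- x) * indicator {0..<1} x"
    proof eventually_elim
      case (elim x)
      then show ?case using p[of "- x"] by (auto simp: indicator_def)
    qed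
  qed
  finally show ?thesis by simp
qed

lemma nn_integral_torus:
  fixes f :: "plane \<Rightarrow> ennreal"
  assumes [measurable]: "f \<in> borel_measurable borel"
  shows "(\<integral>\<^sup>+x. f x \<partial>torus_leb) = (\<integral>\<^sup>+x\<in>{0..<1}. (\<integral>\<^sup>+y\<in>{0..<1}. f (x, y) \<partial>lborel) \<partial>lborel)" (is ?fst)
    and "(\<integral>\<^sup>+x. f x \<partial>torus_leb) = (\<integral>\<^sup>+y\<in>{0..<1}. (\<integral>\<^sup>+x\<in>{0..<1}. f (x, y) \<partial>lborel) \<partial>lborel)" (is ?snd)
proof -
  have m[measurable]: "f \<in> borel_measurable (borel \<Otimes>\<^sub>M borel)"
    by (simp add: borel_prod)
  have "(\<integral>\<^sup>+x. f x \<partial>torus_leb) = (\<integral>\<^sup>+x. f x * indicator ({0..<1} \<times> {0..<1}) x \<partial>lborel)"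
    unfolding torus_leb_def by (subst nn_integral_restrict_space) auto
  also have "\<dots> = (\<integral>\<^sup>+x. f x * indicator ({0..<1} \<times> {0..<1}) x \<partial>(lborel \<Otimes>\<^sub>M lborel))"
    by (simp add: lborel_prod)
  finally have eq: "(\<integral>\<^sup>+x. f x \<partial>torus_leb) = \<dots>" .
  have "\<dots> = (\<integral>\<^sup>+x. (\<integral>\<^sup>+y. f (x, y) * indicator ({0..<1} \<times> {0..<1}) (x, y) \<partial>lborel) \<partial>lborel)"
    by (rule lborel.nn_integral_fst[symmetric]) measurable
  also have "\<dots> = (\<integral>\<^sup>+x\<in>{0..<1}. (\<integral>\<^sup>+y\<in>{0..<1}. f (x, y) \<partial>lborel) \<partial>lborel)"
    by (intro nn_integral_cong) (auto simp: indicator_def)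
  finally show ?fst using eq by simp
  have "(\<integral>\<^sup>+x. f x * indicator ({0..<1} \<times> {0..<1}) x \<partial>(lborel \<Otimes>\<^sub>M lborel))
     = (\<integral>\<^sup>+y. (\<integral>\<^sup>+x. f (x, y) * indicator ({0..<1} \<times> {0..<1}) (x, y) \<partial>lborel) \<partial>lborel)"
    by (rule lborel_pair.nn_integral_snd[symmetric]) measurable
  also have "\<dots> = (\<integral>\<^sup>+y\<in>{0..<1}. (\<integral>\<^sup>+x\<in>{0..<1}. f (x, y) \<partial>lborel) \<partial>lborel)"
    by (intro nn_integral_cong) (auto simp: indicator_def)
  finally show ?snd using eq by simp
qed

lemma prob_space_torus_leb: "prob_space torus_leb"
proof
  have "emeasure torus_leb (space torus_leb) = (\<integral>\<^sup>+x. 1 \<partial>torus_leb)" by simp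
  also have "\<dots> = 1" by (subst nn_integral_torus) simp_all
  finally show "emeasure torus_leb (space torus_leb) = 1" .
qed

interpretation torus: prob_space torus_leb
  by (rule prob_space_torus_leb)

lemma nn_integral_torus_translate:
  fixes f :: "plane \<Rightarrow> ennreal"
  assumes [measurable]: "f \<in> borel_measurable borel" and p: "periodic f"
  shows "(\<integral>\<^sup>+x. f (x + w) \<partial>torus_leb) = (\<integral>\<^sup>+x. f x \<partial>torus_leb)"
proof -
  have [measurable]: "f \<in> borel_measurable (borel \<Otimes>\<^sub>M borel)"
    by (simp add: borel_prod)
  have p1: "f (x + 1, y) = f (x, y)" and p2: "f (x, y + 1) = f (x, y)" for x y
    using periodicD[OF p, of "(x, y)" 1 0] periodicD[OF p, of "(x, y)" 0 1] by simp_all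
  have "(\<integral>\<^sup>+x. f (x + w) \<partial>torus_leb)
      = (\<integral>\<^sup>+x\<in>{0..<1}. (\<integral>\<^sup>+y\<in>{0..<1}. f (x + fst w, y + snd w) \<partial>lborel) \<partial>lborel)"
    by (subst nn_integral_torus(1)) (measurable, simp add: plus_prod_def)
  also have "\<dots> = (\<integral>\<^sup>+x\<in>{0..<1}. (\<integral>\<^sup>+y\<in>{0..<1}. f (x + fst w, y) \<partial>lborel) \<partial>lborel)"
    using nn_integral_periodic_shift[of "\<lambda>y. f (x + fst w, y)" "snd w" for x] p2 by simp
  also have "\<dots> = (\<integral>\<^sup>+x\<in>{0..<1}. (\<integral>\<^sup>+y\<in>{0..<1}. f (x, y) \<partial>lborel) \<partial>lborel)"
    using nn_integral_periodic_shift[of "\<lambda>x. \<integral>\<^sup>+y\<in>{0..<1}. f (x, y) \<partial>lborel" "fst w"] p1 by simp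
  also have "\<dots> = (\<integral>\<^sup>+x. f x \<partial>torus_leb)"
    by (rule nn_integral_torus(1)[symmetric]) measurable
  finally show ?thesis .
qed

lemma nn_integral_torus_shear:
  fixes f :: "plane \<Rightarrow> ennreal"
  assumes [measurable]: "f \<in> borel_measurable borel" and p: "periodic f"
  shows "(\<integral>\<^sup>+x. f (fst x + of_int k * snd x, snd x) \<partial>torus_leb) = (\<integral>\<^sup>+x. f x \<partial>torus_leb)"
proof -
  have [measurable]: "f \<in> borel_measurable (borel \<Otimes>\<^sub>M borel)"
    by (simp add: borel_prod)
  have p1: "f (x + 1, y) = f (x, y)" for x y
    using periodicD[OF p, of "(x, y)" 1 0] by simp
  have m: "(\<lambda>x. f (fst x + of_int k * snd x, snd x)) \<in> borel_measurable borel"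
    by (rule measurable_compose[OF _ assms(1)]) (auto intro!: borel_measurable_continuous_onI continuous_intros)
  have "(\<integral>\<^sup>+x. f (fst x + of_int k * snd x, snd x) \<partial>torus_leb)
      = (\<integral>\<^sup>+y\<in>{0..<1}. (\<integral>\<^sup>+x\<in>{0..<1}. f (x + of_int k * y, y) \<partial>lborel) \<partial>lborel)"
    by (subst nn_integral_torus(2)[OF m]) simp
  also have "\<dots> = (\<integral>\<^sup>+y\<in>{0..<1}. (\<integral>\<^sup>+x\<in>{0..<1}. f (x, y) \<partial>lborel) \<partial>lborel)"
    using nn_integral_periodic_shift[of "\<lambda>x. f (x, y)" "of_int k * y" for y] p1 by simp
  also have "\<dots> = (\<integral>\<^sup>+x. f x \<partial>torus_leb)"
    by (rule nn_integral_torus(2)[symmetric]) measurable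
  finally show ?thesis .
qed

lemma nn_integral_torus_rotate:
  fixes f :: "plane \<Rightarrow> ennreal"
  assumes [measurable]: "f \<in> borel_measurable borel" and p: "periodic f"
  shows "(\<integral>\<^sup>+x. f (- snd x, fst x) \<partial>torus_leb) = (\<integral>\<^sup>+x. f x \<partial>torus_leb)"
proof -
  have [measurable]: "f \<in> borel_measurable (borel \<Otimes>\<^sub>M borel)"
    by (simp add: borel_prod)
  have p1: "f (x + 1, y) = f (x, y)" for x y
    using periodicD[OF p, of "(x, y)" 1 0] by simp
  have m: "(\<lambda>x. f (- snd x, fst x)) \<in> borel_measurable borel"
    by (rule measurable_compose[OF _ assms(1)]) (auto intro!: borel_measurable_continuous_onI continuous_intros)
  have "(\<integral>\<^sup>+x. f (- snd x, fst x) \<partial>torus_leb)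
      = (\<integral>\<^sup>+y\<in>{0..<1}. (\<integral>\<^sup>+x\<in>{0..<1}. f (- x, y) \<partial>lborel) \<partial>lborel)"
    by (subst nn_integral_torus(1)[OF m]) simp
  also have "\<dots> = (\<integral>\<^sup>+y\<in>{0..<1}. (\<integral>\<^sup>+x\<in>{0..<1}. f (x, y) \<partial>lborel) \<partial>lborel)"
    using nn_integral_periodic_reflect[of "\<lambda>x. f (x, y)" for y] p1 by simp
  also have "\<dots> = (\<integral>\<^sup>+x. f x \<partial>torus_leb)"
    by (rule nn_integral_torus(2)[symmetric]) measurable
  finally show ?thesis .
qed

text \<open>
  The generators of \<open>SL(2, \<int>)\<close> act as a shear and a rotation by a right angle. Both preserve the
  integral by Tonelli's theorem and the invariance of one-dimensional periodic integrals under
  shifts and the reflection.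
\<close>
lemma nn_integral_torus_map:
  fixes f :: "plane \<Rightarrow> ennreal"
  assumes det: "a * d - b * c = 1" and m: "f \<in> borel_measurable borel" and p: "periodic f"
  shows "(\<integral>\<^sup>+x. f (torus_map a b c d x) \<partial>torus_leb) = (\<integral>\<^sup>+x. f x \<partial>torus_leb)"
proof (induction rule: SL2_induct)
  case det
  show ?case by (rule assms(1))
next
  case one
  show ?case by (simp add: torus_map_def)
next
  case (T a b c d k)
  have "f (torus_map (a + k * c) (b + k * d) c d x)
      = (\<lambda>x. f (torus_map a b c d x)) (fst x + of_int k * snd x, snd x)" for x
    by (simp add: torus_map_def algebra_simps)
  then show ?case
    using nn_integral_torus_shear[of "\<lambda>x. f (torus_map a b c d x)" k] T
      periodic_torus_map[OF p, of a b c d 0] m by simp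
next
  case (S a b c d)
  have "f (torus_map (- c) (- d) a b x)
      = (\<lambda>x. f (torus_map a b c d x)) (- snd x, fst x)" for x
    by (simp add: torus_map_def algebra_simps)
  then show ?case
    using nn_integral_torus_rotate[of "\<lambda>x. f (torus_map a b c d x)"] S
      periodic_torus_map[OF p, of a b c d 0] m by simp
qed

lemma nn_integral_torus_affine:
  fixes f :: "plane \<Rightarrow> ennreal"
  assumes det: "a * d - b * c = 1" and m: "f \<in> borel_measurable borel" and p: "periodic f"
  shows "(\<integral>\<^sup>+x. f (torus_map a b c d x + w) \<partial>torus_leb) = (\<integral>\<^sup>+x. f x \<partial>torus_leb)"
proof -
  have "periodic (\<lambda>x. f (x + w))"
    using periodic_torus_map[OF p, of 1 0 0 1 w] by (simp add: torus_map_def)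
  then show ?thesis
    using nn_integral_torus_map[OF det, of "\<lambda>x. f (x + w)"] nn_integral_torus_translate[OF m p] m by simp
qed

lemma integral_torus_affine:
  fixes f :: "plane \<Rightarrow> real"
  assumes det: "a * d - b * c = 1" and m[measurable]: "f \<in> borel_measurable borel" and p: "periodic f"
  shows "integrable torus_leb (\<lambda>x. f (torus_map a b c d x + w)) \<longleftrightarrow> integrable torus_leb f" (is ?int)
    and "(\<integral>x. f (torus_map a b c d x + w) \<partial>torus_leb) = (\<integral>x. f x \<partial>torus_leb)" (is ?eq)
proof -
  have nn: "(\<integral>\<^sup>+x. ennreal (g (f (torus_map a b c d x + w))) \<partial>torus_leb) = (\<integral>\<^sup>+x. ennreal (g (f x)) \<partial>torus_leb)"
    if [measurable]: "g \<in> borel_measurable borel" for g :: "real \<Rightarrow> real"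
    by (rule nn_integral_torus_affine[OF det, of "\<lambda>x. ennreal (g (f x))"])
      (use p in \<open>auto intro: periodic_compose\<close>)
  have m': "(\<lambda>x. f (torus_map a b c d x + w)) \<in> borel_measurable torus_leb"
    by measurable
  show ?int
    using nn[of norm] m' by (simp add: integrable_iff_bounded)
  show ?eq
  proof (cases "integrable torus_leb f")
    case True
    with \<open>?int\<close> show ?thesis
      using nn[of "\<lambda>x. x"] nn[of uminus] by (simp add: real_lebesgue_integral_def)
  next
    case False
    with \<open>?int\<close> show ?thesis by (simp add: not_integrable_integral_eq)
  qed
qed

lemma integral_torus_reflect:
  fixes f :: "plane \<Rightarrow> real"
  assumes "f \<in> borel_measurable borel" "periodic f"
  shows "integrable torus_leb (\<lambda>x. f (w - x)) \<longleftrightarrow> integrable torus_leb f"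
    and "(\<integral>x. f (w - x) \<partial>torus_leb) = (\<integral>x. f x \<partial>torus_leb)"
proof -
  have "torus_map (-1) 0 0 (-1) x + w = w - x" for x
    by (simp add: torus_map_def prod_eq_iff)
  then show "integrable torus_leb (\<lambda>x. f (w - x)) \<longleftrightarrow> integrable torus_leb f"
    and "(\<integral>x. f (w - x) \<partial>torus_leb) = (\<integral>x. f x \<partial>torus_leb)"
    using integral_torus_affine[of "-1" "-1" 0 0 f w] assms by simp_all
qed

lemma integral_torus_vol:
  fixes f :: "plane \<Rightarrow> real"
  assumes "Im \<tau> > 0" and [measurable]: "f \<in> borel_measurable borel"
  shows "(\<integral>x. f x \<partial>torus_vol \<tau>) = Im \<tau> * (\<integral>x. f x \<partial>torus_leb)"
  unfolding torus_vol_def using assms(1) by (subst integral_density) auto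

lemma integrable_torus_vol:
  fixes f :: "plane \<Rightarrow> real"
  assumes "Im \<tau> > 0"
  shows "integrable (torus_vol \<tau>) f \<longleftrightarrow> integrable torus_leb f"
proof -
  have "f \<in> borel_measurable (torus_vol \<tau>) \<longleftrightarrow> f \<in> borel_measurable torus_leb"
    by (simp add: torus_vol_def)
  moreover have "integrable (torus_vol \<tau>) f \<longleftrightarrow> integrable torus_leb f" if "f \<in> borel_measurable torus_leb"
    unfolding torus_vol_def using that assms by (subst integrable_density) auto
  ultimately show ?thesis by (meson borel_measurable_integrable)
qed

section \<open>Smooth periodic functions and trigonometric polynomials\<close>

lemma pd_of_has_derivative:
  assumes D: "(f has_derivative D) (at x)"
  shows "pd1 f x = D (1, 0)" "pd2 f x = D (0, 1)"
proof -
  have lin: "linear D" by (rule has_derivative_linear[OF D])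
  have "((\<lambda>s. f (s, snd x)) has_derivative (\<lambda>h. D (h, 0))) (at (fst x))"
    using has_derivative_compose[of "\<lambda>s. (s, snd x)" "\<lambda>h. (h, 0)" "fst x" UNIV f D] D
    by (simp add: has_derivative_Pair)
  moreover have "(\<lambda>h. D (h, 0)) = (*) (D (1, 0))"
  proof
    fix h show "D (h, 0) = D (1, 0) * h"
      using linear_scale[OF lin, of h "(1, 0)"] by (simp add: mult.commute)
  qed
  ultimately have "((\<lambda>s. f (s, snd x)) has_field_derivative D (1, 0)) (at (fst x))"
    by (simp only: has_field_derivative_def)
  then show "pd1 f x = D (1, 0)"
    unfolding pd1_def by (rule DERIV_imp_deriv)
  have "((\<lambda>s. f (fst x, s)) has_derivative (\<lambda>h. D (0, h))) (at (snd x))"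
    using has_derivative_compose[of "\<lambda>s. (fst x, s)" "\<lambda>h. (0, h)" "snd x" UNIV f D] D
    by (simp add: has_derivative_Pair)
  moreover have "(\<lambda>h. D (0, h)) = (*) (D (0, 1))"
  proof
    fix h show "D (0, h) = D (0, 1) * h"
      using linear_scale[OF lin, of h "(0, 1)"] by (simp add: mult.commute)
  qed
  ultimately have "((\<lambda>s. f (fst x, s)) has_field_derivative D (0, 1)) (at (snd x))"
    by (simp only: has_field_derivative_def)
  then show "pd2 f x = D (0, 1)"
    unfolding pd2_def by (rule DERIV_imp_deriv)
qed

lemma has_derivative_pd:
  assumes "f differentiable (at x)"
  shows "(f has_derivative (\<lambda>h. fst h * pd1 f x + snd h * pd2 f x)) (at x)"
proof -
  obtain D where D: "(f has_derivative D) (at x)"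
    using assms by (auto simp: differentiable_def)
  have lin: "linear D" by (rule has_derivative_linear[OF D])
  have "D h = fst h * pd1 f x + snd h * pd2 f x" for h
  proof -
    have "D h = D (fst h *\<^sub>R (1, 0) + snd h *\<^sub>R (0, 1))"
      by simp
    also have "\<dots> = fst h * D (1, 0) + snd h * D (0, 1)"
      by (simp only: linear_add[OF lin] linear_scale[OF lin]) simp
    finally show ?thesis using pd_of_has_derivative[OF D] by simp
  qed
  then have "D = (\<lambda>h. fst h * pd1 f x + snd h * pd2 f x)" by (rule ext)
  with D show ?thesis by simp
qed

lemma Ck_SucD: "Ck (Suc k) f \<Longrightarrow> f differentiable (at x)"
  by (simp only: Ck.simps)

lemma Ck_SucI:
  "(\<And>x. f differentiable (at x)) \<Longrightarrow> Ck k (pd1 f) \<Longrightarrow> Ck k (pd2 f) \<Longrightarrow> Ck (Suc k) f"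
  by (simp only: Ck.simps) blast

lemma Ck_Suc_imp_Ck: "Ck (Suc k) f \<Longrightarrow> Ck k f"
proof (induction k arbitrary: f)
  case 0
  then have "\<forall>x. f differentiable (at x)" by simp
  then show ?case
    by (auto intro!: continuous_at_imp_continuous_on differentiable_imp_continuous_within)
next
  case (Suc k)
  from Suc.prems have "\<forall>x. f differentiable (at x)" "Ck (Suc k) (pd1 f)" "Ck (Suc k) (pd2 f)"
    by simp_all
  with Suc.IH show ?case using Ck.simps(2)[of k f] by blast
qed

lemma Ck_continuous: "Ck k f \<Longrightarrow> continuous_on UNIV f"
proof (induction k)
  case (Suc k)
  then show ?case using Ck_Suc_imp_Ck by blast
qed simp

lemma Ck_add:
  assumes "Ck k f" "Ck k g"
  shows "Ck k (\<lambda>x. f x + g x)"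
  using assms
proof (induction k arbitrary: f g)
  case 0
  then show ?case by (auto intro: continuous_intros)
next
  case (Suc k)
  have D: "((\<lambda>x. f x + g x) has_derivative (\<lambda>h. (fst h * pd1 f x + snd h * pd2 f x) +
     (fst h * pd1 g x + snd h * pd2 g x))) (at x)" for x
    by (intro has_derivative_add has_derivative_pd Ck_SucD[OF Suc.prems(1)] Ck_SucD[OF Suc.prems(2)])
  have "pd1 (\<lambda>x. f x + g x) = (\<lambda>x. pd1 f x + pd1 g x)" "pd2 (\<lambda>x. f x + g x) = (\<lambda>x. pd2 f x + pd2 g x)"
    using pd_of_has_derivative[OF D] by (auto simp: fun_eq_iff)
  moreover have "(\<lambda>x. f x + g x) differentiable (at x)" for x
    using D unfolding differentiable_def by blast
  ultimately show ?case using Suc by (intro Ck_SucI) auto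
qed

lemma Ck_mult:
  assumes "Ck k f" "Ck k g"
  shows "Ck k (\<lambda>x. f x * g x)"
  using assms
proof (induction k arbitrary: f g)
  case 0
  then show ?case by (auto intro: continuous_intros)
next
  case (Suc k)
  have D: "((\<lambda>x. f x * g x) has_derivative (\<lambda>h. f x * (fst h * pd1 g x + snd h * pd2 g x) +
     (fst h * pd1 f x + snd h * pd2 f x) * g x)) (at x)" for x
    by (intro has_derivative_mult has_derivative_pd Ck_SucD[OF Suc.prems(1)] Ck_SucD[OF Suc.prems(2)])
  have "pd1 (\<lambda>x. f x * g x) = (\<lambda>x. f x * pd1 g x + pd1 f x * g x)"
       "pd2 (\<lambda>x. f x * g x) = (\<lambda>x. f x * pd2 g x + pd2 f x * g x)"
    using pd_of_has_derivative[OF D] by (auto simp: fun_eq_iff)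
  moreover have "Ck k f" "Ck k g"
    using Suc.prems Ck_Suc_imp_Ck by blast+
  moreover have "(\<lambda>x. f x * g x) differentiable (at x)" for x
    using D unfolding differentiable_def by blast
  ultimately show ?case using Suc by (intro Ck_SucI) (auto intro!: Ck_add)
qed

lemma Ck_const: "Ck k (\<lambda>x. a)"
proof (induction k arbitrary: a)
  case (Suc k)
  then show ?case by (simp add: pd1_def pd2_def)
qed simp

lemma Ck_cmult: "Ck k f \<Longrightarrow> Ck k (\<lambda>x. a * f x)"
  using Ck_mult[OF Ck_const] by blast

definition affine_plane :: "real \<Rightarrow> real \<Rightarrow> real \<Rightarrow> real \<Rightarrow> plane \<Rightarrow> plane \<Rightarrow> plane" where
  "affine_plane a b c d w x = (a * fst x + b * snd x + fst w, c * fst x + d * snd x + snd w)"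

lemma pd_affine:
  assumes "f differentiable (at (affine_plane a b c d w x))"
  shows "(\<lambda>x. f (affine_plane a b c d w x)) differentiable (at x)"
    and "pd1 (\<lambda>x. f (affine_plane a b c d w x)) x = a * pd1 f (affine_plane a b c d w x) + c * pd2 f (affine_plane a b c d w x)"
    and "pd2 (\<lambda>x. f (affine_plane a b c d w x)) x = b * pd1 f (affine_plane a b c d w x) + d * pd2 f (affine_plane a b c d w x)"
proof -
  let ?L = "affine_plane a b c d w"
  have "(?L has_derivative (\<lambda>h. (a * fst h + b * snd h, c * fst h + d * snd h))) (at x)"
    unfolding affine_plane_def[abs_def] by (auto intro!: derivative_eq_intros simp: algebra_simps)
  from has_derivative_compose[OF this has_derivative_pd[OF assms]]
  have D: "((\<lambda>x. f (?L x)) has_derivative (\<lambda>h. (a * fst h + b * snd h) * pd1 f (?L x)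
     + (c * fst h + d * snd h) * pd2 f (?L x))) (at x)" by simp
  show "(\<lambda>x. f (?L x)) differentiable (at x)"
    using D by (auto simp: differentiable_def)
  show "pd1 (\<lambda>x. f (?L x)) x = a * pd1 f (?L x) + c * pd2 f (?L x)"
    "pd2 (\<lambda>x. f (?L x)) x = b * pd1 f (?L x) + d * pd2 f (?L x)"
    using pd_of_has_derivative[OF D] by simp_all
qed

lemma continuous_affine: "continuous_on A (affine_plane a b c d w)"
  unfolding affine_plane_def[abs_def] by (intro continuous_intros)

lemma Ck_affine:
  assumes "Ck k f"
  shows "Ck k (\<lambda>x. f (affine_plane a b c d w x))"
  using assms
proof (induction k arbitrary: f)
  case 0
  then show ?case using continuous_on_compose2[of UNIV f UNIV, OF _ continuous_affine] by simp
next
  case (Suc k)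
  have d: "f differentiable (at x)" for x
    using Suc.prems by (rule Ck_SucD)
  have "pd1 (\<lambda>x. f (affine_plane a b c d w x)) = (\<lambda>x. a * pd1 f (affine_plane a b c d w x) + c * pd2 f (affine_plane a b c d w x))"
    "pd2 (\<lambda>x. f (affine_plane a b c d w x)) = (\<lambda>x. b * pd1 f (affine_plane a b c d w x) + d * pd2 f (affine_plane a b c d w x))"
    by (intro ext pd_affine d)+
  with Suc show ?case by (intro Ck_SucI pd_affine(1) d) (auto intro!: Ck_add Ck_cmult)
qed

text \<open>
  Real trigonometric monomials. The free phase \<open>s\<close> makes the family contain sines and cosines
  alike, closed under translation, reflection and, up to factors, differentiation.
\<close>
definition wave :: "int \<Rightarrow> int \<Rightarrow> real \<Rightarrow> plane \<Rightarrow> real" where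
  "wave k l s x = cos (2 * pi * (of_int k * fst x + of_int l * snd x) + s)"

lemma wave_has_derivative:
  "(wave k l s has_derivative (\<lambda>h. fst h * (2 * pi * of_int k * wave k l (s + pi / 2) x)
     + snd h * (2 * pi * of_int l * wave k l (s + pi / 2) x))) (at x)"
proof -
  have "wave k l (s + pi / 2) x = - sin (2 * pi * (of_int k * fst x + of_int l * snd x) + s)"
    by (simp add: wave_def cos_add add.assoc[symmetric])
  then show ?thesis
    unfolding wave_def[of k l s, abs_def] by (auto intro!: derivative_eq_intros simp: algebra_simps)
qed

lemma pd_wave:
  "pd1 (wave k l s) = (\<lambda>x. 2 * pi * of_int k * wave k l (s + pi / 2) x)"
  "pd2 (wave k l s) = (\<lambda>x. 2 * pi * of_int l * wave k l (s + pi / 2) x)"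
  using pd_of_has_derivative[OF wave_has_derivative] by (auto simp: fun_eq_iff)

lemma Ck_wave: "Ck n (wave k l s)"
proof (induction n arbitrary: s)
  case 0
  show ?case unfolding wave_def[abs_def] by (auto intro!: continuous_intros)
next
  case (Suc n)
  have "wave k l s differentiable (at x)" for x
    using wave_has_derivative unfolding differentiable_def by blast
  then show ?case using Suc by (intro Ck_SucI) (auto simp: pd_wave intro!: Ck_cmult)
qed

lemma periodic_wave: "periodic (wave k l s)"
proof (rule periodicI)
  fix x :: plane and i j
  have "2 * pi * (of_int k * fst (x + (of_int i, of_int j)) + of_int l * snd (x + (of_int i, of_int j))) + s
    = (2 * pi * (of_int k * fst x + of_int l * snd x) + s) + 2 * pi * of_int (k * i + l * j)"
    by (simp add: algebra_simps)
  moreover have "cos (t + 2 * pi * of_int n) = cos t" for t n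
    unfolding cos_add cos_int_2pin sin_int_2pin by simp
  ultimately show "wave k l s (x + (of_int i, of_int j)) = wave k l s x"
    unfolding wave_def by (simp only:)
qed

lemma test_functionD:
  assumes "test_function f"
  shows "periodic f" "continuous_on UNIV f" "f differentiable (at x)" "f \<in> borel_measurable borel"
    "test_function (pd1 f)" "test_function (pd2 f)"
proof -
  show p: "periodic f" and c: "continuous_on UNIV f"
    using assms by (auto simp: test_function_def dest: Ck_continuous)
  show "f differentiable (at x)"
    using assms unfolding test_function_def by (metis Ck.simps(2))
  show "f \<in> borel_measurable borel"
    using c by (rule borel_measurable_continuous_onI)
  have per: "f (s + of_int i, t + of_int j) = f (s, t)" for s t i j
    using periodicD[OF p, of "(s, t)" i j] by simp
  have *: "deriv (\<lambda>s. g s) (x + of_int i) = deriv g x" if "\<And>s. g (s + of_int i) = g s" for g :: "real \<Rightarrow> real" and x and i :: int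
    using DERIV_shift[of g _ x "of_int i"] that by (simp add: deriv_def add.commute)
  have "periodic (pd1 f)"
  proof (rule periodicI)
    fix x :: plane and i j
    show "pd1 f (x + (of_int i, of_int j)) = pd1 f x"
      using *[of "\<lambda>s. f (s, snd x)" i "fst x"] per[of _ 0 "snd x" j] per[of _ _ "snd x" 0] by (simp add: pd1_def)
  qed
  moreover have "periodic (pd2 f)"
  proof (rule periodicI)
    fix x :: plane and i j
    show "pd2 f (x + (of_int i, of_int j)) = pd2 f x"
      using *[of "\<lambda>s. f (fst x, s)" j "snd x"] per[of "fst x" i _ 0] per[of "fst x" 0] by (simp add: pd2_def)
  qed
  moreover have "Ck k (pd1 f) \<and> Ck k (pd2 f)" for k
    using assms unfolding test_function_def by (metis Ck.simps(2))
  ultimately show "test_function (pd1 f)" "test_function (pd2 f)"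
    by (auto simp: test_function_def)
qed

lemma test_function_add: "test_function f \<Longrightarrow> test_function g \<Longrightarrow> test_function (\<lambda>x. f x + g x)"
  by (auto simp: test_function_def Ck_add periodic_def)

lemma test_function_mult: "test_function f \<Longrightarrow> test_function g \<Longrightarrow> test_function (\<lambda>x. f x * g x)"
  by (auto simp: test_function_def Ck_mult periodic_def)

lemma test_function_const: "test_function (\<lambda>x. a)"
  by (auto simp: test_function_def Ck_const periodic_def)

lemma test_function_cmult: "test_function f \<Longrightarrow> test_function (\<lambda>x. a * f x)"
  using test_function_mult[OF test_function_const] by blast

lemma test_function_sum: "(\<And>i. i \<in> I \<Longrightarrow> test_function (f i)) \<Longrightarrow> test_function (\<lambda>x. \<Sum>i\<in>I. f i x)"
  by (induction I rule: infinite_finite_induct) (auto intro: test_function_add test_function_const)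

lemma test_function_wave: "test_function (wave k l s)"
  by (simp add: test_function_def Ck_wave periodic_wave)

lemma test_function_torus_map:
  assumes "test_function f"
  shows "test_function (\<lambda>x. f (torus_map a b c d x + w))"
proof -
  have "torus_map a b c d x + w = affine_plane (of_int d) (of_int b) (of_int c) (of_int a) w x" for x
    by (simp add: torus_map_def affine_plane_def prod_eq_iff)
  moreover have "periodic (\<lambda>x. f (torus_map a b c d x + w))"
    using assms by (intro periodic_torus_map) (simp add: test_function_def)
  ultimately show ?thesis using assms by (auto simp: test_function_def intro: Ck_affine)
qed

lemma test_function_reflect:
  assumes "test_function f"
  shows "test_function (\<lambda>y. f (x - y))"
proof -
  have "torus_map (-1) 0 0 (-1) y + x = x - y" for y
    by (simp add: torus_map_def prod_eq_iff)
  then show ?thesis using test_function_torus_map[OF assms, of "-1" 0 0 "-1" x] by simp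
qed

lemma pd_reflect:
  assumes "test_function f"
  shows "pd1 (\<lambda>y. f (x - y)) = (\<lambda>y. - pd1 f (x - y))" "pd2 (\<lambda>y. f (x - y)) = (\<lambda>y. - pd2 f (x - y))"
proof -
  have "affine_plane (-1) 0 0 (-1) x y = x - y" for y
    by (simp add: affine_plane_def prod_eq_iff)
  then show "pd1 (\<lambda>y. f (x - y)) = (\<lambda>y. - pd1 f (x - y))" "pd2 (\<lambda>y. f (x - y)) = (\<lambda>y. - pd2 f (x - y))"
    using pd_affine[of f "-1" 0 0 "-1" x] test_functionD(3)[OF assms] by (auto simp: fun_eq_iff)
qed

lemma periodic_continuous_bounded:
  fixes f :: "plane \<Rightarrow> real"
  assumes "periodic f" "continuous_on UNIV f"
  obtains B where "B \<ge> 0" "\<And>x. \<bar>f x\<bar> \<le> B"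
proof -
  have "compact (f ` ({0..1} \<times> {0..1}))"
    using assms(2) by (intro compact_continuous_image compact_Times) (auto intro: continuous_on_subset)
  then obtain B where B: "\<And>y. y \<in> f ` ({0..1} \<times> {0..1}) \<Longrightarrow> norm y \<le> B"
    using bounded_iff compact_imp_bounded by metis
  have "\<bar>f x\<bar> \<le> B" for x
  proof -
    have "f (frac (fst x), frac (snd x)) \<in> f ` ({0..1} \<times> {0..1})"
      by (intro imageI) (auto simp: frac_lt_1 less_imp_le)
    then show ?thesis using B periodic_frac[OF assms(1), of x] by fastforce
  qed
  then show ?thesis using that[of B] abs_ge_zero order_trans by blast
qed

lemma integrable_continuous_periodic:
  fixes f :: "plane \<Rightarrow> real"
  assumes "periodic f" "continuous_on UNIV f"
  shows "integrable torus_leb f"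
proof -
  obtain B where "\<And>x. \<bar>f x\<bar> \<le> B"
    using periodic_continuous_bounded[OF assms] by blast
  moreover have "f \<in> borel_measurable torus_leb"
    using assms(2) by (intro borel_measurable_torus_leb borel_measurable_continuous_onI)
  ultimately show ?thesis by (intro torus.integrable_const_bound[where B = B]) auto
qed

lemma integrable_test_function: "test_function f \<Longrightarrow> integrable torus_leb f"
  by (intro integrable_continuous_periodic test_functionD)

inductive trig_poly :: "(plane \<Rightarrow> real) \<Rightarrow> bool" where
  wave: "trig_poly (wave k l s)"
| add: "trig_poly f \<Longrightarrow> trig_poly g \<Longrightarrow> trig_poly (\<lambda>x. f x + g x)"
| cmult: "trig_poly f \<Longrightarrow> trig_poly (\<lambda>x. a * f x)"

lemma test_function_trig_poly: "trig_poly f \<Longrightarrow> test_function f"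
  by (induction rule: trig_poly.induct) (auto intro: test_function_wave test_function_add test_function_cmult)

lemma trig_poly_const: "trig_poly (\<lambda>x. a)"
  using trig_poly.cmult[OF trig_poly.wave[of 0 0 0], of a] by (simp add: wave_def)

lemma wave_mult:
  "wave k l s x * wave k' l' s' x = 1 / 2 * wave (k - k') (l - l') (s - s') x + 1 / 2 * wave (k + k') (l + l') (s + s') x"
  unfolding wave_def by (simp add: cos_times_cos) (simp add: algebra_simps)

lemma trig_poly_mult:
  assumes "trig_poly f" "trig_poly g"
  shows "trig_poly (\<lambda>x. f x * g x)"
  using assms
proof (induction arbitrary: g rule: trig_poly.induct)
  case (wave k l s)
  then show ?case
  proof (induction rule: trig_poly.induct)
    case (wave k' l' s')
    show ?case unfolding wave_mult by (intro trig_poly.intros)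
  next
    case (add f g)
    then show ?case using trig_poly.add by (simp add: distrib_left)
  next
    case (cmult f a)
    from trig_poly.cmult[OF cmult.IH, of a] show ?case by (simp add: mult_ac)
  qed
next
  case (add f g)
  then show ?case using trig_poly.add by (simp add: distrib_right)
next
  case (cmult f a)
  from trig_poly.cmult[OF cmult.IH[OF cmult.prems], of a] show ?case by (simp add: mult_ac)
qed

lemma trig_poly_power: "trig_poly f \<Longrightarrow> trig_poly (\<lambda>x. f x ^ n)"
  by (induction n) (auto intro: trig_poly_const trig_poly_mult)

lemma trig_poly_reflect:
  assumes "trig_poly f"
  shows "trig_poly (\<lambda>y. f (x - y))"
  using assms
proof (induction rule: trig_poly.induct)
  case (wave k l s)
  have "wave k l s (x - y) = wave (- k) (- l) (s + 2 * pi * (of_int k * fst x + of_int l * snd x)) y" for y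
    by (simp add: wave_def algebra_simps)
  then show ?case by (simp add: trig_poly.wave)
qed (auto intro: trig_poly.intros)

section \<open>A mollifier of trigonometric polynomials\<close>

text \<open>
  The product of \<open>cos\<^sup>2 (\<pi> x\<^sub>1)\<close> and \<open>cos\<^sup>2 (\<pi> x\<^sub>2)\<close>: it lies between \<open>0\<close> and \<open>1\<close> and equals \<open>1\<close>
  exactly on the integer lattice, so that its normalised powers concentrate there.
\<close>
definition bump :: "plane \<Rightarrow> real" where
  "bump x = (1 / 2 + 1 / 2 * wave 1 0 0 x) * (1 / 2 + 1 / 2 * wave 0 1 0 x)"

definition peak :: "nat \<Rightarrow> plane \<Rightarrow> real" where
  "peak k x = 1 / (\<integral>x. bump x ^ k \<partial>torus_leb) * bump x ^ k"

lemma trig_poly_bump: "trig_poly bump"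
  unfolding bump_def[abs_def] by (intro trig_poly_mult trig_poly.intros trig_poly_const)

lemma trig_poly_peak: "trig_poly (peak k)"
  unfolding peak_def[abs_def] by (intro trig_poly.cmult trig_poly_power trig_poly_bump)

lemma bump_bounds: "0 \<le> bump x" "bump x \<le> 1"
proof -
  have *: "0 \<le> 1 / 2 + 1 / 2 * cos t" "1 / 2 + 1 / 2 * cos t \<le> 1" for t :: real
    using cos_ge_minus_one[of t] cos_le_one[of t] by linarith+
  show "0 \<le> bump x" "bump x \<le> 1"
    unfolding bump_def wave_def by (intro mult_nonneg_nonneg mult_le_one *)+
qed

lemma bump_0: "bump 0 = 1"
  by (simp add: bump_def wave_def)

lemma continuous_bump: "continuous_on UNIV bump"
  by (intro test_functionD test_function_trig_poly trig_poly_bump)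

lemma bump_eq_1:
  assumes "bump x = 1"
  shows "\<exists>i j. x = (of_int i, of_int j)"
proof -
  define u where "u = 1 / 2 + 1 / 2 * cos (2 * pi * fst x)"
  define v where "v = 1 / 2 + 1 / 2 * cos (2 * pi * snd x)"
  have uv: "u * v = 1" using assms by (simp add: bump_def wave_def u_def v_def)
  have le: "u \<le> 1" "v \<le> 1" and ge: "0 \<le> u" "0 \<le> v"
    using cos_le_one[of "2 * pi * fst x"] cos_le_one[of "2 * pi * snd x"]
      cos_ge_minus_one[of "2 * pi * fst x"] cos_ge_minus_one[of "2 * pi * snd x"]
    unfolding u_def v_def by linarith+
  have "u * v \<le> u * 1" "u * v \<le> 1 * v"
    using le ge by (intro mult_left_mono mult_right_mono; simp)+
  with uv le have "u = 1" "v = 1" by simp_all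
  then have "cos (2 * pi * fst x) = 1" "cos (2 * pi * snd x) = 1" by (simp_all add: u_def v_def)
  then obtain i j :: int where "2 * pi * fst x = of_int i * 2 * pi" "2 * pi * snd x = of_int j * 2 * pi"
    by (auto simp: cos_one_2pi_int)
  then have "x = (of_int i, of_int j)" by (simp add: prod_eq_iff)
  then show ?thesis by blast
qed

text \<open>
  By continuity \<open>bump\<close> exceeds \<open>1 - \<delta>\<close> on a small square at the origin, whose area serves as
  \<open>c\<close>.
\<close>
lemma integral_bump_power_lower:
  assumes "0 < \<delta>" "\<delta> < 1"
  shows "\<exists>c>0. \<forall>k. c * (1 - \<delta>) ^ k \<le> (\<integral>x. bump x ^ k \<partial>torus_leb)"
proof -
  have "isCont bump 0"
    by (metis continuous_bump continuous_on_eq_continuous_at open_UNIV UNIV_I)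
  then obtain e where e: "e > 0" "\<And>x. dist x 0 < e \<Longrightarrow> dist (bump x) (bump 0) < \<delta>"
    using assms(1) unfolding continuous_at_eps_delta by (metis UNIV_I)
  define \<eta> where "\<eta> = min (e / 3) (1 / 2)"
  define S where "S = {0..\<eta>} \<times> {0..\<eta>}"
  have \<eta>: "0 < \<eta>" "\<eta> < 1" "2 * \<eta> < e" using e(1) by (auto simp: \<eta>_def)
  have S[measurable]: "S \<in> sets (borel :: plane measure)"
    unfolding S_def by (intro borel_closed closed_Times) auto
  have "emeasure torus_leb S = (\<integral>\<^sup>+x. indicator S x \<partial>torus_leb)"
  proof (rule nn_integral_indicator[symmetric])
    have "S \<subseteq> {0..<1} \<times> {0..<1}" using \<eta> by (auto simp: S_def)
    then show "S \<in> sets torus_leb"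
      using S by (simp add: torus_leb_def sets_restrict_space_iff)
  qed
  also have "\<dots> = (\<integral>\<^sup>+x\<in>{0..<1}. (\<integral>\<^sup>+y\<in>{0..<1}. indicator S (x, y) \<partial>lborel) \<partial>lborel)"
    by (rule nn_integral_torus(1)) measurable
  also have "\<dots> = (\<integral>\<^sup>+x. (\<integral>\<^sup>+y. indicator {0..\<eta>} y \<partial>lborel) * indicator {0..\<eta>} x \<partial>lborel)"
    using \<eta> by (intro nn_integral_cong) (auto simp: indicator_def S_def intro!: nn_integral_cong)
  also have "\<dots> = ennreal (\<eta> * \<eta>)"
    using \<eta> by (simp add: nn_integral_cmult ennreal_mult)
  finally have mS: "measure torus_leb S = \<eta> * \<eta>"
    using \<eta> by (simp add: measure_def)
  have SS: "S \<in> sets torus_leb"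
    using S \<eta> by (auto simp: torus_leb_def sets_restrict_space_iff S_def)
  have "(\<eta> * \<eta>) * (1 - \<delta>) ^ k \<le> (\<integral>x. bump x ^ k \<partial>torus_leb)" for k
  proof -
    have "(\<integral>x. indicator S x * (1 - \<delta>) ^ k \<partial>torus_leb) \<le> (\<integral>x. bump x ^ k \<partial>torus_leb)"
    proof (rule integral_mono)
      show "integrable torus_leb (\<lambda>x. indicator S x * (1 - \<delta>) ^ k)"
        using SS by (intro integrable_mult_left integrable_real_indicator) (auto simp: torus.emeasure_eq_measure)
      show "integrable torus_leb (\<lambda>x. bump x ^ k)"
        by (intro integrable_test_function test_function_trig_poly trig_poly_power trig_poly_bump)
      fix x
      show "indicator S x * (1 - \<delta>) ^ k \<le> bump x ^ k"
      proof (cases "x \<in> S")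
        case True
        have "dist x 0 \<le> \<bar>fst x\<bar> + \<bar>snd x\<bar>"
          by (simp add: dist_norm norm_prod_def) (metis real_norm_def sqrt_sum_squares_le_sum_abs)
        also have "\<dots> < e" using True \<eta> by (auto simp: S_def)
        finally have "dist (bump x) 1 < \<delta>" using e(2) bump_0 by simp
        then have "1 - \<delta> \<le> bump x" by (simp add: dist_real_def abs_if split: if_splits)
        then show ?thesis using True assms by (auto intro: power_mono)
      qed (simp add: bump_bounds)
    qed
    then show ?thesis using SS mS by simp
  qed
  then show ?thesis using \<eta> by (intro exI[of _ "\<eta> * \<eta>"]) auto
qed

text \<open>
  Where a test function \<open>\<phi>\<close> differs from \<open>\<phi> 0\<close> by at least \<open>e\<close>, compactness bounds \<open>bump\<close> by
  some \<open>1 - \<delta>\<close>. The powers of \<open>bump\<close> are there exponentially small compared with their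
  integrals, which by \<open>integral_bump_power_lower\<close> are at least of the order \<open>(1 - \<delta>/2)\<^sup>k\<close>.
\<close>
lemma mollifier_peak: "mollifier peak"
proof -
  define m where "m k = (\<integral>x. bump x ^ k \<partial>torus_leb)" for k
  have int: "integrable torus_leb (\<lambda>x. bump x ^ k)" for k
    by (intro integrable_test_function test_function_trig_poly trig_poly_power trig_poly_bump)
  have mpos: "m k > 0" for k
  proof -
    obtain c where "c > 0" "c * (1 - 1 / 2) ^ k \<le> m k"
      using integral_bump_power_lower[of "1 / 2"] unfolding m_def by auto
    then show ?thesis by (smt (verit) mult_pos_pos zero_less_power field_sum_of_halves)
  qed
  have conv: "(\<lambda>k. \<integral>x. \<phi> x * peak k x \<partial>torus_leb) \<longlonglongrightarrow> \<phi> 0" if \<phi>: "test_function \<phi>" for \<phi>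
  proof (rule LIMSEQ_I)
    fix r :: real assume "r > 0"
    define e where "e = r / 2"
    have "e > 0" using \<open>r > 0\<close> by (simp add: e_def)
    note c\<phi> = test_functionD(2)[OF \<phi>]
    obtain B where B: "\<And>x. \<bar>\<phi> x\<bar> \<le> B"
      using periodic_continuous_bounded test_functionD[OF \<phi>] by metis
    define K where "K = ({0..1} \<times> {0..1}) \<inter> {x. e \<le> \<bar>\<phi> x - \<phi> 0\<bar>}"
    have "compact K"
      unfolding K_def using c\<phi>
      by (intro compact_Int_closed compact_Times closed_Collect_le) (auto intro!: continuous_intros)
    have lt1: "bump x < 1" if "x \<in> K" for x
    proof (rule ccontr)
      assume "\<not> bump x < 1"
      then have "bump x = 1" using bump_bounds[of x] by linarith
      from bump_eq_1[OF this] obtain i j where "x = 0 + (of_int i, of_int j)"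
        by auto
      then have "\<phi> x = \<phi> 0" using periodicD[OF test_functionD(1)[OF \<phi>]] by metis
      then show False using that \<open>e > 0\<close> by (simp add: K_def)
    qed
    have "\<exists>\<delta>. 0 < \<delta> \<and> \<delta> < 1 \<and> (\<forall>x\<in>K. bump x \<le> 1 - \<delta>)"
    proof (cases "K = {}")
      case False
      then obtain x0 where x0: "x0 \<in> K" "\<And>x. x \<in> K \<Longrightarrow> bump x \<le> bump x0"
        using continuous_attains_sup[OF \<open>compact K\<close>] continuous_on_subset[OF continuous_bump] by (metis subset_UNIV)
      show ?thesis
        by (rule exI[of _ "min (1 - bump x0) (1 / 2)"]) (use x0 lt1[OF x0(1)] in \<open>fastforce simp: min_def\<close>)
    qed (auto intro: exI[of _ "1 / 2"])
    then obtain \<delta> where \<delta>: "0 < \<delta>" "\<delta> < 1" "\<And>x. x \<in> K \<Longrightarrow> bump x \<le> 1 - \<delta>" by blast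
    obtain c where c: "c > 0" "\<And>k. c * (1 - \<delta> / 2) ^ k \<le> m k"
      using integral_bump_power_lower[of "\<delta> / 2"] \<delta> unfolding m_def by auto
    have pointwise: "\<bar>\<phi> x - \<phi> 0\<bar> * bump x ^ k \<le> e * bump x ^ k + 2 * B * (1 - \<delta>) ^ k"
      if "x \<in> {0..<1} \<times> {0..<1}" for x k
    proof (cases "x \<in> K")
      case True
      have "\<bar>\<phi> x - \<phi> 0\<bar> * bump x ^ k \<le> (2 * B) * (1 - \<delta>) ^ k"
        using B[of x] B[of 0] \<delta>(3)[OF True] bump_bounds by (intro mult_mono power_mono) auto
      moreover have "0 \<le> e * bump x ^ k"
        using \<open>e > 0\<close> bump_bounds by simp
      ultimately show ?thesis by linarith
    next
      case False
      then have "\<bar>\<phi> x - \<phi> 0\<bar> \<le> e" using that by (auto simp: K_def)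
      then have "\<bar>\<phi> x - \<phi> 0\<bar> * bump x ^ k \<le> e * bump x ^ k"
        using bump_bounds by (intro mult_right_mono) auto
      moreover have "0 \<le> 2 * B * (1 - \<delta>) ^ k"
        using B[of 0] \<delta> by simp
      ultimately show ?thesis by linarith
    qed
    have bound: "\<bar>(\<integral>x. \<phi> x * peak k x \<partial>torus_leb) - \<phi> 0\<bar> \<le> e + 2 * B / c * ((1 - \<delta>) / (1 - \<delta> / 2)) ^ k" for k
    proof -
      have i1: "integrable torus_leb (\<lambda>x. \<phi> x * bump x ^ k)"
        by (intro integrable_test_function test_function_mult \<phi> test_function_trig_poly trig_poly_power trig_poly_bump)
      have "(\<integral>x. \<phi> x * peak k x \<partial>torus_leb) = (\<integral>x. \<phi> x * bump x ^ k \<partial>torus_leb) / m k"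
        by (simp add: peak_def m_def)
      then have "(\<integral>x. \<phi> x * peak k x \<partial>torus_leb) - \<phi> 0 = (\<integral>x. (\<phi> x - \<phi> 0) * bump x ^ k \<partial>torus_leb) / m k"
        using mpos[of k] i1 int by (simp add: left_diff_distrib diff_divide_distrib m_def[symmetric])
      moreover have "\<bar>\<integral>x. (\<phi> x - \<phi> 0) * bump x ^ k \<partial>torus_leb\<bar> \<le> e * m k + 2 * B * (1 - \<delta>) ^ k"
      proof -
        have "\<bar>\<integral>x. (\<phi> x - \<phi> 0) * bump x ^ k \<partial>torus_leb\<bar> \<le> (\<integral>x. \<bar>(\<phi> x - \<phi> 0) * bump x ^ k\<bar> \<partial>torus_leb)"
          by (rule integral_abs_bound)
        also have "\<dots> \<le> (\<integral>x. e * bump x ^ k + 2 * B * (1 - \<delta>) ^ k \<partial>torus_leb)"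
        proof (rule integral_mono)
          have "integrable torus_leb (\<lambda>x. (\<phi> x - \<phi> 0) * bump x ^ k)"
            using i1 int by (simp add: left_diff_distrib)
          then show "integrable torus_leb (\<lambda>x. \<bar>(\<phi> x - \<phi> 0) * bump x ^ k\<bar>)" by simp
          show "integrable torus_leb (\<lambda>x. e * bump x ^ k + 2 * B * (1 - \<delta>) ^ k)"
            using int by simp
          fix x assume "x \<in> space torus_leb"
          then show "\<bar>(\<phi> x - \<phi> 0) * bump x ^ k\<bar> \<le> e * bump x ^ k + 2 * B * (1 - \<delta>) ^ k"
            using pointwise[of x k] bump_bounds[of x] by (simp add: space_torus_leb abs_mult)
        qed
        also have "\<dots> = e * m k + 2 * B * (1 - \<delta>) ^ k"
          using int by (simp add: m_def torus.prob_space)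
        finally show ?thesis .
      qed
      ultimately have "\<bar>(\<integral>x. \<phi> x * peak k x \<partial>torus_leb) - \<phi> 0\<bar> \<le> (e * m k + 2 * B * (1 - \<delta>) ^ k) / m k"
        using mpos[of k] by (simp add: divide_right_mono)
      also have "\<dots> = e + 2 * B * (1 - \<delta>) ^ k / m k"
        using mpos[of k] by (simp add: add_divide_distrib)
      also have "2 * B * (1 - \<delta>) ^ k / m k \<le> 2 * B * (1 - \<delta>) ^ k / (c * (1 - \<delta> / 2) ^ k)"
        using c \<delta> B[of 0] mpos[of k] by (intro divide_left_mono) auto
      finally show ?thesis by (simp add: power_divide)
    qed
    have "(\<lambda>k. 2 * B / c * ((1 - \<delta>) / (1 - \<delta> / 2)) ^ k) \<longlonglongrightarrow> 2 * B / c * 0"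
      using \<delta> by (intro tendsto_mult tendsto_const LIMSEQ_realpow_zero) (auto simp: field_simps)
    then have "\<forall>\<^sub>F k in sequentially. 2 * B / c * ((1 - \<delta>) / (1 - \<delta> / 2)) ^ k < e"
      using \<open>e > 0\<close> by (intro order_tendstoD(2)) auto
    then obtain N where "\<And>k. k \<ge> N \<Longrightarrow> 2 * B / c * ((1 - \<delta>) / (1 - \<delta> / 2)) ^ k < e"
      by (auto simp: eventually_sequentially)
    then show "\<exists>N. \<forall>k\<ge>N. norm ((\<integral>x. \<phi> x * peak k x \<partial>torus_leb) - \<phi> 0) < r"
      using bound unfolding e_def real_norm_def by (smt (verit) field_sum_of_halves)
  qed
  show ?thesis
    unfolding mollifier_def
  proof (intro conjI allI impI conv)
    show "test_function (peak k)" for k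
      by (intro test_function_trig_poly trig_poly_peak)
    show "0 \<le> peak k x" for k x
      using mpos[of k] bump_bounds[of x] by (simp add: peak_def m_def)
    show "(\<integral>x. peak k x \<partial>torus_leb) = 1" for k
      using mpos[of k] by (simp add: peak_def m_def)
  qed
qed

section \<open>Green functions\<close>

lemma integral_wave_eq_0:
  assumes "k \<noteq> 0 \<or> l \<noteq> 0"
  shows "(\<integral>x. wave k l s x \<partial>torus_leb) = 0"
proof -
  \<comment> \<open>A half-wavelength translation changes the sign of the wave.\<close>
  obtain w :: plane where w: "2 * pi * (of_int k * fst w + of_int l * snd w) = pi"
  proof (cases "k = 0")
    case False
    then show ?thesis by (intro that[of "(1 / (2 * of_int k), 0)"]) simp
  next
    case True
    with assms show ?thesis by (intro that[of "(0, 1 / (2 * of_int l))"]) simp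
  qed
  have "wave k l s (torus_map 1 0 0 1 x + w) = - wave k l s x" for x
  proof -
    have "wave k l s (torus_map 1 0 0 1 x + w)
        = cos (2 * pi * (of_int k * fst x + of_int l * snd x) + s + 2 * pi * (of_int k * fst w + of_int l * snd w))"
      by (simp add: wave_def torus_map_def algebra_simps)
    then show ?thesis unfolding w by (simp add: wave_def)
  qed
  then show ?thesis
    using integral_torus_affine(2)[of 1 1 0 0 "wave k l s" w]
      test_functionD(1,4)[OF test_function_wave[of k l s]] by simp
qed

lemma laplacian_wave:
  assumes "Im \<tau> > 0"
  shows "laplacian \<tau> (wave k l s) x
    = - (4 * pi\<^sup>2 * (cmod (of_int k * \<tau> - of_int l))\<^sup>2 / (Im \<tau>)\<^sup>2) * wave k l s x"
proof -
  have ww: "wave k l (s + pi / 2 + pi / 2) x = - wave k l s x"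
  proof -
    have "2 * pi * (of_int k * fst x + of_int l * snd x) + (s + pi / 2 + pi / 2)
        = 2 * pi * (of_int k * fst x + of_int l * snd x) + s + pi" by simp
    then show ?thesis unfolding wave_def by (simp only: cos_periodic_pi)
  qed
  have pdc: "pd1 (\<lambda>x. c * f x) = (\<lambda>x. c * pd1 f x)" "pd2 (\<lambda>x. c * f x) = (\<lambda>x. c * pd2 f x)"
    if "test_function f" for c f
  proof -
    have D: "((\<lambda>x. c * f x) has_derivative (\<lambda>h. c * (fst h * pd1 f x + snd h * pd2 f x))) (at x)" for x
      by (intro has_derivative_mult_right has_derivative_pd test_functionD(3)[OF that])
    show "pd1 (\<lambda>x. c * f x) = (\<lambda>x. c * pd1 f x)" "pd2 (\<lambda>x. c * f x) = (\<lambda>x. c * pd2 f x)"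
      using pd_of_has_derivative[OF D] by (auto simp: fun_eq_iff)
  qed
  have n: "(cmod (of_int k * \<tau> - of_int l))\<^sup>2
      = (cmod \<tau>)\<^sup>2 * (of_int k)\<^sup>2 - 2 * Re \<tau> * of_int k * of_int l + (of_int l)\<^sup>2"
    unfolding cmod_power2 by (simp add: power2_eq_square algebra_simps)
  show ?thesis
    unfolding laplacian_def pd_wave pdc[OF test_function_wave] ww n
    by (simp add: divide_inverse power2_eq_square algebra_simps)
qed

lemma green_functionD:
  assumes "green_function \<tau> G" "Im \<tau> > 0"
  shows "periodic G" "integrable torus_leb G" "G \<in> borel_measurable borel"
proof -
  show "periodic G" "integrable torus_leb G"
    using assms integrable_torus_vol by (auto simp: green_function_def)
  then show "G \<in> borel_measurable borel"
    by (intro borel_measurable_periodic) auto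
qed

text \<open>
  The Fourier multiplier of the Green function. For \<open>k = l = 0\<close> the division by zero gives \<open>0\<close>,
  which is the coefficient of a function of mean zero.
\<close>
definition green_coeff :: "complex \<Rightarrow> int \<Rightarrow> int \<Rightarrow> real" where
  "green_coeff \<tau> k l = Im \<tau> / (2 * pi * (cmod (of_int k * \<tau> - of_int l))\<^sup>2)"

text \<open>
  Waves are eigenfunctions of the Laplacian, so the distributional equation tested with a wave
  is an equation for the Fourier coefficient.
\<close>
lemma green_function_fourier:
  assumes G: "green_function \<tau> G" and \<tau>: "Im \<tau> > 0"
  shows "(\<integral>x. G (w - x) * wave k l s x \<partial>torus_leb) = green_coeff \<tau> k l * wave k l s w"
proof (cases "k = 0 \<and> l = 0")
  case True
  have "(\<integral>x. G (w - x) \<partial>torus_vol \<tau>) = 0"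
    using G unfolding green_function_def by blast
  moreover have m: "(\<lambda>x. G (w - x)) \<in> borel_measurable borel"
    using green_functionD(3)[OF G \<tau>] by measurable
  ultimately have "(\<integral>x. G (w - x) \<partial>torus_leb) = 0"
    using \<tau> integral_torus_vol[OF \<tau> m] by simp
  then show ?thesis using True by (simp add: wave_def green_coeff_def)
next
  case False
  define \<Lambda> where "\<Lambda> = 4 * pi\<^sup>2 * (cmod (of_int k * \<tau> - of_int l))\<^sup>2 / (Im \<tau>)\<^sup>2"
  have nz: "of_int k * \<tau> - of_int l \<noteq> 0"
  proof
    assume *: "of_int k * \<tau> - of_int l = 0"
    then have "Im (of_int k * \<tau> - of_int l) = 0" by simp
    then have "k = 0" using \<tau> by simp
    with * False show False by simp
  qed
  have [measurable]: "G \<in> borel_measurable borel"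
    by (rule green_functionD(3)[OF G \<tau>])
  have [measurable]: "wave k l s \<in> borel_measurable borel"
    by (rule test_functionD[OF test_function_wave])
  define I where "I = (\<integral>x. G (w - x) * wave k l s x \<partial>torus_leb)"
  have "- (\<integral>x. G (w - x) * laplacian \<tau> (wave k l s) x \<partial>torus_vol \<tau>)
      = 2 * pi * (wave k l s w - (\<integral>x. wave k l s x \<partial>torus_vol \<tau>) / Im \<tau>)"
    using G test_function_wave unfolding green_function_def by blast
  also have "(\<integral>x. wave k l s x \<partial>torus_vol \<tau>) = 0"
    using integral_wave_eq_0 False by (subst integral_torus_vol[OF \<tau>]) auto
  also have "(\<integral>x. G (w - x) * laplacian \<tau> (wave k l s) x \<partial>torus_vol \<tau>)
      = (\<integral>x. (- \<Lambda>) * (G (w - x) * wave k l s x) \<partial>torus_vol \<tau>)"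
    unfolding laplacian_wave[OF \<tau>] \<Lambda>_def by (intro Bochner_Integration.integral_cong) auto
  also have "\<dots> = Im \<tau> * ((- \<Lambda>) * I)"
    unfolding I_def by (subst integral_torus_vol[OF \<tau>]) simp_all
  finally have "Im \<tau> * \<Lambda> * I = 2 * pi * wave k l s w" by simp
  then have "(4 * pi\<^sup>2 * (cmod (of_int k * \<tau> - of_int l))\<^sup>2 / Im \<tau>) * I = 2 * pi * wave k l s w"
    using \<tau> by (simp add: \<Lambda>_def power2_eq_square)
  then show ?thesis
    using nz \<tau> unfolding I_def[symmetric] green_coeff_def
    by (simp add: field_simps power2_eq_square)
qed

lemma wave_torus_map:
  assumes det: "a * d - b * c = 1"
  shows "wave (a * k - c * l) (d * l - b * k) s (torus_map a b c d x) = wave k l s x"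
proof -
  have "of_int (a * k - c * l) * (of_int d * fst x + of_int b * snd x)
      + of_int (d * l - b * k) * (of_int c * fst x + of_int a * snd x)
     = of_int (a * d - b * c) * (of_int k * fst x + of_int l * snd x)"
    by (simp add: algebra_simps)
  then show ?thesis
    unfolding wave_def torus_map_def det by simp
qed

text \<open>
  The lattice vector of the new frequencies is \<open>c\<tau> + d\<close> times the old one, and the square of
  \<open>|c\<tau> + d|\<close> is also the ratio of the two imaginary parts.
\<close>
lemma green_coeff_moebius:
  assumes \<tau>: "Im \<tau> > 0" and det: "a * d - b * c = 1"
  shows "green_coeff \<tau> (a * k - c * l) (d * l - b * k) = green_coeff (moebius_map a b c d \<tau>) k l"
proof -
  define j where "j = of_int c * \<tau> + of_int d"
  have j: "j \<noteq> 0" unfolding j_def by (rule moebius_denominator_nonzero[OF \<tau> det])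
  have "of_int (a * k - c * l) * \<tau> - of_int (d * l - b * k) = j * (of_int k * moebius_map a b c d \<tau> - of_int l)"
  proof -
    have "j * moebius_map a b c d \<tau> = of_int a * \<tau> + of_int b"
      using j by (simp add: moebius_map_def j_def[symmetric])
    moreover have "j * (of_int k * m - of_int l) = of_int k * (j * m) - of_int l * j" for m
      by (simp add: algebra_simps)
    ultimately show ?thesis by (simp add: j_def algebra_simps)
  qed
  then show ?thesis
    unfolding green_coeff_def Im_moebius_map[OF \<tau> det] j_def[symmetric]
    using j by (simp add: norm_mult power_mult_distrib)
qed

lemma integrable_mult_test_function:
  assumes "integrable torus_leb u" "test_function f"
  shows "integrable torus_leb (\<lambda>x. u x * f x)"
proof -
  obtain B where B: "\<And>x. \<bar>f x\<bar> \<le> B"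
    using periodic_continuous_bounded test_functionD[OF assms(2)] by metis
  have [measurable]: "f \<in> borel_measurable borel"
    by (rule test_functionD[OF assms(2)])
  show ?thesis
  proof (rule Bochner_Integration.integrable_bound)
    show "integrable torus_leb (\<lambda>x. B * u x)" using assms by simp
    show "(\<lambda>x. u x * f x) \<in> borel_measurable torus_leb"
      using assms(1) by measurable
    have "\<bar>u x\<bar> * \<bar>f x\<bar> \<le> \<bar>u x\<bar> * \<bar>B\<bar>" for x
      using B[of x] by (intro mult_left_mono) auto
    then show "AE x in torus_leb. norm (u x * f x) \<le> norm (B * u x)"
      by (simp add: abs_mult mult.commute)
  qed
qed

interpretation torus_pair: pair_sigma_finite torus_leb torus_leb ..

lemma measurable_ident_torus: "(\<lambda>x. x) \<in> torus_leb \<rightarrow>\<^sub>M borel"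
  by (rule borel_measurable_torus_leb) simp

lemma measurable_compose_difference:
  fixes F :: "plane \<Rightarrow> real"
  assumes "(\<lambda>x. x) \<in> M \<rightarrow>\<^sub>M borel" "(\<lambda>x. x) \<in> N \<rightarrow>\<^sub>M borel" and F: "F \<in> borel_measurable borel"
  shows "(\<lambda>p. F (fst p - snd p)) \<in> borel_measurable (M \<Otimes>\<^sub>M N)"
    and "(\<lambda>p. F (snd p - fst p)) \<in> borel_measurable (M \<Otimes>\<^sub>M N)"
proof -
  have m: "fst \<in> M \<Otimes>\<^sub>M N \<rightarrow>\<^sub>M borel" "snd \<in> M \<Otimes>\<^sub>M N \<rightarrow>\<^sub>M borel"
    using measurable_compose[OF measurable_fst assms(1)] measurable_compose[OF measurable_snd assms(2)] by auto
  show "(\<lambda>p. F (fst p - snd p)) \<in> borel_measurable (M \<Otimes>\<^sub>M N)"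
    by (rule measurable_compose[OF _ F]) (intro borel_measurable_diff m)
  show "(\<lambda>p. F (snd p - fst p)) \<in> borel_measurable (M \<Otimes>\<^sub>M N)"
    by (rule measurable_compose[OF _ F]) (intro borel_measurable_diff m)
qed

text \<open>
  The reflected translates of \<open>peak k\<close> are trigonometric polynomials, so by Fubini's theorem \<open>u\<close>
  is orthogonal to the mollified function \<open>\<psi> k\<close>. These converge to \<open>\<phi>\<close> boundedly. The use of a
  mollifier made of trigonometric polynomials thus replaces the theorem of Stone and Weierstrass
  on the torus.
\<close>
lemma fourier_uniqueness:
  assumes u: "integrable torus_leb u"
    and coeff: "\<And>k l s. (\<integral>x. u x * wave k l s x \<partial>torus_leb) = 0"
    and \<phi>: "test_function \<phi>"
  shows "(\<integral>x. u x * \<phi> x \<partial>torus_leb) = 0"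
proof -
  have trig: "(\<integral>x. u x * p x \<partial>torus_leb) = 0" if "trig_poly p" for p
    using that
  proof (induction rule: trig_poly.induct)
    case (add f g)
    then show ?case
      using integrable_mult_test_function[OF u test_function_trig_poly]
      by (simp add: distrib_left)
  qed (simp_all add: coeff mult.left_commute)
  have um [measurable]: "u \<in> borel_measurable torus_leb" using u by auto
  have \<phi>m [measurable]: "\<phi> \<in> borel_measurable torus_leb"
    by (intro borel_measurable_torus_leb test_functionD[OF \<phi>])
  obtain B where B: "\<And>x. \<bar>\<phi> x\<bar> \<le> B"
    using periodic_continuous_bounded test_functionD[OF \<phi>] by metis
  define \<psi> where "\<psi> k y = (\<integral>x. \<phi> x * peak k (x - y) \<partial>torus_leb)" for k y
  have tp: "test_function (peak k)" for k
    by (intro test_function_trig_poly trig_poly_peak)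
  have tpm: "peak k \<in> borel_measurable borel" for k
    by (rule test_functionD[OF tp])
  have shift: "\<psi> k y = (\<integral>x. \<phi> (x + y) * peak k x \<partial>torus_leb)" for k y
  proof -
    let ?F = "\<lambda>x. \<phi> (x + y) * peak k x"
    have "test_function ?F"
      using test_function_mult[OF test_function_torus_map[OF \<phi>, of 1 0 0 1 y] tp] by (simp add: torus_map_def)
    then show ?thesis
      using integral_torus_affine(2)[of 1 1 0 0 ?F "- y"] test_functionD(1,4)
      by (simp add: \<psi>_def torus_map_def)
  qed
  have lim: "(\<lambda>k. \<psi> k y) \<longlonglongrightarrow> \<phi> y" for y
  proof -
    have "test_function (\<lambda>x. \<phi> (x + y))"
      using test_function_torus_map[OF \<phi>, of 1 0 0 1 y] by (simp add: torus_map_def)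
    then show ?thesis
      using mollifier_peak unfolding shift mollifier_def by fastforce
  qed
  have bnd: "\<bar>\<psi> k y\<bar> \<le> B" for k y
  proof -
    have pk: "integrable torus_leb (peak k)" "\<And>x. 0 \<le> peak k x" "(\<integral>x. peak k x \<partial>torus_leb) = 1"
      using mollifier_peak integrable_test_function[OF tp] by (auto simp: mollifier_def)
    have "\<bar>\<psi> k y\<bar> \<le> (\<integral>x. \<bar>\<phi> (x + y) * peak k x\<bar> \<partial>torus_leb)"
      unfolding shift by (rule integral_abs_bound)
    also have "\<dots> \<le> (\<integral>x. B * peak k x \<partial>torus_leb)"
    proof (rule integral_mono)
      have "test_function (\<lambda>x. \<phi> (x + y) * peak k x)"
        using test_function_mult[OF test_function_torus_map[OF \<phi>, of 1 0 0 1 y] tp] by (simp add: torus_map_def)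
      then show "integrable torus_leb (\<lambda>x. \<bar>\<phi> (x + y) * peak k x\<bar>)"
        by (intro integrable_abs integrable_test_function)
      show "integrable torus_leb (\<lambda>x. B * peak k x)" using pk by simp
      show "\<bar>\<phi> (x + y) * peak k x\<bar> \<le> B * peak k x" for x
        using B pk(2)[of x] by (simp add: abs_mult mult_right_mono)
    qed
    also have "\<dots> = B" using pk by simp
    finally show ?thesis .
  qed
  have zero: "(\<integral>y. u y * \<psi> k y \<partial>torus_leb) = 0" for k
  proof -
    obtain C where C: "\<And>x. \<bar>peak k x\<bar> \<le> C"
      using periodic_continuous_bounded test_functionD[OF tp] by metis
    have BC: "0 \<le> B" "0 \<le> C" using B[of 0] C[of 0] by linarith+
    let ?F = "\<lambda>(x, y). u y * (\<phi> x * peak k (x - y))"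
    have m: "?F \<in> borel_measurable (torus_leb \<Otimes>\<^sub>M torus_leb)"
      unfolding split_beta
      by (intro borel_measurable_times measurable_compose_difference measurable_ident_torus tpm
          measurable_compose[OF measurable_snd um] measurable_compose[OF measurable_fst \<phi>m])
    have "integrable (torus_leb \<Otimes>\<^sub>M torus_leb) ?F"
    proof (rule Bochner_Integration.integrable_bound[OF _ m])
      show "integrable (torus_leb \<Otimes>\<^sub>M torus_leb) (\<lambda>(x, y). (B * C) * u y)"
      proof (rule torus_pair.Fubini_integrable)
        show "(\<lambda>(x, y). (B * C) * u y) \<in> borel_measurable (torus_leb \<Otimes>\<^sub>M torus_leb)" by measurable
        show "integrable torus_leb (\<lambda>x. \<integral>y. norm (case (x, y) of (x, y) \<Rightarrow> (B * C) * u y) \<partial>torus_leb)" by simp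
        show "AE x in torus_leb. integrable torus_leb (\<lambda>y. case (x, y) of (x, y) \<Rightarrow> (B * C) * u y)"
          using u by simp
      qed
      have "\<bar>u y\<bar> * (\<bar>\<phi> x\<bar> * \<bar>peak k (x - y)\<bar>) \<le> \<bar>u y\<bar> * (B * C)" for x y
        using B C BC by (intro mult_left_mono mult_mono) auto
      then show "AE p in torus_leb \<Otimes>\<^sub>M torus_leb. norm (?F p) \<le> norm (case p of (x, y) \<Rightarrow> (B * C) * u y)"
        using BC by (auto simp: abs_mult mult_ac split: prod.split)
    qed
    from torus_pair.Fubini_integral[OF this]
    have "(\<integral>y. u y * \<psi> k y \<partial>torus_leb) = (\<integral>x. \<integral>y. u y * (\<phi> x * peak k (x - y)) \<partial>torus_leb \<partial>torus_leb)"
      by (simp add: \<psi>_def)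
    also have "\<dots> = (\<integral>x. \<phi> x * (\<integral>y. u y * peak k (x - y) \<partial>torus_leb) \<partial>torus_leb)"
      by (simp add: mult.left_commute)
    also have "\<dots> = 0"
      by (simp add: trig trig_poly_reflect[OF trig_poly_peak])
    finally show ?thesis .
  qed
  have "(\<lambda>k. \<integral>y. u y * \<psi> k y \<partial>torus_leb) \<longlonglongrightarrow> (\<integral>y. u y * \<phi> y \<partial>torus_leb)"
  proof (rule integral_dominated_convergence[where w = "\<lambda>y. B * \<bar>u y\<bar>"])
    show "(\<lambda>y. u y * \<psi> k y) \<in> borel_measurable torus_leb" for k
    proof -
      have "\<psi> k \<in> borel_measurable torus_leb"
        unfolding \<psi>_def
      proof (rule torus.borel_measurable_lebesgue_integral)
        show "(\<lambda>(y, x). \<phi> x * peak k (x - y)) \<in> borel_measurable (torus_leb \<Otimes>\<^sub>M torus_leb)"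
          unfolding split_beta
          by (intro borel_measurable_times measurable_compose_difference measurable_ident_torus tpm
              measurable_compose[OF measurable_snd \<phi>m])
      qed
      then show ?thesis by measurable
    qed
    show "AE y in torus_leb. (\<lambda>k. u y * \<psi> k y) \<longlonglongrightarrow> u y * \<phi> y"
      using lim by (auto intro!: tendsto_intros)
    show "AE y in torus_leb. norm (u y * \<psi> k y) \<le> B * \<bar>u y\<bar>" for k
    proof (rule AE_I2)
      fix y
      have "\<bar>u y\<bar> * \<bar>\<psi> k y\<bar> \<le> \<bar>u y\<bar> * B"
        using bnd by (intro mult_left_mono) auto
      then show "norm (u y * \<psi> k y) \<le> B * \<bar>u y\<bar>"
        by (simp add: abs_mult mult.commute)
    qed
  qed (use u in auto)
  then show ?thesis unfolding zero using LIMSEQ_const_iff by metis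
qed

text \<open>
  Both kernels have the same Fourier coefficients. As they agree only almost everywhere, their
  equality is expressed by integrals against test functions; it holds for every \<open>w\<close>.
\<close>
lemma green_function_transport:
  assumes \<tau>: "Im \<tau> > 0" and det: "a * d - b * c = 1"
    and G: "green_function \<tau> G" and G': "green_function (moebius_map a b c d \<tau>) G'"
    and \<phi>: "test_function \<phi>"
  shows "(\<integral>x. G' (w - x) * \<phi> x \<partial>torus_leb) = (\<integral>x. G (torus_map a b c d (w - x)) * \<phi> x \<partial>torus_leb)"
proof -
  let ?A = "torus_map a b c d"
  note \<tau>' = Im_moebius_map_pos[OF \<tau> det]
  note GD = green_functionD[OF G \<tau>] and GD' = green_functionD[OF G' \<tau>']
  have det': "(- a) * (- d) - (- b) * (- c) = 1" using det by simp
  have eq: "?A (w - x) = torus_map (- a) (- b) (- c) (- d) x + ?A w" for x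
    by (simp add: torus_map_def prod_eq_iff algebra_simps)
  have i: "integrable torus_leb (\<lambda>x. G (?A (w - x)))"
    unfolding eq using integral_torus_affine(1)[OF det' GD(3,1)] GD(2) by simp
  have i': "integrable torus_leb (\<lambda>x. G' (w - x))"
    using integral_torus_reflect(1)[OF GD'(3,1)] GD'(2) by simp
  have coeff: "(\<integral>x. G (?A (w - x)) * wave k l s x \<partial>torus_leb)
      = (\<integral>x. G' (w - x) * wave k l s x \<partial>torus_leb)" for k l s
  proof -
    let ?W = "wave (a * k - c * l) (d * l - b * k) s"
    let ?F = "\<lambda>y. G (?A w - y) * ?W y"
    have [measurable]: "G \<in> borel_measurable borel" "?W \<in> borel_measurable borel"
      using GD test_functionD(4)[OF test_function_wave] by auto
    have F: "?F \<in> borel_measurable borel" by measurable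
    have "periodic (\<lambda>y. G (torus_map (-1) 0 0 (-1) y + ?A w))"
      by (rule periodic_torus_map[OF GD(1)])
    moreover have "torus_map (-1) 0 0 (-1) y + ?A w = ?A w - y" for y
      by (simp add: torus_map_def prod_eq_iff)
    ultimately have pF: "periodic ?F"
      using periodic_wave[of "a * k - c * l" "d * l - b * k" s] by (simp add: periodic_def)
    have "(\<integral>x. G (?A (w - x)) * wave k l s x \<partial>torus_leb) = (\<integral>x. ?F (?A x) \<partial>torus_leb)"
      by (simp add: torus_map_diff wave_torus_map[OF det])
    also have "\<dots> = (\<integral>y. ?F y \<partial>torus_leb)"
      using integral_torus_affine(2)[OF det F pF, of 0] by simp
    also have "\<dots> = green_coeff \<tau> (a * k - c * l) (d * l - b * k) * ?W (?A w)"
      by (rule green_function_fourier[OF G \<tau>])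
    also have "\<dots> = green_coeff (moebius_map a b c d \<tau>) k l * wave k l s w"
      by (simp add: green_coeff_moebius[OF \<tau> det] wave_torus_map[OF det])
    finally show ?thesis using green_function_fourier[OF G' \<tau>'] by simp
  qed
  have "(\<integral>x. (G' (w - x) - G (?A (w - x))) * \<phi> x \<partial>torus_leb) = 0"
  proof (rule fourier_uniqueness[OF _ _ \<phi>])
    show "integrable torus_leb (\<lambda>x. G' (w - x) - G (?A (w - x)))" using i i' by simp
    show "(\<integral>x. (G' (w - x) - G (?A (w - x))) * wave k l s x \<partial>torus_leb) = 0" for k l s
      using coeff[of k l s] integrable_mult_test_function[OF i test_function_wave]
        integrable_mult_test_function[OF i' test_function_wave]
      by (simp add: left_diff_distrib)
  qed
  then show ?thesis
    using integrable_mult_test_function[OF i \<phi>] integrable_mult_test_function[OF i' \<phi>]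
    by (simp add: left_diff_distrib)
qed

definition green_form :: "(plane \<Rightarrow> real) \<Rightarrow> (plane \<Rightarrow> real) \<Rightarrow> (plane \<Rightarrow> real) \<Rightarrow> real" where
  "green_form G f g = (\<integral>x. (\<integral>y. f x * g y * G (x - y) \<partial>torus_leb) \<partial>torus_leb)"

lemma green_form_transport:
  assumes \<tau>: "Im \<tau> > 0" and det: "a * d - b * c = 1"
    and G: "green_function \<tau> G" and G': "green_function (moebius_map a b c d \<tau>) G'"
    and f: "test_function f" and g: "test_function g"
  shows "green_form G' (\<lambda>x. f (torus_map a b c d x)) (\<lambda>x. g (torus_map a b c d x)) = green_form G f g"
proof -
  let ?A = "torus_map a b c d"
  note GD = green_functionD[OF G \<tau>]
  have [measurable]: "G \<in> borel_measurable borel" "f \<in> borel_measurable borel" "g \<in> borel_measurable borel"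
    using GD test_functionD(4) f g by auto
  define K where "K u = (\<integral>y. G (u - y) * g y \<partial>torus_leb)" for u
  have gA: "test_function (\<lambda>x. g (?A x))"
    using test_function_torus_map[OF g, of a b c d 0] by simp
  have pG: "periodic (\<lambda>y. G (u - y))" for u
  proof -
    have "torus_map (-1) 0 0 (-1) y + u = u - y" for y
      by (simp add: torus_map_def prod_eq_iff)
    then show ?thesis using periodic_torus_map[OF GD(1), of "-1" 0 0 "-1" u] by simp
  qed
  have inner: "(\<integral>y. G' (x - y) * g (?A y) \<partial>torus_leb) = K (?A x)" for x
  proof -
    let ?F = "\<lambda>y. G (?A x - y) * g y"
    have "periodic ?F"
      using pG[of "?A x"] test_functionD(1)[OF g] by (simp add: periodic_def)
    moreover have "?F \<in> borel_measurable borel" by measurable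
    ultimately have "(\<integral>y. ?F (?A y) \<partial>torus_leb) = K (?A x)"
      using integral_torus_affine(2)[OF det, of ?F 0] by (simp add: K_def)
    then show ?thesis
      using green_function_transport[OF \<tau> det G G' gA, of x] by (simp add: torus_map_diff)
  qed
  have Km: "K \<in> borel_measurable borel"
    unfolding K_def
  proof (rule torus.borel_measurable_lebesgue_integral)
    show "(\<lambda>(u, y). G (u - y) * g y) \<in> borel_measurable (borel \<Otimes>\<^sub>M torus_leb)"
      unfolding split_beta
      by (intro borel_measurable_times measurable_compose_difference measurable_ident_torus GD
          measurable_ident measurable_compose[OF measurable_snd] borel_measurable_torus_leb test_functionD[OF g])
         (simp add: id_def[symmetric])
  qed
  have Kp: "periodic K"
  proof (rule periodicI)
    fix x :: plane and i j
    have "G (x + (of_int i, of_int j) - y) = G (x - y)" for y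
      using periodicD[OF GD(1), of "x - y" i j] by (simp add: algebra_simps)
    then show "K (x + (of_int i, of_int j)) = K x" by (simp add: K_def)
  qed
  have "green_form G' (\<lambda>x. f (?A x)) (\<lambda>x. g (?A x))
      = (\<integral>x. f (?A x) * (\<integral>y. G' (x - y) * g (?A y) \<partial>torus_leb) \<partial>torus_leb)"
    by (simp add: green_form_def mult_ac flip: integral_mult_right_zero)
  also have "\<dots> = (\<integral>x. f (?A x) * K (?A x) \<partial>torus_leb)"
    unfolding inner ..
  also have "\<dots> = (\<integral>x. f x * K x \<partial>torus_leb)"
  proof -
    have "periodic (\<lambda>x. f x * K x)"
      using Kp test_functionD(1)[OF f] by (simp add: periodic_def)
    then show ?thesis
      using integral_torus_affine(2)[OF det, of "\<lambda>x. f x * K x" 0] Km by simp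
  qed
  also have "\<dots> = green_form G f g"
    by (simp add: green_form_def K_def mult_ac flip: integral_mult_right_zero)
  finally show ?thesis .
qed

section \<open>Joint laws and characteristic functions\<close>

lemma integrable_bounded_mult_cis:
  fixes u f :: "'w \<Rightarrow> real"
  assumes u: "integrable M u" and [measurable]: "f \<in> borel_measurable M"
  shows "integrable M (\<lambda>\<omega>. of_real (u \<omega>) * cis (f \<omega>))"
proof (rule Bochner_Integration.integrable_bound[OF u])
  have [measurable]: "u \<in> borel_measurable M" using u by auto
  show "(\<lambda>\<omega>. of_real (u \<omega>) * cis (f \<omega>)) \<in> borel_measurable M"
    unfolding cis_conv_exp by measurable
  show "AE \<omega> in M. norm (of_real (u \<omega>) * cis (f \<omega>)) \<le> norm (u \<omega>)"
    by (simp add: norm_mult)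
qed

text \<open>
  Levy's uniqueness theorem for the images of the normalised measures with densities \<open>u\<close> and
  \<open>v\<close>. The weights are what allows an induction on the number of variables.
\<close>
lemma weighted_charfun_uniqueness:
  fixes u f :: "'w \<Rightarrow> real" and v g :: "'v \<Rightarrow> real"
  assumes u: "integrable M u" "\<And>\<omega>. 0 \<le> u \<omega>" and v: "integrable N v" "\<And>\<omega>. 0 \<le> v \<omega>"
    and [measurable]: "f \<in> borel_measurable M" "g \<in> borel_measurable N" "B \<in> sets borel"
    and eq: "\<And>t. (\<integral>\<omega>. of_real (u \<omega>) * cis (t * f \<omega>) \<partial>M) = (\<integral>\<omega>. of_real (v \<omega>) * cis (t * g \<omega>) \<partial>N)"
  shows "(\<integral>\<omega>. u \<omega> * indicator B (f \<omega>) \<partial>M) = (\<integral>\<omega>. v \<omega> * indicator B (g \<omega>) \<partial>N)"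
proof -
  define m where "m = (\<integral>\<omega>. u \<omega> \<partial>M)"
  have m': "m = (\<integral>\<omega>. v \<omega> \<partial>N)"
    using eq[of 0] by (simp add: m_def)
  have "m \<ge> 0" unfolding m_def using u by simp
  show ?thesis
  proof (cases "m = 0")
    case True
    have "AE \<omega> in M. u \<omega> = 0"
      using True u by (simp add: m_def integral_nonneg_eq_0_iff_AE)
    then have "(\<integral>\<omega>. u \<omega> * indicator B (f \<omega>) \<partial>M) = 0"
      by (intro integral_eq_zero_AE) auto
    moreover have "AE \<omega> in N. v \<omega> = 0"
      using True v by (simp add: m' integral_nonneg_eq_0_iff_AE)
    then have "(\<integral>\<omega>. v \<omega> * indicator B (g \<omega>) \<partial>N) = 0"
      by (intro integral_eq_zero_AE) auto
    ultimately show ?thesis by simp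
  next
    case False
    with \<open>m \<ge> 0\<close> have "m > 0" by simp
    have *: "real_distribution (distr (density L (\<lambda>\<omega>. ennreal (w \<omega> / m))) borel h)
        \<and> (\<forall>t. char (distr (density L (\<lambda>\<omega>. ennreal (w \<omega> / m))) borel h) t
            = (\<integral>\<omega>. of_real (w \<omega>) * cis (t * h \<omega>) \<partial>L) / m)
        \<and> measure (distr (density L (\<lambda>\<omega>. ennreal (w \<omega> / m))) borel h) B
            = (\<integral>\<omega>. w \<omega> * indicator B (h \<omega>) \<partial>L) / m"
      if w: "integrable L w" "\<And>\<omega>. 0 \<le> w \<omega>" and [measurable]: "h \<in> borel_measurable L"
        and mm: "m = (\<integral>\<omega>. w \<omega> \<partial>L)" for L :: "'x measure" and w h
    proof -
      have [measurable]: "w \<in> borel_measurable L" using w by auto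
      let ?D = "density L (\<lambda>\<omega>. ennreal (w \<omega> / m))"
      interpret D: prob_space ?D
      proof
        have "emeasure ?D (space ?D) = (\<integral>\<^sup>+\<omega>. ennreal (w \<omega> / m) \<partial>L)"
          by (subst emeasure_density) (auto intro!: nn_integral_cong)
        also have "\<dots> = ennreal (\<integral>\<omega>. w \<omega> / m \<partial>L)"
          using w \<open>m > 0\<close> by (intro nn_integral_eq_integral) auto
        also have "\<dots> = 1" using \<open>m > 0\<close> mm by simp
        finally show "emeasure ?D (space ?D) = 1" .
      qed
      have "real_distribution (distr ?D borel h)"
        by (rule D.real_distribution_distr) simp
      moreover have "char (distr ?D borel h) t = (\<integral>\<omega>. of_real (w \<omega>) * cis (t * h \<omega>) \<partial>L) / m" for t
      proof -
        have "char (distr ?D borel h) t = (\<integral>\<omega>. cis (t * h \<omega>) \<partial>?D)"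
          unfolding char_def by (subst integral_distr) (auto simp: cis_conv_exp)
        also have "\<dots> = (\<integral>\<omega>. (w \<omega> / m) *\<^sub>R cis (t * h \<omega>) \<partial>L)"
          using w \<open>m > 0\<close> by (subst integral_density) (auto simp: cis_conv_exp)
        also have "\<dots> = (\<integral>\<omega>. (of_real (w \<omega>) * cis (t * h \<omega>)) / m \<partial>L)"
          by (intro Bochner_Integration.integral_cong) (auto simp: scaleR_conv_of_real)
        finally show ?thesis by simp
      qed
      moreover have "measure (distr ?D borel h) B = (\<integral>\<omega>. w \<omega> * indicator B (h \<omega>) \<partial>L) / m"
      proof -
        have "measure (distr ?D borel h) B = (\<integral>x. indicator B x \<partial>distr ?D borel h)"
          by simp
        also have "\<dots> = (\<integral>\<omega>. indicator B (h \<omega>) \<partial>?D)"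
          by (subst integral_distr) auto
        also have "\<dots> = (\<integral>\<omega>. (w \<omega> / m) *\<^sub>R indicator B (h \<omega>) \<partial>L)"
          using w \<open>m > 0\<close> by (subst integral_density) auto
        finally show ?thesis by simp
      qed
      ultimately show ?thesis by blast
    qed
    note 1 = *[OF u \<open>f \<in> borel_measurable M\<close> m_def] and 2 = *[OF v \<open>g \<in> borel_measurable N\<close> m']
    have "distr (density M (\<lambda>\<omega>. ennreal (u \<omega> / m))) borel f = distr (density N (\<lambda>\<omega>. ennreal (v \<omega> / m))) borel g"
      using 1 2 eq by (intro Levy_uniqueness) (auto simp: fun_eq_iff)
    with 1 2 \<open>m > 0\<close> show ?thesis by (metis divide_cancel_right less_irrefl)
  qed
qed

text \<open>
  The multidimensional uniqueness theorem, reduced to one variable. In the inductive step the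
  exponentials of the variables in \<open>J\<close> are put into the weight, as \<open>2 + cos (s + \<Sum> t\<^sub>j f\<^sub>j)\<close> in
  order to keep it nonnegative. The one-dimensional theorem then replaces the exponential of the
  new variable by the indicator of \<open>B i\<close>. After this exchange the indicator is absorbed into the
  weight, and the induction hypothesis handles \<open>J\<close>.
\<close>
lemma joint_charfun_uniqueness:
  fixes u :: "'w \<Rightarrow> real" and v :: "'v \<Rightarrow> real" and f :: "'i \<Rightarrow> 'w \<Rightarrow> real" and g :: "'i \<Rightarrow> 'v \<Rightarrow> real"
  assumes "finite J"
    and "integrable M u" "\<And>\<omega>. 0 \<le> u \<omega>" "integrable N v" "\<And>\<omega>. 0 \<le> v \<omega>"
    and "\<And>j. j \<in> J \<Longrightarrow> f j \<in> borel_measurable M" "\<And>j. j \<in> J \<Longrightarrow> g j \<in> borel_measurable N"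
    and "\<And>j. j \<in> J \<Longrightarrow> B j \<in> sets borel"
    and "\<And>t. (\<integral>\<omega>. of_real (u \<omega>) * cis (\<Sum>j\<in>J. t j * f j \<omega>) \<partial>M)
             = (\<integral>\<omega>. of_real (v \<omega>) * cis (\<Sum>j\<in>J. t j * g j \<omega>) \<partial>N)"
  shows "(\<integral>\<omega>. u \<omega> * (\<Prod>j\<in>J. indicator (B j) (f j \<omega>)) \<partial>M)
       = (\<integral>\<omega>. v \<omega> * (\<Prod>j\<in>J. indicator (B j) (g j \<omega>)) \<partial>N)"
  using assms
proof (induction J arbitrary: u v rule: finite_induct)
  case empty
  from empty.prems(8)[of "\<lambda>_. 0"] show ?case by simp
next
  case (insert i J)
  have fm [measurable]: "f i \<in> borel_measurable M" "\<And>j. j \<in> J \<Longrightarrow> f j \<in> borel_measurable M"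
   and gm [measurable]: "g i \<in> borel_measurable N" "\<And>j. j \<in> J \<Longrightarrow> g j \<in> borel_measurable N"
   and [measurable]: "B i \<in> sets borel" "u \<in> borel_measurable M" "v \<in> borel_measurable N"
    using insert.prems by auto
  have fball: "\<forall>j\<in>insert i J. f j \<in> borel_measurable M" and gball: "\<forall>j\<in>insert i J. g j \<in> borel_measurable N"
    using insert.prems by auto
  have F[measurable]: "(\<lambda>\<omega>. \<Sum>j\<in>J. t j * f j \<omega>) \<in> borel_measurable M"
   and G[measurable]: "(\<lambda>\<omega>. \<Sum>j\<in>J. t j * g j \<omega>) \<in> borel_measurable N" for t
    by (auto intro!: borel_measurable_sum borel_measurable_times)
  have bound_int: "integrable L (\<lambda>\<omega>. w \<omega> * h \<omega>)"
    if w: "integrable L w" and hm: "h \<in> borel_measurable L" and b: "\<And>\<omega>. \<bar>h \<omega>\<bar> \<le> 3"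
    for L :: "'x measure" and w h :: "'x \<Rightarrow> real"
  proof (rule Bochner_Integration.integrable_bound)
    show "integrable L (\<lambda>\<omega>. 3 * w \<omega>)" using w by simp
    show "(\<lambda>\<omega>. w \<omega> * h \<omega>) \<in> borel_measurable L" using w hm by measurable
    have "\<bar>w \<omega>\<bar> * \<bar>h \<omega>\<bar> \<le> \<bar>w \<omega>\<bar> * 3" for \<omega> using b by (intro mult_left_mono) auto
    then show "AE \<omega> in L. norm (w \<omega> * h \<omega>) \<le> norm (3 * w \<omega>)" by (simp add: abs_mult mult.commute)
  qed
  \<comment> \<open>The weight is nonnegative for \<open>r = 0\<close> and for \<open>r = 1\<close>; the difference of the two cases isolates the cosine.\<close>
  have cosine: "(\<integral>\<omega>. u \<omega> * indicator (B i) (f i \<omega>) * cos (s + (\<Sum>j\<in>J. t j * f j \<omega>)) \<partial>M)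
      = (\<integral>\<omega>. v \<omega> * indicator (B i) (g i \<omega>) * cos (s + (\<Sum>j\<in>J. t j * g j \<omega>)) \<partial>N)" for s t
  proof -
    have main: "(\<integral>\<omega>. (u \<omega> * (2 + r * cos (s + (\<Sum>j\<in>J. t j * f j \<omega>)))) * indicator (B i) (f i \<omega>) \<partial>M)
        = (\<integral>\<omega>. (v \<omega> * (2 + r * cos (s + (\<Sum>j\<in>J. t j * g j \<omega>)))) * indicator (B i) (g i \<omega>) \<partial>N)"
      if r: "r = 0 \<or> r = 1" for r
    proof (rule weighted_charfun_uniqueness)
      have b: "\<bar>2 + r * cos x\<bar> \<le> 3" "0 \<le> 2 + r * cos x" for x
      proof -
        have "\<bar>r * cos x\<bar> \<le> 1"
          using r by (auto simp: abs_mult)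
        then show "\<bar>2 + r * cos x\<bar> \<le> 3" "0 \<le> 2 + r * cos x" by linarith+
      qed
      show "integrable M (\<lambda>\<omega>. u \<omega> * (2 + r * cos (s + (\<Sum>j\<in>J. t j * f j \<omega>))))"
        by (rule bound_int[OF insert.prems(1) _ b(1)]) measurable
      show "integrable N (\<lambda>\<omega>. v \<omega> * (2 + r * cos (s + (\<Sum>j\<in>J. t j * g j \<omega>))))"
        by (rule bound_int[OF insert.prems(3) _ b(1)]) measurable
      show "0 \<le> u \<omega> * (2 + r * cos (s + (\<Sum>j\<in>J. t j * f j \<omega>)))" for \<omega>
        using insert.prems(2) b(2) by (intro mult_nonneg_nonneg) auto
      show "0 \<le> v \<omega> * (2 + r * cos (s + (\<Sum>j\<in>J. t j * g j \<omega>)))" for \<omega>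
        using insert.prems(4) b(2) by (intro mult_nonneg_nonneg) auto
      fix x
      have expand: "(\<integral>\<omega>. of_real (w \<omega> * (2 + r * cos (s + (\<Sum>j\<in>J. t j * h j \<omega>)))) * cis (x * h i \<omega>) \<partial>L)
        = 2 * (\<integral>\<omega>. of_real (w \<omega>) * cis (\<Sum>j\<in>insert i J. ((\<lambda>_. 0)(i := x)) j * h j \<omega>) \<partial>L)
        + of_real (r / 2) * cis s * (\<integral>\<omega>. of_real (w \<omega>) * cis (\<Sum>j\<in>insert i J. (t(i := x)) j * h j \<omega>) \<partial>L)
        + of_real (r / 2) * cis (- s) * (\<integral>\<omega>. of_real (w \<omega>) * cis (\<Sum>j\<in>insert i J. ((\<lambda>j. - t j)(i := x)) j * h j \<omega>) \<partial>L)"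
        if w: "integrable L w" and hm: "\<forall>j\<in>insert i J. h j \<in> borel_measurable L"
        for L :: "'x measure" and w and h :: "'i \<Rightarrow> 'x \<Rightarrow> real"
      proof -
        have sm: "(\<Sum>j\<in>insert i J. (t'(i := x)) j * h j \<omega>) = x * h i \<omega> + (\<Sum>j\<in>J. t' j * h j \<omega>)" for t' \<omega>
        proof -
          have "(\<Sum>j\<in>J. (t'(i := x)) j * h j \<omega>) = (\<Sum>j\<in>J. t' j * h j \<omega>)"
            using insert.hyps(2) by (intro sum.cong) auto
          then show ?thesis using insert.hyps by simp
        qed
        have int: "integrable L (\<lambda>\<omega>. of_real (w \<omega>) * cis (\<Sum>j\<in>insert i J. t' j * h j \<omega>))" for t'
          using hm by (intro integrable_bounded_mult_cis w borel_measurable_sum borel_measurable_times) auto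
        have c: "of_real (cos y) = (cis y + cis (- y)) / 2" for y
          by (simp add: complex_eq_iff)
        have "of_real (w \<omega> * (2 + r * cos (s + (\<Sum>j\<in>J. t j * h j \<omega>)))) * cis (x * h i \<omega>)
          = 2 * (of_real (w \<omega>) * cis (\<Sum>j\<in>insert i J. ((\<lambda>_. 0)(i := x)) j * h j \<omega>))
          + of_real (r / 2) * cis s * (of_real (w \<omega>) * cis (\<Sum>j\<in>insert i J. (t(i := x)) j * h j \<omega>))
          + of_real (r / 2) * cis (- s) * (of_real (w \<omega>) * cis (\<Sum>j\<in>insert i J. ((\<lambda>j. - t j)(i := x)) j * h j \<omega>))" for \<omega>
        proof -
          define y where "y = (\<Sum>j\<in>J. t j * h j \<omega>)"
          have split: "cis (s + y) = cis s * cis y" "cis (- (s + y)) = cis (- s) * cis (- y)"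
            "cis (x * h i \<omega> + y') = cis (x * h i \<omega>) * cis y'" for y'
            by (simp_all add: cis_mult)
          have y': "(\<Sum>j\<in>J. - t j * h j \<omega>) = - y" by (simp add: y_def sum_negf)
          show ?thesis
            unfolding sm y' y_def[symmetric] of_real_mult of_real_add c split
            by (simp add: field_simps)
        qed
        then show ?thesis
          using int by simp
      qed
      show "(\<integral>\<omega>. of_real (u \<omega> * (2 + r * cos (s + (\<Sum>j\<in>J. t j * f j \<omega>)))) * cis (x * f i \<omega>) \<partial>M)
          = (\<integral>\<omega>. of_real (v \<omega> * (2 + r * cos (s + (\<Sum>j\<in>J. t j * g j \<omega>)))) * cis (x * g i \<omega>) \<partial>N)"
        by (simp only: expand[OF insert.prems(1) fball] expand[OF insert.prems(3) gball] insert.prems(8))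
    qed simp_all
    let ?If = "\<lambda>\<omega>. u \<omega> * indicator (B i) (f i \<omega>)" and ?Ig = "\<lambda>\<omega>. v \<omega> * indicator (B i) (g i \<omega>)"
    have iu: "integrable M ?If" and iv: "integrable N ?Ig"
      by (rule bound_int[OF insert.prems(1)], measurable, simp add: indicator_def)
         (rule bound_int[OF insert.prems(3)], measurable, simp add: indicator_def)
    have icu: "integrable M (\<lambda>\<omega>. ?If \<omega> * cos (s + (\<Sum>j\<in>J. t j * f j \<omega>)))"
      by (rule bound_int[OF iu]) (measurable, meson abs_cos_le_one order_trans one_le_numeral)
    have icv: "integrable N (\<lambda>\<omega>. ?Ig \<omega> * cos (s + (\<Sum>j\<in>J. t j * g j \<omega>)))"
      by (rule bound_int[OF iv]) (measurable, meson abs_cos_le_one order_trans one_le_numeral)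
    have "2 * (\<integral>\<omega>. ?If \<omega> \<partial>M) = 2 * (\<integral>\<omega>. ?Ig \<omega> \<partial>N)"
      using main[of 0] by (simp add: mult.commute[of _ 2] mult.assoc)
    moreover have "2 * (\<integral>\<omega>. ?If \<omega> \<partial>M) + (\<integral>\<omega>. ?If \<omega> * cos (s + (\<Sum>j\<in>J. t j * f j \<omega>)) \<partial>M)
        = 2 * (\<integral>\<omega>. ?Ig \<omega> \<partial>N) + (\<integral>\<omega>. ?Ig \<omega> * cos (s + (\<Sum>j\<in>J. t j * g j \<omega>)) \<partial>N)"
    proof -
      have "2 * (\<integral>\<omega>. w \<omega> * I \<omega> \<partial>L) + (\<integral>\<omega>. w \<omega> * I \<omega> * C \<omega> \<partial>L) = (\<integral>\<omega>. (w \<omega> * (2 + 1 * C \<omega>)) * I \<omega> \<partial>L)"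
        if "integrable L (\<lambda>\<omega>. w \<omega> * I \<omega>)" "integrable L (\<lambda>\<omega>. w \<omega> * I \<omega> * C \<omega>)"
        for L :: "'x measure" and w I C :: "'x \<Rightarrow> real"
      proof -
        have "(\<integral>\<omega>. (w \<omega> * (2 + 1 * C \<omega>)) * I \<omega> \<partial>L) = (\<integral>\<omega>. 2 * (w \<omega> * I \<omega>) + w \<omega> * I \<omega> * C \<omega> \<partial>L)"
          by (intro Bochner_Integration.integral_cong) (auto simp: algebra_simps)
        then show ?thesis using that by simp
      qed
      from this[OF iu icu] this[OF iv icv] main[of 1] show ?thesis by simp
    qed
    ultimately show ?thesis by linarith
  qed
  have ind: "integrable M (\<lambda>\<omega>. u \<omega> * indicator (B i) (f i \<omega>))" "integrable N (\<lambda>\<omega>. v \<omega> * indicator (B i) (g i \<omega>))"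
    by (rule bound_int[OF insert.prems(1)], measurable, simp add: indicator_def)
       (rule bound_int[OF insert.prems(3)], measurable, simp add: indicator_def)
  have "(\<integral>\<omega>. (u \<omega> * indicator (B i) (f i \<omega>)) * (\<Prod>j\<in>J. indicator (B j) (f j \<omega>)) \<partial>M)
       = (\<integral>\<omega>. (v \<omega> * indicator (B i) (g i \<omega>)) * (\<Prod>j\<in>J. indicator (B j) (g j \<omega>)) \<partial>N)"
  proof (rule insert.IH)
    fix t
    have ReIm: "Re (\<integral>\<omega>. of_real (w \<omega>) * cis (h \<omega>) \<partial>L) = (\<integral>\<omega>. w \<omega> * cos (0 + h \<omega>) \<partial>L)
        \<and> Im (\<integral>\<omega>. of_real (w \<omega>) * cis (h \<omega>) \<partial>L) = (\<integral>\<omega>. w \<omega> * cos (- (pi / 2) + h \<omega>) \<partial>L)"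
      if "integrable L w" "h \<in> borel_measurable L" for L :: "'x measure" and w h
    proof -
      have "cos (- (pi / 2) + y) = sin y" for y
        by (simp only: cos_add cos_minus sin_minus cos_pi_half sin_pi_half)
      then show ?thesis
        using integral_Re[OF integrable_bounded_mult_cis[OF that]] integral_Im[OF integrable_bounded_mult_cis[OF that]]
        by simp
    qed
    show "(\<integral>\<omega>. of_real (u \<omega> * indicator (B i) (f i \<omega>)) * cis (\<Sum>j\<in>J. t j * f j \<omega>) \<partial>M)
             = (\<integral>\<omega>. of_real (v \<omega> * indicator (B i) (g i \<omega>)) * cis (\<Sum>j\<in>J. t j * g j \<omega>) \<partial>N)"
      using ReIm[OF ind(1) F[of t]] ReIm[OF ind(2) G[of t]] cosine[of 0 t] cosine[of "- (pi / 2)" t]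
      by (intro complex_eqI) simp_all
  qed (use ind insert.prems in auto)
  then show ?case using insert.hyps by (simp add: mult.assoc)
qed

section \<open>Riemann sums, Gaussian variables, and distributions on the torus\<close>

lemma antiderivative_exists:
  fixes h :: "real \<Rightarrow> real"
  assumes "continuous_on UNIV h"
  shows "\<exists>F. \<forall>x. (F has_real_derivative h x) (at x)"
proof -
  define F where "F u = (LBINT y=ereal 0..ereal u. h y)" for u
  have "(F has_real_derivative h x) (at x)" for x
  proof -
    define a where "a = \<bar>x\<bar> + 1"
    have "(F has_vector_derivative h x) (at x within {- a..a})"
      unfolding F_def using assms
      by (intro interval_integral_FTC2) (auto simp: a_def intro: continuous_on_subset)
    moreover have "x \<in> interior {- a..a}" by (auto simp: a_def)
    ultimately have "(F has_vector_derivative h x) (at x)"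
      by (simp only: at_within_interior)
    then show ?thesis by (simp add: has_real_derivative_iff_has_vector_derivative)
  qed
  then show ?thesis by blast
qed

lemma set_integral_antiderivative:
  fixes h F :: "real \<Rightarrow> real"
  assumes "continuous_on UNIV h" "\<And>x. (F has_real_derivative h x) (at x)" "a \<le> b"
  shows "(LBINT x:{a..b}. h x) = F b - F a"
proof -
  have "(\<integral>x. h x * indicator {a..b} x \<partial>lborel) = F b - F a"
    using assms by (intro integral_FTC_Icc_real) (auto simp: continuous_on_eq_continuous_at)
  then show ?thesis by (simp add: set_lebesgue_integral_def mult.commute)
qed

lemma riemann_sum_tendsto:
  fixes h :: "real \<Rightarrow> real" and L :: real
  assumes h: "continuous_on UNIV h" and L: "L > 0"
  shows "(\<lambda>N. L / Suc N * (\<Sum>l<Suc N. h (L * l / Suc N))) \<longlonglongrightarrow> (LBINT x:{0..L}. h x)"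
proof (rule LIMSEQ_I)
  fix r :: real assume "r > 0"
  obtain F where F: "\<And>x. (F has_real_derivative h x) (at x)"
    using antiderivative_exists[OF h] by blast
  have "uniformly_continuous_on {0..L} h"
    using h by (intro compact_uniformly_continuous) (auto intro: continuous_on_subset)
  then obtain d where d: "d > 0" "\<And>x y. x \<in> {0..L} \<Longrightarrow> y \<in> {0..L} \<Longrightarrow> dist x y < d \<Longrightarrow> dist (h x) (h y) < r / (2 * L)"
  proof -
    have "r / (2 * L) > 0" using \<open>r > 0\<close> L by simp
    from uniformly_continuous_onE[OF \<open>uniformly_continuous_on {0..L} h\<close> this]
    show ?thesis using that by metis
  qed
  obtain N0 :: nat where N0: "L / d < N0" using reals_Archimedean2 by blast
  show "\<exists>N0. \<forall>N\<ge>N0. norm (L / Suc N * (\<Sum>l<Suc N. h (L * l / Suc N)) - (LBINT x:{0..L}. h x)) < r"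
  proof (intro exI allI impI)
    fix N assume "N \<ge> N0"
    define t where "t l = L * real l / Suc N" for l :: nat
    have step: "t (Suc l) - t l = L / Suc N" for l
      by (simp add: t_def diff_divide_distrib[symmetric] algebra_simps)
    have "L / d < Suc N" using N0 \<open>N \<ge> N0\<close> by simp
    then have small: "L / Suc N < d" using d(1) L by (simp add: field_simps)
    have "\<bar>(L / Suc N) * h (t l) - (F (t (Suc l)) - F (t l))\<bar> \<le> (L / Suc N) * (r / (2 * L))" if "l < Suc N" for l
    proof -
      have lt: "t l < t (Suc l)" using step[of l] L by (smt (verit) divide_pos_pos of_nat_0_less_iff zero_less_Suc)
      obtain \<xi> where \<xi>: "t l < \<xi>" "\<xi> < t (Suc l)" "F (t (Suc l)) - F (t l) = (t (Suc l) - t l) * h \<xi>"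
        using MVT2[OF lt, of F h] F by blast
      have "0 \<le> t l" using L by (simp add: t_def)
      moreover have "t (Suc l) \<le> L"
      proof -
        have "L * real (Suc l) \<le> L * real (Suc N)" using that L by (intro mult_left_mono) auto
        then show ?thesis by (simp add: t_def field_simps)
      qed
      ultimately have "dist (h (t l)) (h \<xi>) < r / (2 * L)"
        using \<xi> lt step[of l] small by (intro d(2)) (auto simp: dist_real_def)
      then have "\<bar>h (t l) - h \<xi>\<bar> \<le> r / (2 * L)" by (simp add: dist_real_def)
      then have "(L / Suc N) * \<bar>h (t l) - h \<xi>\<bar> \<le> (L / Suc N) * (r / (2 * L))"
        using L by (intro mult_left_mono) auto
      moreover have "(L / Suc N) * h (t l) - (F (t (Suc l)) - F (t l)) = (L / Suc N) * (h (t l) - h \<xi>)"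
        unfolding \<xi>(3) step by (simp only: right_diff_distrib)
      ultimately show ?thesis using L by (simp add: abs_mult)
    qed
    then have "\<bar>\<Sum>l<Suc N. (L / Suc N) * h (t l) - (F (t (Suc l)) - F (t l))\<bar> \<le> (\<Sum>l<Suc N. (L / Suc N) * (r / (2 * L)))"
      by (intro order_trans[OF sum_abs] sum_mono) auto
    also have "\<dots> = r / 2" using L by (simp add: field_simps del: of_nat_Suc)
    also have "(\<Sum>l<Suc N. (L / Suc N) * h (t l) - (F (t (Suc l)) - F (t l)))
        = L / Suc N * (\<Sum>l<Suc N. h (t l)) - (F (t (Suc N)) - F (t 0))"
      unfolding sum_lessThan_telescope[of "\<lambda>l. F (t l)" "Suc N", symmetric] sum_distrib_left
      by (rule sum_subtractf)
    also have "F (t (Suc N)) - F (t 0) = (LBINT x:{0..L}. h x)"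
      using set_integral_antiderivative[OF h F, of 0 L] L by (simp add: t_def)
    finally show "norm (L / Suc N * (\<Sum>l<Suc N. h (L * l / Suc N)) - (LBINT x:{0..L}. h x)) < r"
      using \<open>r > 0\<close> by (simp add: t_def)
  qed
qed

text \<open>
  If \<open>F\<close> is an antiderivative of \<open>h\<close>, then \<open>F (s + L) - F s\<close> has derivative \<open>0\<close> in \<open>s\<close>.
\<close>
lemma set_integral_period_shift:
  fixes h :: "real \<Rightarrow> real" and L s :: real
  assumes h: "continuous_on UNIV h" and p: "\<And>x. h (x + L) = h x" and L: "L > 0"
  shows "(LBINT x:{0..L}. h (s + x)) = (LBINT x:{0..L}. h x)"
proof -
  obtain F where F: "\<And>x. (F has_real_derivative h x) (at x)"
    using antiderivative_exists[OF h] by blast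
  have "((\<lambda>s. F (s + L) - F s) has_real_derivative 0) (at x)" for x
  proof -
    have "((\<lambda>s. F (s + L)) has_real_derivative h (x + L) * 1) (at x)"
      by (rule DERIV_chain2[OF F]) (auto intro!: derivative_eq_intros)
    from DERIV_diff[OF this F[of x]] show ?thesis by (simp add: p)
  qed
  then have "F (s + L) - F s = F (0 + L) - F 0"
    by (intro DERIV_isconst_all) auto
  moreover have "(LBINT x:{0..L}. h (s + x)) = F (s + L) - F (s + 0)"
  proof (rule set_integral_antiderivative)
    show "continuous_on UNIV (\<lambda>x. h (s + x))"
      by (rule continuous_on_compose2[OF h]) (auto intro!: continuous_intros)
    show "((\<lambda>x. F (s + x)) has_real_derivative h (s + x)) (at x)" for x
    proof -
      have "((\<lambda>x. s + x) has_real_derivative 1) (at x)" by (auto intro!: derivative_eq_intros)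
      from DERIV_chain2[OF F this] show ?thesis by simp
    qed
  qed (use L in auto)
  moreover have "(LBINT x:{0..L}. h x) = F L - F 0"
    using set_integral_antiderivative[OF h F] L by simp
  ultimately show ?thesis by simp
qed

lemma centered_gaussian_charfun:
  assumes "prob_space M" and Z: "centered_gaussian M Z"
  shows "(\<integral>\<omega>. cis (Z \<omega>) \<partial>M) = of_real (exp (- (\<integral>\<omega>. Z \<omega> * Z \<omega> \<partial>M) / 2))"
proof -
  interpret prob_space M by fact
  have [measurable]: "Z \<in> borel_measurable M" using Z by (simp add: centered_gaussian_def)
  from Z consider "AE \<omega> in M. Z \<omega> = 0" | \<sigma> where "\<sigma> > 0" "distributed M lborel Z (normal_density 0 \<sigma>)"
    by (auto simp: centered_gaussian_def)
  then show ?thesis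
  proof cases
    case 1
    have "(\<integral>\<omega>. cis (Z \<omega>) \<partial>M) = (\<integral>\<omega>. 1 \<partial>M)"
      using 1 by (intro integral_cong_AE) (auto simp: cis_conv_exp)
    moreover have "(\<integral>\<omega>. Z \<omega> * Z \<omega> \<partial>M) = 0"
      using 1 by (intro integral_eq_zero_AE) auto
    ultimately show ?thesis by (simp add: prob_space)
  next
    case 2
    have E: "expectation Z = 0" by (rule normal_distributed_expectation[OF 2])
    have V: "expectation (\<lambda>\<omega>. Z \<omega> * Z \<omega>) = \<sigma>\<^sup>2"
      using normal_distributed_variance[OF 2] E by (simp add: power2_eq_square)
    have "distributed M lborel (\<lambda>\<omega>. (Z \<omega> - 0) / \<sigma>) std_normal_density"
      using 2 by (subst normal_standard_normal_convert[symmetric]) auto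
    then have D: "distr M lborel (\<lambda>\<omega>. Z \<omega> / \<sigma>) = std_normal_distribution"
      by (simp add: distributed_distr_eq_density)
    have "(\<integral>\<omega>. cis (Z \<omega>) \<partial>M) = (\<integral>\<omega>. cis (\<sigma> * (Z \<omega> / \<sigma>)) \<partial>M)"
      using 2 by simp
    also have "\<dots> = (\<integral>x. cis (\<sigma> * x) \<partial>distr M lborel (\<lambda>\<omega>. Z \<omega> / \<sigma>))"
      by (rule integral_distr[symmetric]) (auto simp: cis_conv_exp)
    also have "\<dots> = char std_normal_distribution \<sigma>"
      unfolding D char_def by (simp add: cis_conv_exp)
    also have "\<dots> = of_real (exp (- (\<sigma>\<^sup>2) / 2))"
      by (simp add: char_std_normal_distribution)
    finally show ?thesis unfolding V by simp
  qed
qed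

lemma H_minus_1_lincomb:
  assumes u: "u \<in> H_minus_1" and "finite I" "\<And>i. i \<in> I \<Longrightarrow> test_function (f i)"
  shows "u (\<lambda>x. \<Sum>i\<in>I. c i * f i x) = (\<Sum>i\<in>I. c i * u (f i))"
  using assms(2,3)
proof (induction I rule: finite_induct)
  case empty
  have "u (\<lambda>x. 0 * (0::real) + 0 * 0) = 0 * u (\<lambda>x. 0) + 0 * u (\<lambda>x. 0)"
    using u test_function_const[of 0] unfolding H_minus_1_def by blast
  then show ?case by simp
next
  case (insert i I)
  have lin: "u (\<lambda>x. a * f x + b * g x) = a * u f + b * u g" if "test_function f" "test_function g" for f g a b
    using u that unfolding H_minus_1_def by blast
  have "test_function (\<lambda>x. \<Sum>j\<in>I. c j * f j x)"
    using insert.prems by (intro test_function_sum test_function_cmult) auto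
  then have "u (\<lambda>x. c i * f i x + 1 * (\<Sum>j\<in>I. c j * f j x)) = c i * u (f i) + 1 * u (\<lambda>x. \<Sum>j\<in>I. c j * f j x)"
    using insert.prems by (intro lin) auto
  then show ?case using insert by simp
qed

text \<open>
  Translation of a test function is continuous in the \<open>H\<^sup>1\<close> norm, by dominated convergence for
  the function and its first derivatives, and \<open>u\<close> is bounded in that norm.
\<close>
lemma continuous_convolve:
  assumes u: "u \<in> H_minus_1" and \<rho>: "test_function \<rho>"
  shows "continuous_on UNIV (convolve u \<rho>)"
proof -
  obtain C where C: "\<And>f. test_function f \<Longrightarrow> \<bar>u f\<bar> \<le> C * H1_norm f"
    using u unfolding H_minus_1_def by blast
  have lin: "u (\<lambda>x. a * f x + b * g x) = a * u f + b * u g" if "test_function f" "test_function g" for f g a b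
    using u that unfolding H_minus_1_def by blast
  have lim: "(\<lambda>n. convolve u \<rho> (p n)) \<longlonglongrightarrow> convolve u \<rho> q" if p: "p \<longlonglongrightarrow> q" for p q
  proof -
    define D where "D F n x = F (p n - x) - F (q - x)" for F :: "plane \<Rightarrow> real" and n x
    have Dtest: "test_function (D F n)" if "test_function F" for F n
      using test_function_add[OF test_function_reflect[OF that, of "p n"] test_function_cmult[OF test_function_reflect[OF that, of q], of "-1"]]
      unfolding D_def[abs_def] by simp
    have pdD: "pd1 (D \<rho> n) x = - D (pd1 \<rho>) n x" "pd2 (D \<rho> n) x = - D (pd2 \<rho>) n x" for n x
    proof -
      have "((\<lambda>x. \<rho> (p n - x) - \<rho> (q - x)) has_derivative
         (\<lambda>h. (fst h * pd1 (\<lambda>x. \<rho> (p n - x)) x + snd h * pd2 (\<lambda>x. \<rho> (p n - x)) x)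
            - (fst h * pd1 (\<lambda>x. \<rho> (q - x)) x + snd h * pd2 (\<lambda>x. \<rho> (q - x)) x))) (at x)"
        by (intro has_derivative_diff has_derivative_pd test_functionD(3) test_function_reflect \<rho>)
      from pd_of_has_derivative[OF this] show "pd1 (D \<rho> n) x = - D (pd1 \<rho>) n x" "pd2 (D \<rho> n) x = - D (pd2 \<rho>) n x"
        by (simp_all add: D_def[abs_def] pd_reflect[OF \<rho>])
    qed
    have L2: "(\<lambda>n. \<integral>x. (D F n x)\<^sup>2 \<partial>torus_leb) \<longlonglongrightarrow> 0" and int2: "integrable torus_leb (\<lambda>x. (D F n x)\<^sup>2)"
      if F: "test_function F" for F n
    proof -
      show i: "integrable torus_leb (\<lambda>x. (D F n x)\<^sup>2)" for n
        unfolding power2_eq_square by (intro integrable_test_function test_function_mult Dtest F)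
      obtain B where B: "\<And>x. \<bar>F x\<bar> \<le> B"
        using periodic_continuous_bounded test_functionD[OF F] by metis
      have "(\<lambda>n. \<integral>x. (D F n x)\<^sup>2 \<partial>torus_leb) \<longlonglongrightarrow> (\<integral>x. 0 \<partial>torus_leb)"
      proof (rule integral_dominated_convergence[where w = "\<lambda>_. (2 * B)\<^sup>2"])
        show "(\<lambda>x. (D F n x)\<^sup>2) \<in> borel_measurable torus_leb" for n
          using i by auto
        have "(\<lambda>n. (D F n x)\<^sup>2) \<longlonglongrightarrow> 0" for x
        proof -
          have "isCont F (q - x)"
            by (metis test_functionD(2)[OF F] continuous_on_eq_continuous_at open_UNIV UNIV_I)
          then have "(\<lambda>n. F (p n - x)) \<longlonglongrightarrow> F (q - x)"
            by (rule isCont_tendsto_compose) (intro tendsto_intros p)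
          then have "(\<lambda>n. (F (p n - x) - F (q - x))\<^sup>2) \<longlonglongrightarrow> (F (q - x) - F (q - x))\<^sup>2"
            by (intro tendsto_intros)
          then show ?thesis by (simp add: D_def)
        qed
        then show "AE x in torus_leb. (\<lambda>n. (D F n x)\<^sup>2) \<longlonglongrightarrow> 0" by simp
        have "(D F n x)\<^sup>2 \<le> (2 * B)\<^sup>2" for n x
          using B[of "p n - x"] B[of "q - x"] unfolding D_def by (intro abs_le_square_iff[THEN iffD1]) linarith
        then show "AE x in torus_leb. norm ((D F n x)\<^sup>2) \<le> (2 * B)\<^sup>2" for n by simp
      qed simp_all
      then show "(\<lambda>n. \<integral>x. (D F n x)\<^sup>2 \<partial>torus_leb) \<longlonglongrightarrow> 0" by simp
    qed
    have "(\<lambda>n. H1_norm (D \<rho> n)) \<longlonglongrightarrow> sqrt (0 + 0 + 0)"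
    proof -
      note i = int2[OF \<rho>] int2[OF test_functionD(5)[OF \<rho>]] int2[OF test_functionD(6)[OF \<rho>]]
      have "H1_norm (D \<rho> n) = sqrt ((\<integral>x. (D \<rho> n x)\<^sup>2 \<partial>torus_leb) + (\<integral>x. (D (pd1 \<rho>) n x)\<^sup>2 \<partial>torus_leb)
          + (\<integral>x. (D (pd2 \<rho>) n x)\<^sup>2 \<partial>torus_leb))" for n
        unfolding H1_norm_def pdD using i by simp
      then show ?thesis
        by (simp only:) (intro tendsto_intros L2 \<rho> test_functionD(5,6)[OF \<rho>])
    qed
    then have "(\<lambda>n. C * H1_norm (D \<rho> n)) \<longlonglongrightarrow> 0"
      by (auto intro: tendsto_mult_right_zero)
    moreover have "norm (convolve u \<rho> (p n) - convolve u \<rho> q) \<le> C * H1_norm (D \<rho> n)" for n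
    proof -
      have "convolve u \<rho> (p n) - convolve u \<rho> q = u (D \<rho> n)"
        using lin[OF test_function_reflect[OF \<rho>, of "p n"] test_function_reflect[OF \<rho>, of q], of 1 "-1"]
        by (simp add: convolve_def D_def[abs_def])
      then show ?thesis using C[OF Dtest[OF \<rho>]] by simp
    qed
    ultimately have "(\<lambda>n. convolve u \<rho> (p n) - convolve u \<rho> q) \<longlonglongrightarrow> 0"
      by (rule Lim_null_comparison[OF always_eventually[OF allI], rotated])
    then show ?thesis by (simp add: LIM_zero_iff)
  qed
  show ?thesis
    using lim by (auto simp: continuous_on_sequentially o_def)
qed

section \<open>The law of the circle averages\<close>

lemma continuous_circ: "continuous_on A f \<Longrightarrow> continuous_on A (\<lambda>x. circ \<tau> (f x))"
  unfolding circ_def divide_inverse by (intro continuous_intros)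

text \<open>
  The map \<open>circ \<tau>\<close> is the inverse of the complex coordinate \<open>x\<^sub>1 + \<tau> x\<^sub>2\<close> of the plane.
\<close>
lemma circ_emb:
  assumes "Im \<tau> > 0"
  shows "circ \<tau> z = p \<longleftrightarrow> of_real (fst p) + \<tau> * of_real (snd p) = z"
proof -
  have "of_real (fst p) + \<tau> * of_real (snd p) = z
      \<longleftrightarrow> fst p + Re \<tau> * snd p = Re z \<and> Im \<tau> * snd p = Im z"
    by (auto simp: complex_eq_iff)
  also have "\<dots> \<longleftrightarrow> circ \<tau> z = p"
  proof -
    have "Im \<tau> * snd p = Im z \<longleftrightarrow> Im z / Im \<tau> = snd p"
      using assms by (auto simp: field_simps)
    moreover have "Re \<tau> / Im \<tau> * Im z = Re \<tau> * snd p" if "Im z / Im \<tau> = snd p"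
      using that by (simp flip: that)
    ultimately show ?thesis
      unfolding circ_def prod_eq_iff by auto
  qed
  finally show ?thesis by simp
qed

lemma torus_map_circ:
  assumes \<tau>: "Im \<tau> > 0" and det: "a * d - b * c = 1"
  shows "torus_map a b c d (circ (moebius_map a b c d \<tau>) z) = circ \<tau> ((of_int c * \<tau> + of_int d) * z)"
proof -
  define j where "j = of_int c * \<tau> + of_int d"
  have j: "j \<noteq> 0" unfolding j_def by (rule moebius_denominator_nonzero[OF \<tau> det])
  define p where "p = circ (moebius_map a b c d \<tau>) z"
  have "of_real (fst p) + moebius_map a b c d \<tau> * of_real (snd p) = z"
    using circ_emb[OF Im_moebius_map_pos[OF \<tau> det]] p_def by metis
  then have "j * z = j * of_real (fst p) + (j * moebius_map a b c d \<tau>) * of_real (snd p)"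
    by (metis distrib_left mult.assoc)
  also have "j * moebius_map a b c d \<tau> = of_int a * \<tau> + of_int b"
    using j by (simp add: moebius_map_def j_def[symmetric])
  finally have "of_real (fst (torus_map a b c d p)) + \<tau> * of_real (snd (torus_map a b c d p)) = j * z"
    by (simp add: torus_map_def j_def algebra_simps)
  then show ?thesis
    using circ_emb[OF \<tau>, of "j * z" "torus_map a b c d p"] by (simp add: p_def j_def)
qed

text \<open>
  The starting angle \<open>\<theta>0\<close> is left free because the torus map rotates circles by the argument of
  \<open>c\<tau> + d\<close>.
\<close>
lemma circle_mean_riemann:
  fixes h :: "plane \<Rightarrow> real" and \<epsilon> \<theta>0 :: real
  assumes h: "continuous_on UNIV h"
  shows "(\<lambda>N. \<Sum>l<Suc N. 1 / Suc N * h (x + circ \<tau> (of_real \<epsilon> * cis (\<theta>0 + 2 * pi * l / Suc N))))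
     \<longlonglongrightarrow> 1 / (2 * pi) * (LBINT \<theta>:{0..2 * pi}. h (x + circ \<tau> (of_real \<epsilon> * cis \<theta>)))"
proof -
  define g where "g \<theta> = h (x + circ \<tau> (of_real \<epsilon> * cis \<theta>))" for \<theta>
  have g: "continuous_on UNIV g"
    unfolding g_def by (rule continuous_on_compose2[OF h]) (auto intro!: continuous_intros continuous_circ)
  have gs: "continuous_on UNIV (\<lambda>\<theta>. g (\<theta>0 + \<theta>))"
    by (rule continuous_on_compose2[OF g]) (auto intro!: continuous_intros)
  have p: "g (\<theta> + 2 * pi) = g \<theta>" for \<theta>
    by (simp add: g_def flip: cis_mult)
  have "(\<lambda>N. 1 / (2 * pi) * (2 * pi / Suc N * (\<Sum>l<Suc N. g (\<theta>0 + 2 * pi * l / Suc N))))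
      \<longlonglongrightarrow> 1 / (2 * pi) * (LBINT \<theta>:{0..2 * pi}. g (\<theta>0 + \<theta>))"
    using riemann_sum_tendsto[OF gs, of "2 * pi"] by (intro tendsto_mult tendsto_const) simp
  also have "(LBINT \<theta>:{0..2 * pi}. g (\<theta>0 + \<theta>)) = (LBINT \<theta>:{0..2 * pi}. g \<theta>)"
    by (rule set_integral_period_shift[OF g p]) simp
  also have "(\<lambda>N. 1 / (2 * pi) * (2 * pi / Suc N * (\<Sum>l<Suc N. g (\<theta>0 + 2 * pi * l / Suc N))))
     = (\<lambda>N. \<Sum>l<Suc N. 1 / Suc N * g (\<theta>0 + 2 * pi * l / Suc N))"
    unfolding sum_distrib_left[symmetric] by (simp del: of_nat_Suc sum.lessThan_Suc)
  finally show ?thesis by (simp only: g_def)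
qed

text \<open>
  Pairing a field with this function gives a Riemann sum, with starting angle \<open>\<theta>0\<close>, for the
  average of the field mollified by \<open>\<rho>\<close> over the circle of radius \<open>\<epsilon>\<close> around \<open>x\<close>.
\<close>
definition circle_test :: "(plane \<Rightarrow> real) \<Rightarrow> complex \<Rightarrow> real \<Rightarrow> real \<Rightarrow> plane \<Rightarrow> nat \<Rightarrow> plane \<Rightarrow> real" where
  "circle_test \<rho> \<tau> \<epsilon> \<theta>0 x N y =
     (\<Sum>l<Suc N. 1 / Suc N * \<rho> (x + circ \<tau> (of_real \<epsilon> * cis (\<theta>0 + 2 * pi * l / Suc N)) - y))"

lemma test_function_circle_test:
  "test_function \<rho> \<Longrightarrow> test_function (circle_test \<rho> \<tau> \<epsilon> \<theta>0 x N)"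
  unfolding circle_test_def[abs_def]
  by (intro test_function_sum test_function_cmult test_function_reflect)

lemma circle_test_tendsto:
  assumes u: "u \<in> H_minus_1" and \<rho>: "test_function \<rho>"
  shows "(\<lambda>N. u (circle_test \<rho> \<tau> \<epsilon> \<theta>0 x N))
    \<longlonglongrightarrow> 1 / (2 * pi) * (LBINT \<theta>:{0..2 * pi}. convolve u \<rho> (x + circ \<tau> (of_real \<epsilon> * cis \<theta>)))"
proof -
  have "u (circle_test \<rho> \<tau> \<epsilon> \<theta>0 x N)
     = (\<Sum>l<Suc N. 1 / Suc N * convolve u \<rho> (x + circ \<tau> (of_real \<epsilon> * cis (\<theta>0 + 2 * pi * l / Suc N))))" for N
    unfolding circle_test_def[abs_def] convolve_def
    by (intro H_minus_1_lincomb[OF u] test_function_reflect \<rho>) simp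
  then show ?thesis
    using circle_mean_riemann[OF continuous_convolve[OF u \<rho>]] by (simp only:)
qed

lemma norm_cis_diff_le: "cmod (cis x - cis y) \<le> \<bar>x - y\<bar>"
proof -
  have "cis x - cis y = cis y * (cis (x - y) - 1)"
    by (simp add: algebra_simps cis_mult)
  then have "cmod (cis x - cis y) = cmod (cis (x - y) - 1)"
    by (simp add: norm_mult)
  also have "\<dots> \<le> \<bar>x - y\<bar>"
    using iexp_approx1[of "x - y" 0] by (simp add: cis_conv_exp)
  finally show ?thesis .
qed

lemma charfun_tendsto_L2:
  fixes A :: "nat \<Rightarrow> 'i \<Rightarrow> 'w \<Rightarrow> real" and S :: "'i \<Rightarrow> 'w \<Rightarrow> real"
  assumes M: "prob_space M" and J: "finite J"
    and A: "\<And>k j. j \<in> J \<Longrightarrow> A k j \<in> borel_measurable M" and S: "\<And>j. j \<in> J \<Longrightarrow> S j \<in> borel_measurable M"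
    and L2: "\<And>j. j \<in> J \<Longrightarrow> (\<lambda>k. \<integral>\<^sup>+\<omega>. ennreal ((S j \<omega> - A k j \<omega>)\<^sup>2) \<partial>M) \<longlonglongrightarrow> 0"
  shows "(\<lambda>k. \<integral>\<omega>. cis (\<Sum>j\<in>J. t j * A k j \<omega>) \<partial>M) \<longlonglongrightarrow> (\<integral>\<omega>. cis (\<Sum>j\<in>J. t j * S j \<omega>) \<partial>M)"
proof (rule LIMSEQ_I)
  interpret prob_space M by fact
  fix r :: real assume "r > 0"
  define T where "T = (\<Sum>j\<in>J. \<bar>t j\<bar>)"
  have "T \<ge> 0" by (simp add: T_def sum_nonneg)
  \<comment> \<open>The total error will be \<open>T \<delta>\<close>; the added \<open>1\<close> covers the case \<open>T = 0\<close>.\<close>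
  define \<delta> where "\<delta> = r / (2 * (T + 1))"
  have \<delta>: "\<delta> > 0" using \<open>r > 0\<close> \<open>T \<ge> 0\<close> by (simp add: \<delta>_def)
  have cis_int: "integrable M (\<lambda>\<omega>. cis (f \<omega>))" if "f \<in> borel_measurable M" for f
    using integrable_bounded_mult_cis[of M "\<lambda>_. 1" f] that by simp
  have mA: "(\<lambda>\<omega>. \<Sum>j\<in>J. t j * A k j \<omega>) \<in> borel_measurable M" for k
    using A by (intro borel_measurable_sum borel_measurable_times) auto
  have mS: "(\<lambda>\<omega>. \<Sum>j\<in>J. t j * S j \<omega>) \<in> borel_measurable M"
    using S by (intro borel_measurable_sum borel_measurable_times) auto
  have "\<forall>\<^sub>F k in sequentially. \<forall>j\<in>J. (\<integral>\<^sup>+\<omega>. ennreal ((S j \<omega> - A k j \<omega>)\<^sup>2) \<partial>M) < ennreal (\<delta>\<^sup>2)"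
    using J L2 \<delta> by (intro eventually_ball_finite ballI order_tendstoD(2)) auto
  then obtain K where K: "\<And>k j. k \<ge> K \<Longrightarrow> j \<in> J \<Longrightarrow> (\<integral>\<^sup>+\<omega>. ennreal ((S j \<omega> - A k j \<omega>)\<^sup>2) \<partial>M) < ennreal (\<delta>\<^sup>2)"
    by (auto simp: eventually_sequentially)
  show "\<exists>K. \<forall>k\<ge>K. norm ((\<integral>\<omega>. cis (\<Sum>j\<in>J. t j * A k j \<omega>) \<partial>M) - (\<integral>\<omega>. cis (\<Sum>j\<in>J. t j * S j \<omega>) \<partial>M)) < r"
  proof (intro exI allI impI)
    fix k assume "k \<ge> K"
    have sq: "integrable M (\<lambda>\<omega>. (S j \<omega> - A k j \<omega>)\<^sup>2) \<and> (\<integral>\<omega>. (S j \<omega> - A k j \<omega>)\<^sup>2 \<partial>M) \<le> \<delta>\<^sup>2" if j: "j \<in> J" for j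
    proof -
      have m: "(\<lambda>\<omega>. (S j \<omega> - A k j \<omega>)\<^sup>2) \<in> borel_measurable M"
        using A[OF j] S[OF j] by measurable
      have lt: "(\<integral>\<^sup>+\<omega>. ennreal ((S j \<omega> - A k j \<omega>)\<^sup>2) \<partial>M) < ennreal (\<delta>\<^sup>2)"
        by (rule K[OF \<open>k \<ge> K\<close> j])
      then have i: "integrable M (\<lambda>\<omega>. (S j \<omega> - A k j \<omega>)\<^sup>2)"
        using m by (intro integrableI_nonneg) (auto intro: less_trans ennreal_less_top)
      have "ennreal (\<integral>\<omega>. (S j \<omega> - A k j \<omega>)\<^sup>2 \<partial>M) < ennreal (\<delta>\<^sup>2)"
        using lt by (subst (asm) nn_integral_eq_integral[OF i]) auto
      then show ?thesis using i by (auto simp: ennreal_less_iff)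
    qed
    have pt: "cmod (cis (\<Sum>j\<in>J. t j * A k j \<omega>) - cis (\<Sum>j\<in>J. t j * S j \<omega>))
        \<le> (\<Sum>j\<in>J. \<bar>t j\<bar> * (\<delta> / 2 + (S j \<omega> - A k j \<omega>)\<^sup>2 / (2 * \<delta>)))" for \<omega>
    proof -
      have "cmod (cis (\<Sum>j\<in>J. t j * A k j \<omega>) - cis (\<Sum>j\<in>J. t j * S j \<omega>))
          \<le> \<bar>(\<Sum>j\<in>J. t j * A k j \<omega>) - (\<Sum>j\<in>J. t j * S j \<omega>)\<bar>"
        by (rule norm_cis_diff_le)
      also have "\<dots> = \<bar>\<Sum>j\<in>J. t j * (A k j \<omega> - S j \<omega>)\<bar>"
        by (simp add: sum_subtractf right_diff_distrib)
      also have "\<dots> \<le> (\<Sum>j\<in>J. \<bar>t j * (A k j \<omega> - S j \<omega>)\<bar>)" by (rule sum_abs)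
      also have "\<dots> \<le> (\<Sum>j\<in>J. \<bar>t j\<bar> * (\<delta> / 2 + (S j \<omega> - A k j \<omega>)\<^sup>2 / (2 * \<delta>)))"
      proof (rule sum_mono)
        fix j
        \<comment> \<open>The elementary inequality \<open>D \<le> \<delta>/2 + D\<^sup>2/(2\<delta>)\<close> passes from \<open>L\<^sup>1\<close> to \<open>L\<^sup>2\<close>.\<close>
        define D where "D = \<bar>A k j \<omega> - S j \<omega>\<bar>"
        have "0 \<le> (D - \<delta>)\<^sup>2" by simp
        then have "2 * \<delta> * D \<le> \<delta>\<^sup>2 + D\<^sup>2" by (simp add: power2_eq_square algebra_simps)
        then have "D \<le> \<delta> / 2 + D\<^sup>2 / (2 * \<delta>)" using \<delta> by (simp add: field_simps power2_eq_square)
        moreover have "D\<^sup>2 = (S j \<omega> - A k j \<omega>)\<^sup>2" by (simp add: D_def power2_commute)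
        ultimately show "\<bar>t j * (A k j \<omega> - S j \<omega>)\<bar> \<le> \<bar>t j\<bar> * (\<delta> / 2 + (S j \<omega> - A k j \<omega>)\<^sup>2 / (2 * \<delta>))"
          by (simp add: abs_mult D_def mult_left_mono)
      qed
      finally show ?thesis .
    qed
    have "norm ((\<integral>\<omega>. cis (\<Sum>j\<in>J. t j * A k j \<omega>) \<partial>M) - (\<integral>\<omega>. cis (\<Sum>j\<in>J. t j * S j \<omega>) \<partial>M))
       = norm (\<integral>\<omega>. cis (\<Sum>j\<in>J. t j * A k j \<omega>) - cis (\<Sum>j\<in>J. t j * S j \<omega>) \<partial>M)"
      using cis_int[OF mA] cis_int[OF mS] by simp
    also have "\<dots> \<le> (\<integral>\<omega>. (\<Sum>j\<in>J. \<bar>t j\<bar> * (\<delta> / 2 + (S j \<omega> - A k j \<omega>)\<^sup>2 / (2 * \<delta>))) \<partial>M)"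
      by (rule order_trans[OF integral_norm_bound integral_mono]) (use cis_int[OF mA] cis_int[OF mS] sq pt in auto)
    also have "\<dots> = (\<Sum>j\<in>J. \<bar>t j\<bar> * (\<delta> / 2 + (\<integral>\<omega>. (S j \<omega> - A k j \<omega>)\<^sup>2 \<partial>M) / (2 * \<delta>)))"
    proof -
      have "(\<integral>\<omega>. (\<Sum>j\<in>J. \<bar>t j\<bar> * (\<delta> / 2 + (S j \<omega> - A k j \<omega>)\<^sup>2 / (2 * \<delta>))) \<partial>M)
          = (\<Sum>j\<in>J. \<integral>\<omega>. \<bar>t j\<bar> * (\<delta> / 2 + (S j \<omega> - A k j \<omega>)\<^sup>2 / (2 * \<delta>)) \<partial>M)"
        by (rule Bochner_Integration.integral_sum) (use sq in auto)
      also have "\<dots> = (\<Sum>j\<in>J. \<bar>t j\<bar> * (\<delta> / 2 + (\<integral>\<omega>. (S j \<omega> - A k j \<omega>)\<^sup>2 \<partial>M) / (2 * \<delta>)))"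
        using sq by (intro sum.cong refl) (simp add: prob_space)
      finally show ?thesis .
    qed
    also have "\<dots> \<le> (\<Sum>j\<in>J. \<bar>t j\<bar> * (\<delta> / 2 + \<delta>\<^sup>2 / (2 * \<delta>)))"
      using sq \<delta> by (intro sum_mono mult_left_mono add_left_mono divide_right_mono) auto
    also have "\<dots> = T * \<delta>"
      using \<delta> by (simp add: T_def sum_distrib_right power2_eq_square)
    also have "\<dots> < r"
    proof -
      have "T * r < r * (2 * (T + 1))" using \<open>r > 0\<close> \<open>T \<ge> 0\<close> by (simp add: algebra_simps add_strict_increasing2)
      then show ?thesis using \<open>T \<ge> 0\<close> by (simp add: \<delta>_def field_simps)
    qed
    finally show "norm ((\<integral>\<omega>. cis (\<Sum>j\<in>J. t j * A k j \<omega>) \<partial>M) - (\<integral>\<omega>. cis (\<Sum>j\<in>J. t j * S j \<omega>) \<partial>M)) < r" .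
  qed
qed

text \<open>
  Two limits lead from pairings with test functions to circle averages. Riemann sums of the
  mollified field are Gaussian with a variance given by \<open>G\<close>, and they converge pointwise as \<open>N\<close>
  grows. As \<open>k\<close> grows, the mollified averages converge in \<open>L\<^sup>2\<close>. So the characteristic function
  is an iterated limit of expressions in \<open>G\<close>, \<open>\<rho>\<close> and the circles alone.
\<close>
lemma circle_average_charfun:
  fixes x :: "'i \<Rightarrow> plane" and t :: "'i \<Rightarrow> real" and \<theta>0 :: real
  assumes gff: "gff \<tau> M X"
    and G: "\<And>f g. test_function f \<Longrightarrow> test_function g \<Longrightarrow> (\<integral>\<omega>. X \<omega> f * X \<omega> g \<partial>M) = green_form G f g"
    and Y: "circle_average \<tau> M X Y" and \<epsilon>: "\<epsilon> > 0" and \<rho>: "mollifier \<rho>" and J: "finite J"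
  defines "F \<equiv> \<lambda>k N y. \<Sum>j\<in>J. t j * circle_test (\<rho> k) \<tau> \<epsilon> \<theta>0 (x j) N y"
  shows "\<exists>c. (\<forall>k. (\<lambda>N. complex_of_real (exp (- green_form G (F k N) (F k N) / 2))) \<longlonglongrightarrow> c k)
     \<and> c \<longlonglongrightarrow> (\<integral>\<omega>. cis (\<Sum>j\<in>J. t j * Y \<epsilon> (x j) \<omega>) \<partial>M)"
proof -
  interpret prob_space M using gff by (simp add: gff_def)
  have Xf: "centered_gaussian M (\<lambda>\<omega>. X \<omega> f)" if "test_function f" for f
    using gff that by (simp add: gff_def)
  then have Xm: "(\<lambda>\<omega>. X \<omega> f) \<in> borel_measurable M" if "test_function f" for f
    using that by (simp add: centered_gaussian_def)
  have XH: "X \<omega> \<in> H_minus_1" if "\<omega> \<in> space M" for \<omega>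
    using gff that by (simp add: gff_def)
  have \<rho>t: "test_function (\<rho> k)" for k using \<rho> by (simp add: mollifier_def)
  have Ft: "test_function (F k N)" for k N
    unfolding F_def by (intro test_function_sum test_function_cmult test_function_circle_test \<rho>t)
  define A where "A k j \<omega> = 1 / (2 * pi) * (LBINT \<theta>:{0..2 * pi}.
      convolve (X \<omega>) (\<rho> k) (x j + circ \<tau> (of_real \<epsilon> * cis \<theta>)))" for k j \<omega>
  have lim: "(\<lambda>N. X \<omega> (circle_test (\<rho> k) \<tau> \<epsilon> \<theta>0 (x j) N)) \<longlonglongrightarrow> A k j \<omega>" if "\<omega> \<in> space M" for \<omega> k j
    unfolding A_def by (rule circle_test_tendsto[OF XH[OF that] \<rho>t])
  have Am: "A k j \<in> borel_measurable M" for k j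
    by (rule borel_measurable_LIMSEQ_real[OF lim Xm[OF test_function_circle_test[OF \<rho>t]]])
  have inner: "(\<lambda>N. complex_of_real (exp (- green_form G (F k N) (F k N) / 2)))
      \<longlonglongrightarrow> (\<integral>\<omega>. cis (\<Sum>j\<in>J. t j * A k j \<omega>) \<partial>M)" for k
  proof -
    have "(\<lambda>N. \<integral>\<omega>. cis (X \<omega> (F k N)) \<partial>M) \<longlonglongrightarrow> (\<integral>\<omega>. cis (\<Sum>j\<in>J. t j * A k j \<omega>) \<partial>M)"
    proof (rule integral_dominated_convergence[where w = "\<lambda>_. 1"])
      show "(\<lambda>\<omega>. cis (\<Sum>j\<in>J. t j * A k j \<omega>)) \<in> borel_measurable M"
        using Am unfolding cis_conv_exp by measurable
      show "(\<lambda>\<omega>. cis (X \<omega> (F k N))) \<in> borel_measurable M" for N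
        using Xm[OF Ft] unfolding cis_conv_exp by measurable
      have "(\<lambda>N. cis (X \<omega> (F k N))) \<longlonglongrightarrow> cis (\<Sum>j\<in>J. t j * A k j \<omega>)" if \<omega>: "\<omega> \<in> space M" for \<omega>
      proof -
        have "X \<omega> (F k N) = (\<Sum>j\<in>J. t j * X \<omega> (circle_test (\<rho> k) \<tau> \<epsilon> \<theta>0 (x j) N))" for N
          unfolding F_def by (intro H_minus_1_lincomb XH \<omega> J test_function_circle_test \<rho>t)
        then have "(\<lambda>N. X \<omega> (F k N)) \<longlonglongrightarrow> (\<Sum>j\<in>J. t j * A k j \<omega>)"
          by (simp only:) (intro tendsto_sum tendsto_mult tendsto_const lim \<omega>)
        then show ?thesis
          unfolding cis_conv_exp by (intro tendsto_exp tendsto_mult tendsto_const tendsto_of_real)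
      qed
      then show "AE \<omega> in M. (\<lambda>N. cis (X \<omega> (F k N))) \<longlonglongrightarrow> cis (\<Sum>j\<in>J. t j * A k j \<omega>)"
        by simp
    qed simp_all
    moreover have "(\<integral>\<omega>. cis (X \<omega> (F k N)) \<partial>M) = complex_of_real (exp (- green_form G (F k N) (F k N) / 2))" for N
      using centered_gaussian_charfun[OF prob_space_axioms Xf[OF Ft]] G[OF Ft Ft] by simp
    ultimately show ?thesis by simp
  qed
  have outer: "(\<lambda>k. \<integral>\<omega>. cis (\<Sum>j\<in>J. t j * A k j \<omega>) \<partial>M) \<longlonglongrightarrow> (\<integral>\<omega>. cis (\<Sum>j\<in>J. t j * Y \<epsilon> (x j) \<omega>) \<partial>M)"
  proof (rule charfun_tendsto_L2[OF prob_space_axioms J Am])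
    show "Y \<epsilon> (x j) \<in> borel_measurable M" for j
      using Y \<epsilon> unfolding circle_average_def by blast
    show "(\<lambda>k. \<integral>\<^sup>+\<omega>. ennreal ((Y \<epsilon> (x j) \<omega> - A k j \<omega>)\<^sup>2) \<partial>M) \<longlonglongrightarrow> 0" for j
      using Y \<epsilon> \<rho> unfolding circle_average_def A_def by blast
  qed
  show ?thesis
    by (rule exI[of _ "\<lambda>k. \<integral>\<omega>. cis (\<Sum>j\<in>J. t j * A k j \<omega>) \<partial>M"]) (intro conjI allI inner outer)
qed

lemma mollifier_torus_map:
  assumes \<rho>: "mollifier \<rho>" and det: "a * d - b * c = 1"
  shows "mollifier (\<lambda>k x. \<rho> k (torus_map a b c d x))"
proof -
  let ?A = "torus_map a b c d" and ?B = "torus_map d (- b) (- c) a"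
  have \<rho>t: "test_function (\<rho> k)" for k using \<rho> by (simp add: mollifier_def)
  have detr: "real_of_int a * real_of_int d - real_of_int b * real_of_int c = 1"
    using det by (metis of_int_1 of_int_diff of_int_mult)
  have BA: "?B (?A x) = x" for x
  proof -
    have "?B (?A x) = ((real_of_int a * real_of_int d - real_of_int b * real_of_int c) * fst x,
        (real_of_int a * real_of_int d - real_of_int b * real_of_int c) * snd x)"
      by (simp add: torus_map_def algebra_simps)
    then show ?thesis unfolding detr by simp
  qed
  have intA: "(\<integral>x. f (?A x) \<partial>torus_leb) = (\<integral>x. f x \<partial>torus_leb)" if "test_function f" for f
    using integral_torus_affine(2)[OF det test_functionD(4,1)[OF that], of 0] by simp
  show ?thesis
    unfolding mollifier_def
  proof (intro conjI allI impI)
    show "test_function (\<lambda>x. \<rho> k (?A x))" for k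
      using test_function_torus_map[OF \<rho>t, of k a b c d 0] by simp
    show "0 \<le> \<rho> k (?A x)" for k x using \<rho> unfolding mollifier_def by blast
    show "(\<integral>x. \<rho> k (?A x) \<partial>torus_leb) = 1" for k
      using intA[OF \<rho>t] \<rho> by (simp add: mollifier_def)
    fix \<phi> assume \<phi>: "test_function \<phi>"
    have \<phi>B: "test_function (\<lambda>x. \<phi> (?B x))"
      using test_function_torus_map[OF \<phi>, of d "- b" "- c" a 0] by simp
    have "(\<lambda>k. \<integral>x. \<phi> (?B x) * \<rho> k x \<partial>torus_leb) \<longlonglongrightarrow> \<phi> (?B 0)"
      using \<rho> \<phi>B unfolding mollifier_def by blast
    moreover have "(\<integral>x. \<phi> (?B x) * \<rho> k x \<partial>torus_leb) = (\<integral>x. \<phi> x * \<rho> k (?A x) \<partial>torus_leb)" for k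
      using intA[OF test_function_mult[OF \<phi>B \<rho>t[of k]]] by (simp add: BA)
    ultimately show "(\<lambda>k. \<integral>x. \<phi> x * \<rho> k (?A x) \<partial>torus_leb) \<longlonglongrightarrow> \<phi> 0"
      by (simp add: torus_map_def zero_prod_def)
  qed
qed

lemma circle_test_torus_map:
  assumes \<tau>: "Im \<tau> > 0" and det: "a * d - b * c = 1"
  shows "circle_test (\<lambda>x. \<rho> (torus_map a b c d x)) (moebius_map a b c d \<tau>) \<epsilon> 0 x N y
    = circle_test \<rho> \<tau> (cmod (of_int c * \<tau> + of_int d) * \<epsilon>) (Arg (of_int c * \<tau> + of_int d))
        (torus_map a b c d x) N (torus_map a b c d y)"
proof -
  let ?j = "of_int c * \<tau> + of_int d"
  have "?j * (of_real \<epsilon> * cis (0 + s)) = of_real (cmod ?j * \<epsilon>) * cis (Arg ?j + s)" for s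
  proof -
    have "?j = of_real (cmod ?j) * cis (Arg ?j)"
      using rcis_cmod_Arg[of ?j] by (simp add: rcis_def)
    then have "?j * (of_real \<epsilon> * cis s) = of_real (cmod ?j) * cis (Arg ?j) * (of_real \<epsilon> * cis s)"
      by simp
    then show ?thesis by (simp add: cis_mult[symmetric] mult_ac)
  qed
  then show ?thesis
    unfolding circle_test_def torus_map_diff torus_map_add torus_map_circ[OF \<tau> det] by (simp only:)
qed

text \<open>
  The mollifier \<open>peak\<close> is used for \<open>\<tau>\<close> and its composition with the torus map for \<open>\<psi>(\<tau>)\<close>. Then
  the test functions on both sides correspond to each other, and the Gaussian characteristic
  functions agree before any limit is taken.
\<close>
lemma circle_average_charfun_transport:
  fixes x :: "'i \<Rightarrow> plane"
  assumes \<tau>: "Im \<tau> > 0" and det: "a * d - b * c = 1" and \<epsilon>: "\<epsilon> > 0" and J: "finite J"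
    and X: "gff \<tau> M X" "circle_average \<tau> M X Y"
    and X': "gff (moebius_map a b c d \<tau>) M' X'" "circle_average (moebius_map a b c d \<tau>) M' X' Y'"
  shows "(\<integral>\<omega>. cis (\<Sum>j\<in>J. t j * Y' \<epsilon> (x j) \<omega>) \<partial>M')
    = (\<integral>\<omega>. cis (\<Sum>j\<in>J. t j * Y (cmod (of_int c * \<tau> + of_int d) * \<epsilon>) (torus_map a b c d (x j)) \<omega>) \<partial>M)"
proof -
  let ?j = "of_int c * \<tau> + of_int d" and ?A = "torus_map a b c d"
  have r: "cmod ?j * \<epsilon> > 0"
    using moebius_denominator_nonzero[OF \<tau> det] \<epsilon> by simp
  obtain G where G: "green_function \<tau> G"
    "\<And>f g. test_function f \<Longrightarrow> test_function g \<Longrightarrow> (\<integral>\<omega>. X \<omega> f * X \<omega> g \<partial>M) = green_form G f g"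
    using X(1) unfolding gff_def green_form_def by blast
  obtain G' where G': "green_function (moebius_map a b c d \<tau>) G'"
    "\<And>f g. test_function f \<Longrightarrow> test_function g \<Longrightarrow> (\<integral>\<omega>. X' \<omega> f * X' \<omega> g \<partial>M') = green_form G' f g"
    using X'(1) unfolding gff_def green_form_def by blast
  define F where "F k N y = (\<Sum>j\<in>J. t j * circle_test (peak k) \<tau> (cmod ?j * \<epsilon>) (Arg ?j) (?A (x j)) N y)" for k N y
  have Ft: "test_function (F k N)" for k N
    unfolding F_def[abs_def]
    by (intro test_function_sum test_function_cmult test_function_circle_test test_function_trig_poly trig_poly_peak)
  obtain e where e: "\<And>k. (\<lambda>N. complex_of_real (exp (- green_form G (F k N) (F k N) / 2))) \<longlonglongrightarrow> e k"
     "e \<longlonglongrightarrow> (\<integral>\<omega>. cis (\<Sum>j\<in>J. t j * Y (cmod ?j * \<epsilon>) (?A (x j)) \<omega>) \<partial>M)"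
    using circle_average_charfun[OF X(1) G(2) X(2) r mollifier_peak J, of t "Arg ?j" "\<lambda>j. ?A (x j)"]
    unfolding F_def[abs_def] by blast
  have "(\<lambda>y. \<Sum>j\<in>J. t j * circle_test (\<lambda>x. peak k (?A x)) (moebius_map a b c d \<tau>) \<epsilon> 0 (x j) N y) = (\<lambda>y. F k N (?A y))" for k N
    unfolding F_def circle_test_torus_map[OF \<tau> det] ..
  then obtain e' where e': "\<And>k. (\<lambda>N. complex_of_real (exp (- green_form G' (\<lambda>y. F k N (?A y)) (\<lambda>y. F k N (?A y)) / 2))) \<longlonglongrightarrow> e' k"
     "e' \<longlonglongrightarrow> (\<integral>\<omega>. cis (\<Sum>j\<in>J. t j * Y' \<epsilon> (x j) \<omega>) \<partial>M')"
    using circle_average_charfun[OF X'(1) G'(2) X'(2) \<epsilon> mollifier_torus_map[OF mollifier_peak det] J, of t 0 x]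
    by auto
  have "e' = e"
  proof
    fix k
    show "e' k = e k"
      using e'(1)[of k] e(1)[of k] unfolding green_form_transport[OF \<tau> det G(1) G'(1) Ft Ft]
      by (rule LIMSEQ_unique)
  qed
  with e(2) e'(2) show ?thesis using LIMSEQ_unique by blast
qed

lemma law_eqI:
  fixes f :: "'i \<Rightarrow> 'w \<Rightarrow> real" and g :: "'i \<Rightarrow> 'v \<Rightarrow> real"
  assumes M: "prob_space M" and N: "prob_space N"
    and f[measurable]: "\<And>i. f i \<in> borel_measurable M" and g[measurable]: "\<And>i. g i \<in> borel_measurable N"
    and eq: "\<And>J t. finite J \<Longrightarrow> (\<integral>\<omega>. cis (\<Sum>j\<in>J. t j * f j \<omega>) \<partial>M) = (\<integral>\<omega>. cis (\<Sum>j\<in>J. t j * g j \<omega>) \<partial>N)"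
  shows "distr M (Pi\<^sub>M UNIV (\<lambda>_. borel)) (\<lambda>\<omega> i. f i \<omega>) = distr N (Pi\<^sub>M UNIV (\<lambda>_. borel)) (\<lambda>\<omega> i. g i \<omega>)"
proof (rule measure_eqI_PiM_infinite)
  interpret M: prob_space M by fact
  interpret N: prob_space N by fact
  have fm: "(\<lambda>\<omega> i. f i \<omega>) \<in> M \<rightarrow>\<^sub>M Pi\<^sub>M UNIV (\<lambda>_. borel)"
    by (rule measurable_PiM_single') (use f in auto)
  have gm: "(\<lambda>\<omega> i. g i \<omega>) \<in> N \<rightarrow>\<^sub>M Pi\<^sub>M UNIV (\<lambda>_. borel)"
    by (rule measurable_PiM_single') (use g in auto)
  show "finite_measure (distr M (Pi\<^sub>M UNIV (\<lambda>_. borel)) (\<lambda>\<omega> i. f i \<omega>))"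
    using M.prob_space_distr[OF fm] prob_space.finite_measure by blast
  fix B :: "'i \<Rightarrow> real set" and J :: "'i set"
  assume J: "finite J" and B: "\<And>i. i \<in> J \<Longrightarrow> B i \<in> sets borel"
  have emb: "emeasure (distr L (Pi\<^sub>M UNIV (\<lambda>_. borel)) (\<lambda>\<omega> i. h i \<omega>)) (prod_emb UNIV (\<lambda>_. borel) J (Pi\<^sub>E J B))
      = ennreal (\<integral>\<omega>. 1 * (\<Prod>j\<in>J. indicator (B j) (h j \<omega>)) \<partial>L)"
    if L: "prob_space L" and hm: "(\<lambda>\<omega> i. h i \<omega>) \<in> L \<rightarrow>\<^sub>M Pi\<^sub>M UNIV (\<lambda>_. borel)"
      for L :: "'x measure" and h :: "'i \<Rightarrow> 'x \<Rightarrow> real"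
  proof -
    interpret prob_space L by fact
    let ?E = "(\<lambda>\<omega> i. h i \<omega>) -` prod_emb UNIV (\<lambda>_. borel) J (Pi\<^sub>E J B) \<inter> space L"
    have S: "prod_emb UNIV (\<lambda>_. borel) J (Pi\<^sub>E J B) \<in> sets (Pi\<^sub>M UNIV (\<lambda>_. borel))"
      using J B by (intro sets_PiM_I) auto
    have "emeasure (distr L (Pi\<^sub>M UNIV (\<lambda>_. borel)) (\<lambda>\<omega> i. h i \<omega>)) (prod_emb UNIV (\<lambda>_. borel) J (Pi\<^sub>E J B)) = emeasure L ?E"
      by (rule emeasure_distr[OF hm S])
    also have "\<dots> = ennreal (\<integral>\<omega>. indicator ?E \<omega> \<partial>L)"
      using measurable_sets[OF hm S] by (simp add: emeasure_eq_measure)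
    also have "(\<integral>\<omega>. indicator ?E \<omega> \<partial>L) = (LINT \<omega>|L. 1 * (\<Prod>j\<in>J. indicat_real (B j) (h j \<omega>)))"
    proof (rule Bochner_Integration.integral_cong[OF refl])
      fix \<omega> assume "\<omega> \<in> space L"
      then have "\<omega> \<in> ?E \<longleftrightarrow> (\<forall>j\<in>J. h j \<omega> \<in> B j)"
        by (auto simp: prod_emb_def PiE_def Pi_def)
      then show "indicator ?E \<omega> = (1 * (\<Prod>j\<in>J. indicator (B j) (h j \<omega>)) :: real)"
        using J by (auto simp: indicator_def)
    qed
    finally show ?thesis .
  qed
  show "emeasure (distr M (Pi\<^sub>M UNIV (\<lambda>_. borel)) (\<lambda>\<omega> i. f i \<omega>)) (prod_emb UNIV (\<lambda>_. borel) J (Pi\<^sub>E J B))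
      = emeasure (distr N (Pi\<^sub>M UNIV (\<lambda>_. borel)) (\<lambda>\<omega> i. g i \<omega>)) (prod_emb UNIV (\<lambda>_. borel) J (Pi\<^sub>E J B))"
    unfolding emb[OF M fm] emb[OF N gm]
    by (intro arg_cong[where f = ennreal] joint_charfun_uniqueness) (use J B eq in auto)
qed simp_all

section \<open>Scaling of the regularised partition function\<close>

text \<open>
  The integral over the torus, for continuous periodic functions, as a limit of expressions in
  countably many point evaluations. Paths are measured by their point evaluations, so this form
  makes the integral a measurable function of the path.
\<close>
definition grid_mean :: "(plane \<Rightarrow> real) \<Rightarrow> real" where
  "grid_mean g = lim (\<lambda>N. 1 / Suc N * (\<Sum>k<Suc N. lim (\<lambda>L. 1 / Suc L * (\<Sum>l<Suc L. g (k / Suc N, l / Suc L)))))"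

lemma grid_mean_eq_integral:
  assumes p: "periodic g" and c: "continuous_on UNIV g"
  shows "grid_mean g = (\<integral>x. g x \<partial>torus_leb)"
proof -
  obtain B where B: "\<And>x. \<bar>g x\<bar> \<le> B"
    using periodic_continuous_bounded[OF p c] by blast
  define h where "h x = (LBINT y:{0..1}. g (x, y))" for x
  have cy: "continuous_on UNIV (\<lambda>y. g (x, y))" for x
    by (rule continuous_on_compose2[OF c]) (auto intro!: continuous_intros)
  have cx: "continuous_on UNIV (\<lambda>x. g (x, y))" for y
    by (rule continuous_on_compose2[OF c]) (auto intro!: continuous_intros)
  have si: "set_integrable lborel {0..1} (\<lambda>y. f y)" if "continuous_on UNIV f" for f :: "real \<Rightarrow> real"
    using that by (intro borel_integrable_compact[OF compact_Icc, of 0 1 f, folded set_integrable_def]) (auto intro: continuous_on_subset)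
  have ch: "continuous_on UNIV h"
  proof (rule continuous_on_sequentiallyI)
    fix u a assume u: "\<forall>n. u n \<in> (UNIV :: real set)" "u \<longlonglongrightarrow> (a :: real)"
    show "(\<lambda>n. h (u n)) \<longlonglongrightarrow> h a"
      unfolding h_def set_lebesgue_integral_def
    proof (rule integral_dominated_convergence[where w = "\<lambda>y. indicator {0..1} y * B"])
      show "integrable lborel (\<lambda>y::real. indicator {0..1} y * B)"
        by (intro integrable_mult_left integrable_real_indicator) auto
      show "(\<lambda>y. indicator {0..1} y *\<^sub>R g (a, y)) \<in> borel_measurable lborel"
        using borel_measurable_continuous_onI[OF cy[of a]] by simp
      show "(\<lambda>y. indicator {0..1} y *\<^sub>R g (u n, y)) \<in> borel_measurable lborel" for n
        using borel_measurable_continuous_onI[OF cy[of "u n"]] by simp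
      have lim: "(\<lambda>n. g (u n, y)) \<longlonglongrightarrow> g (a, y)" for y
      proof -
        have "isCont (\<lambda>x. g (x, y)) a"
          by (metis cx continuous_on_eq_continuous_at open_UNIV UNIV_I)
        then show ?thesis using u(2) by (rule isCont_tendsto_compose)
      qed
      show "AE y in lborel. (\<lambda>n. indicator {0..1} y *\<^sub>R g (u n, y)) \<longlonglongrightarrow> indicator {0..1} y *\<^sub>R g (a, y)"
        by (intro AE_I2 tendsto_scaleR tendsto_const lim)
      show "AE y in lborel. norm (indicator {0..1} y *\<^sub>R g (u n, y)) \<le> indicator {0..1} y * B" for n
        using B by (auto simp: indicator_def)
    qed
  qed
  have inner: "(\<lambda>L. 1 / Suc L * (\<Sum>l<Suc L. g (x, l / Suc L))) \<longlonglongrightarrow> h x" for x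
    using riemann_sum_tendsto[OF cy[of x], of 1] by (simp only: h_def mult_1 zero_less_one)
  have outer: "(\<lambda>N. 1 / Suc N * (\<Sum>k<Suc N. h (k / Suc N))) \<longlonglongrightarrow> (LBINT x:{0..1}. h x)"
    using riemann_sum_tendsto[OF ch, of 1] by (simp only: mult_1 zero_less_one)
  have "grid_mean g = (LBINT x:{0..1}. h x)"
    unfolding grid_mean_def limI[OF inner] by (rule limI[OF outer])
  also have "\<dots> = (\<integral>x. g x \<partial>torus_leb)"
  proof -
    have eq01: "indicator {0..1::real} x *\<^sub>R z = indicator {0..<1} x *\<^sub>R (z::real)" if "x \<noteq> 1" for x z
      using that by (auto simp: indicator_def)
    have half: "(LBINT x:{0..1}. f x) = (LBINT x:{0..<1}. f x)" if "continuous_on UNIV f" for f :: "real \<Rightarrow> real"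
      unfolding set_lebesgue_integral_def
    proof (rule integral_cong_AE)
      have [measurable]: "f \<in> borel_measurable borel" using that by (rule borel_measurable_continuous_onI)
      show "(\<lambda>x. indicator {0..1} x *\<^sub>R f x) \<in> borel_measurable lborel" by simp
      show "(\<lambda>x. indicator {0..<1} x *\<^sub>R f x) \<in> borel_measurable lborel" by simp
      show "AE x in lborel. indicator {0..1} x *\<^sub>R f x = indicator {0..<1} x *\<^sub>R f x"
        using AE_lborel_singleton[of "1::real"] by eventually_elim (rule eq01)
    qed
    have h_half: "h x = (LBINT y:{0..<1}. g (x, y))" for x
      unfolding h_def by (rule half[OF cy])
    have gm: "g \<in> borel_measurable borel" by (rule borel_measurable_continuous_onI[OF c])
    let ?F = "\<lambda>x. indicator ({0..<1} \<times> {0..<1}) x *\<^sub>R g x"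
    have "integrable torus_leb g" by (rule integrable_continuous_periodic[OF p c])
    then have "integrable lborel ?F"
      unfolding torus_leb_def by (subst (asm) integrable_restrict_space) auto
    then have i: "integrable (lborel \<Otimes>\<^sub>M lborel) ?F" by (simp only: lborel_prod)
    have "(\<integral>x. g x \<partial>torus_leb) = (\<integral>x. ?F x \<partial>lborel)"
      unfolding torus_leb_def by (subst integral_restrict_space) auto
    also have "\<dots> = (\<integral>x. ?F x \<partial>(lborel \<Otimes>\<^sub>M lborel))" by (simp only: lborel_prod)
    also have "\<dots> = (\<integral>x. (\<integral>y. ?F (x, y) \<partial>lborel) \<partial>lborel)"
      by (rule lborel_pair.integral_fst'[OF i, symmetric])
    also have "\<dots> = (\<integral>x. indicator {0..<1} x *\<^sub>R (LBINT y:{0..<1}. g (x, y)) \<partial>lborel)"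
      unfolding set_lebesgue_integral_def
      by (intro Bochner_Integration.integral_cong refl) (auto simp: indicator_def)
    also have "\<dots> = (LBINT x:{0..<1}. h x)"
      unfolding h_half set_lebesgue_integral_def ..
    finally show ?thesis using half[OF ch] by simp
  qed
  finally show ?thesis .
qed

lemma measurable_grid_mean:
  assumes "\<And>x. (\<lambda>y. F y x) \<in> borel_measurable M"
  shows "(\<lambda>y. grid_mean (F y)) \<in> borel_measurable M"
  unfolding grid_mean_def
  by (intro borel_measurable_lim_metric borel_measurable_times borel_measurable_const borel_measurable_sum assms)

text \<open>
  Multiplication by an invertible constant is a bijection from the simple functions below \<open>f\<close> to
  those below \<open>K f\<close>; this covers arbitrary functions \<open>f\<close>, such as the partial integrals over the
  constant mode below.
\<close>
lemma nn_integral_cmult_pos: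
  assumes "K \<noteq> 0" "K \<noteq> \<top>"
  shows "(\<integral>\<^sup>+x. K * f x \<partial>M) = K * (\<integral>\<^sup>+x. f x \<partial>M)"
proof -
  have le: "k * (\<integral>\<^sup>+x. f x \<partial>M) \<le> (\<integral>\<^sup>+x. k * f x \<partial>M)" for k and f :: "'a \<Rightarrow> ennreal"
  proof -
    have "k * (\<integral>\<^sup>+x. f x \<partial>M) = (SUP g\<in>{g. simple_function M g \<and> g \<le> f}. k * integral\<^sup>S M g)"
      unfolding nn_integral_def by (rule SUP_mult_left_ennreal)
    also have "\<dots> \<le> (\<integral>\<^sup>+x. k * f x \<partial>M)"
    proof (rule SUP_least)
      fix g assume g: "g \<in> {g. simple_function M g \<and> g \<le> f}"
      then have "k * integral\<^sup>S M g = (\<integral>\<^sup>Sx. k * g x \<partial>M)"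
        by (simp add: simple_integral_mult)
      also have "\<dots> = (\<integral>\<^sup>+x. k * g x \<partial>M)"
        using g by (intro nn_integral_eq_simple_integral[symmetric] simple_function_mult simple_function_const) auto
      also have "\<dots> \<le> (\<integral>\<^sup>+x. k * f x \<partial>M)"
        using g by (intro nn_integral_mono mult_left_mono) (auto simp: le_fun_def)
      finally show "k * integral\<^sup>S M g \<le> (\<integral>\<^sup>+x. k * f x \<partial>M)" .
    qed
    finally show ?thesis .
  qed
  have inv: "K * inverse K = 1"
    using assms by (simp add: ennreal_divide_self less_top flip: divide_ennreal_def)
  have "(\<integral>\<^sup>+x. K * f x \<partial>M) = K * (inverse K * (\<integral>\<^sup>+x. K * f x \<partial>M))"
    by (simp add: inv flip: mult.assoc)
  also have "\<dots> \<le> K * (\<integral>\<^sup>+x. inverse K * (K * f x) \<partial>M)"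
    by (intro mult_left_mono le) simp
  also have "\<dots> = K * (\<integral>\<^sup>+x. f x \<partial>M)"
    by (simp add: inv mult.commute[of "inverse K"] flip: mult.assoc)
  finally show ?thesis using le by (intro antisym)
qed

lemma circle_average_measurable: "circle_average \<tau> M X Y \<Longrightarrow> \<epsilon> > 0 \<Longrightarrow> Y \<epsilon> x \<in> borel_measurable M"
  unfolding circle_average_def by blast

lemma circle_average_path:
  assumes "circle_average \<tau> M X Y" "\<epsilon> > 0" "\<omega> \<in> space M"
  shows "continuous_on UNIV (\<lambda>x. Y \<epsilon> x \<omega>)" "periodic (\<lambda>x. Y \<epsilon> x \<omega>)"
  using assms unfolding circle_average_def by blast+

text \<open>
  Let \<open>r = |c\<tau> + d|\<close>. The law of the circle averages is transported from \<open>\<epsilon>\<close> to \<open>r\<epsilon>\<close>, and the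
  logarithm of the imaginary part changes by \<open>2 ln r\<close>. What is left is the bookkeeping of powers
  of \<open>r\<close>, which cancel in the potential exactly because \<open>\<gamma> Q = 2 + \<gamma>\<^sup>2/2\<close>.
\<close>
lemma liouville_partition_eps_transport:
  assumes \<tau>: "Im \<tau> > 0" and det: "a * d - b * c = 1" and \<gamma>: "0 < \<gamma>" and \<epsilon>: "\<epsilon> > 0"
    and X: "gff \<tau> M X" "circle_average \<tau> M X Y"
    and X': "gff (moebius_map a b c d \<tau>) M' X'" "circle_average (moebius_map a b c d \<tau>) M' X' Y'"
  shows "liouville_partition_eps \<gamma> \<mu> n z \<alpha> (moebius_map a b c d \<tau>) M' Y' \<epsilon> =
    ennreal (\<Prod>i<n. cmod (deriv (moebius_map a b c d) \<tau>) powr (- conformal_weight \<gamma> (\<alpha> i))) *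
    liouville_partition_eps \<gamma> \<mu> n (\<lambda>i. torus_map a b c d (z i)) \<alpha> \<tau> M Y (cmod (of_int c * \<tau> + of_int d) * \<epsilon>)"
proof -
  let ?\<tau>' = "moebius_map a b c d \<tau>" and ?A = "torus_map a b c d" and ?Q = "Q_of \<gamma>"
  define r where "r = cmod (of_int c * \<tau> + of_int d)"
  have r: "r > 0" using moebius_denominator_nonzero[OF \<tau> det] by (simp add: r_def)
  have r\<epsilon>: "r * \<epsilon> > 0" using r \<epsilon> by simp
  note \<tau>' = Im_moebius_map_pos[OF \<tau> det]
  have Im': "Im ?\<tau>' = Im \<tau> / r\<^sup>2" unfolding r_def by (rule Im_moebius_map[OF \<tau> det])
  have ln': "ln (Im ?\<tau>') = ln (Im \<tau>) - 2 * ln r"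
    using \<tau> r by (simp add: Im' ln_div ln_realpow)
  define \<kappa> where "\<kappa> = (\<Prod>i<n. cmod (deriv (moebius_map a b c d) \<tau>) powr (- conformal_weight \<gamma> (\<alpha> i)))"
  have \<psi>': "cmod (deriv (moebius_map a b c d) \<tau>) = r powr (- 2)"
    using r unfolding deriv_moebius_map[OF \<tau> det]
    by (simp add: norm_divide norm_power r_def[symmetric] powr_minus powr_realpow[of r 2, simplified] inverse_eq_divide)
  have \<kappa>: "\<kappa> = (\<Prod>i<n. r powr (\<alpha> i * ?Q - (\<alpha> i)\<^sup>2 / 2))"
    unfolding \<kappa>_def \<psi>' powr_powr conformal_weight_def
    by (intro prod.cong refl arg_cong[where f = "\<lambda>u. r powr u"]) (simp add: field_simps power2_eq_square)
  have \<kappa>_pos: "\<kappa> > 0" unfolding \<kappa> using r by (intro prod_pos) simp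
  have \<gamma>Q: "\<gamma> * ?Q = 2 + \<gamma>\<^sup>2 / 2"
    using \<gamma> by (simp add: Q_of_def field_simps power2_eq_square)
  \<comment> \<open>The integrand for \<open>\<psi>(\<tau>)\<close> at the constant mode \<open>s\<close>, as a functional of the path.\<close>
  define \<Phi> :: "real \<Rightarrow> (plane \<Rightarrow> real) \<Rightarrow> ennreal" where "\<Phi> s y = ennreal (
         (\<Prod>i<n. \<epsilon> powr ((\<alpha> i)\<^sup>2 / 2) * exp (\<alpha> i * (s + y (z i) - ?Q / 2 * ln (Im ?\<tau>')))) *
         exp (- \<mu> * \<epsilon> powr (\<gamma>\<^sup>2 / 2) *
            (Im ?\<tau>' * grid_mean (\<lambda>x. exp (\<gamma> * (s + y x - ?Q / 2 * ln (Im ?\<tau>')))))))" for s y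
  have \<Phi>m: "\<Phi> s \<in> borel_measurable (Pi\<^sub>M UNIV (\<lambda>_. borel))" for s
  proof -
    have [measurable]: "(\<lambda>y. y x) \<in> borel_measurable (Pi\<^sub>M UNIV (\<lambda>_. borel))" for x :: plane
      by (rule measurable_component_singleton) simp
    have [measurable]: "(\<lambda>y. grid_mean (\<lambda>x. exp (\<gamma> * (s + y x - ?Q / 2 * ln (Im ?\<tau>'))))) \<in> borel_measurable (Pi\<^sub>M UNIV (\<lambda>_. borel))"
      by (rule measurable_grid_mean) measurable
    show ?thesis unfolding \<Phi>_def by measurable
  qed
  have Ym: "(\<lambda>\<omega> x. Y (r * \<epsilon>) (?A x) \<omega>) \<in> M \<rightarrow>\<^sub>M Pi\<^sub>M UNIV (\<lambda>_. borel)"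
    by (rule measurable_PiM_single') (auto intro: circle_average_measurable[OF X(2) r\<epsilon>])
  have Y'm: "(\<lambda>\<omega> x. Y' \<epsilon> x \<omega>) \<in> M' \<rightarrow>\<^sub>M Pi\<^sub>M UNIV (\<lambda>_. borel)"
    by (rule measurable_PiM_single') (auto intro: circle_average_measurable[OF X'(2) \<epsilon>])
  have law: "distr M' (Pi\<^sub>M UNIV (\<lambda>_. borel)) (\<lambda>\<omega> x. Y' \<epsilon> x \<omega>) = distr M (Pi\<^sub>M UNIV (\<lambda>_. borel)) (\<lambda>\<omega> x. Y (r * \<epsilon>) (?A x) \<omega>)"
  proof (rule law_eqI)
    show "prob_space M'" "prob_space M" using X(1) X'(1) by (simp_all add: gff_def)
    show "Y' \<epsilon> x \<in> borel_measurable M'" for x by (rule circle_average_measurable[OF X'(2) \<epsilon>])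
    show "Y (r * \<epsilon>) (?A x) \<in> borel_measurable M" for x by (rule circle_average_measurable[OF X(2) r\<epsilon>])
    show "(\<integral>\<omega>. cis (\<Sum>j\<in>J. t j * Y' \<epsilon> j \<omega>) \<partial>M') = (\<integral>\<omega>. cis (\<Sum>j\<in>J. t j * Y (r * \<epsilon>) (?A j) \<omega>) \<partial>M)"
      if "finite J" for J t
      unfolding r_def by (rule circle_average_charfun_transport[OF \<tau> det \<epsilon> that X X'])
  qed
  have exp_path: "periodic (\<lambda>x. exp (\<gamma> * (s + y x - q)))" "continuous_on UNIV (\<lambda>x. exp (\<gamma> * (s + y x - q)))"
    if "periodic y" "continuous_on UNIV y" for y :: "plane \<Rightarrow> real" and s q
    using that by (auto simp: periodic_def intro!: continuous_intros)
  define W' where "W' s \<omega> = ennreal (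
         (\<Prod>i<n. \<epsilon> powr ((\<alpha> i)\<^sup>2 / 2) * exp (\<alpha> i * (s + Y' \<epsilon> (z i) \<omega> - ?Q / 2 * ln (Im ?\<tau>')))) *
         exp (- \<mu> * \<epsilon> powr (\<gamma>\<^sup>2 / 2) *
            (\<integral>x. exp (\<gamma> * (s + Y' \<epsilon> x \<omega> - ?Q / 2 * ln (Im ?\<tau>'))) \<partial>torus_vol ?\<tau>')))" for s \<omega>
  define W where "W s \<omega> = ennreal (
         (\<Prod>i<n. (r * \<epsilon>) powr ((\<alpha> i)\<^sup>2 / 2) * exp (\<alpha> i * (s + Y (r * \<epsilon>) (?A (z i)) \<omega> - ?Q / 2 * ln (Im \<tau>)))) *
         exp (- \<mu> * (r * \<epsilon>) powr (\<gamma>\<^sup>2 / 2) *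
            (\<integral>x. exp (\<gamma> * (s + Y (r * \<epsilon>) x \<omega> - ?Q / 2 * ln (Im \<tau>))) \<partial>torus_vol \<tau>)))" for s \<omega>
  have W'\<Phi>: "W' s \<omega> = \<Phi> s (\<lambda>x. Y' \<epsilon> x \<omega>)" if "\<omega> \<in> space M'" for s \<omega>
  proof -
    note path = exp_path[OF circle_average_path(2,1)[OF X'(2) \<epsilon> that], of s "?Q / 2 * ln (Im ?\<tau>')"]
    have "(\<integral>x. exp (\<gamma> * (s + Y' \<epsilon> x \<omega> - ?Q / 2 * ln (Im ?\<tau>'))) \<partial>torus_vol ?\<tau>')
       = Im ?\<tau>' * grid_mean (\<lambda>x. exp (\<gamma> * (s + Y' \<epsilon> x \<omega> - ?Q / 2 * ln (Im ?\<tau>'))))"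
      using integral_torus_vol[OF \<tau>' borel_measurable_continuous_onI[OF path(2)]] grid_mean_eq_integral[OF path] by simp
    then show ?thesis by (simp only: W'_def \<Phi>_def)
  qed
  have \<Phi>W: "\<Phi> s (\<lambda>x. Y (r * \<epsilon>) (?A x) \<omega>) = ennreal \<kappa> * W s \<omega>" if \<omega>: "\<omega> \<in> space M" for s \<omega>
  proof -
    let ?y = "\<lambda>x. Y (r * \<epsilon>) x \<omega>"
    note y = circle_average_path[OF X(2) r\<epsilon> \<omega>]
    let ?E = "\<lambda>x. exp (\<gamma> * (s + ?y x - ?Q / 2 * ln (Im \<tau>)))"
    note pE = exp_path[OF y(2,1), of s "?Q / 2 * ln (Im \<tau>)"]
    have yA: "periodic (\<lambda>x. ?y (?A x))" "continuous_on UNIV (\<lambda>x. ?y (?A x))"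
      using periodic_torus_map[OF y(2), of a b c d 0]
      by (auto intro!: continuous_on_compose2[OF y(1)] continuous_intros)
    note pA = exp_path[OF yA, of s "?Q / 2 * ln (Im ?\<tau>')"]
    have shift: "exp (t * (s + u - ?Q / 2 * ln (Im ?\<tau>'))) = r powr (t * ?Q) * exp (t * (s + u - ?Q / 2 * ln (Im \<tau>)))" for t u
      using r by (simp add: ln' powr_def exp_add[symmetric] algebra_simps)
    have "grid_mean (\<lambda>x. exp (\<gamma> * (s + ?y (?A x) - ?Q / 2 * ln (Im ?\<tau>'))))
        = (\<integral>x. exp (\<gamma> * (s + ?y (?A x) - ?Q / 2 * ln (Im ?\<tau>'))) \<partial>torus_leb)"
      by (rule grid_mean_eq_integral[OF pA])
    also have "\<dots> = r powr (\<gamma> * ?Q) * (\<integral>x. ?E (?A x) \<partial>torus_leb)"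
      unfolding shift by simp
    also have "(\<integral>x. ?E (?A x) \<partial>torus_leb) = (\<integral>x. ?E x \<partial>torus_leb)"
      using integral_torus_affine(2)[OF det borel_measurable_continuous_onI[OF pE(2)] pE(1), of 0] by simp
    finally have "\<epsilon> powr (\<gamma>\<^sup>2 / 2) * (Im ?\<tau>' * grid_mean (\<lambda>x. exp (\<gamma> * (s + ?y (?A x) - ?Q / 2 * ln (Im ?\<tau>')))))
        = \<epsilon> powr (\<gamma>\<^sup>2 / 2) * (r powr (\<gamma> * ?Q) / r\<^sup>2) * (Im \<tau> * (\<integral>x. ?E x \<partial>torus_leb))"
      by (simp add: Im')
    also have "r powr (\<gamma> * ?Q) / r\<^sup>2 = r powr (\<gamma>\<^sup>2 / 2)"
      unfolding \<gamma>Q powr_add using r by (simp add: powr_realpow[of r 2, simplified])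
    also have "\<epsilon> powr (\<gamma>\<^sup>2 / 2) * r powr (\<gamma>\<^sup>2 / 2) = (r * \<epsilon>) powr (\<gamma>\<^sup>2 / 2)"
      using r \<epsilon> by (simp add: powr_mult)
    also have "Im \<tau> * (\<integral>x. ?E x \<partial>torus_leb) = (\<integral>x. ?E x \<partial>torus_vol \<tau>)"
      by (rule integral_torus_vol[OF \<tau> borel_measurable_continuous_onI[OF pE(2)], symmetric])
    finally have I: "\<epsilon> powr (\<gamma>\<^sup>2 / 2) * (Im ?\<tau>' * grid_mean (\<lambda>x. exp (\<gamma> * (s + ?y (?A x) - ?Q / 2 * ln (Im ?\<tau>')))))
        = (r * \<epsilon>) powr (\<gamma>\<^sup>2 / 2) * (\<integral>x. ?E x \<partial>torus_vol \<tau>)" .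
    have "\<epsilon> powr ((\<alpha> i)\<^sup>2 / 2) * exp (\<alpha> i * (s + ?y (?A (z i)) - ?Q / 2 * ln (Im ?\<tau>')))
        = r powr (\<alpha> i * ?Q - (\<alpha> i)\<^sup>2 / 2) * ((r * \<epsilon>) powr ((\<alpha> i)\<^sup>2 / 2) * exp (\<alpha> i * (s + ?y (?A (z i)) - ?Q / 2 * ln (Im \<tau>))))" for i
      unfolding shift using r \<epsilon> by (simp add: powr_mult powr_diff)
    then have P: "(\<Prod>i<n. \<epsilon> powr ((\<alpha> i)\<^sup>2 / 2) * exp (\<alpha> i * (s + ?y (?A (z i)) - ?Q / 2 * ln (Im ?\<tau>'))))
        = \<kappa> * (\<Prod>i<n. (r * \<epsilon>) powr ((\<alpha> i)\<^sup>2 / 2) * exp (\<alpha> i * (s + ?y (?A (z i)) - ?Q / 2 * ln (Im \<tau>))))"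
      unfolding \<kappa> prod.distrib[symmetric] by simp
    have "0 \<le> (\<Prod>i<n. (r * \<epsilon>) powr ((\<alpha> i)\<^sup>2 / 2) * exp (\<alpha> i * (s + ?y (?A (z i)) - ?Q / 2 * ln (Im \<tau>))))"
      by (intro prod_nonneg) simp
    then show ?thesis
      unfolding \<Phi>_def W_def P mult.assoc I using \<kappa>_pos by (simp add: ennreal_mult mult.assoc)
  qed
  have inner: "(\<integral>\<^sup>+\<omega>. W' s \<omega> \<partial>M') = ennreal \<kappa> * (\<integral>\<^sup>+\<omega>. W s \<omega> \<partial>M)" for s
  proof -
    have "(\<integral>\<^sup>+\<omega>. W' s \<omega> \<partial>M') = (\<integral>\<^sup>+\<omega>. \<Phi> s (\<lambda>x. Y' \<epsilon> x \<omega>) \<partial>M')"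
      by (intro nn_integral_cong W'\<Phi>)
    also have "\<dots> = (\<integral>\<^sup>+y. \<Phi> s y \<partial>distr M' (Pi\<^sub>M UNIV (\<lambda>_. borel)) (\<lambda>\<omega> x. Y' \<epsilon> x \<omega>))"
      by (rule nn_integral_distr[OF Y'm, symmetric]) (simp add: \<Phi>m)
    also have "\<dots> = (\<integral>\<^sup>+\<omega>. \<Phi> s (\<lambda>x. Y (r * \<epsilon>) (?A x) \<omega>) \<partial>M)"
      unfolding law by (rule nn_integral_distr[OF Ym]) (simp add: \<Phi>m)
    also have "\<dots> = (\<integral>\<^sup>+\<omega>. ennreal \<kappa> * W s \<omega> \<partial>M)"
      by (intro nn_integral_cong \<Phi>W)
    also have "\<dots> = ennreal \<kappa> * (\<integral>\<^sup>+\<omega>. W s \<omega> \<partial>M)"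
      using \<kappa>_pos by (intro nn_integral_cmult_pos) auto
    finally show ?thesis .
  qed
  have Z: "Z_FF ?\<tau>' = Z_FF \<tau>"
    using SL2_invariant[OF \<tau> det, of Z_FF] Z_FF_T Z_FF_S by blast
  have "liouville_partition_eps \<gamma> \<mu> n z \<alpha> ?\<tau>' M' Y' \<epsilon>
      = ennreal (Z_FF \<tau>) * (\<integral>\<^sup>+s. ennreal \<kappa> * (\<integral>\<^sup>+\<omega>. W s \<omega> \<partial>M) \<partial>lborel)"
    unfolding liouville_partition_eps_def W'_def[symmetric] inner Z ..
  also have "\<dots> = ennreal (Z_FF \<tau>) * (ennreal \<kappa> * (\<integral>\<^sup>+s. (\<integral>\<^sup>+\<omega>. W s \<omega> \<partial>M) \<partial>lborel))"
    using \<kappa>_pos by (subst nn_integral_cmult_pos) auto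
  also have "\<dots> = ennreal \<kappa> * (ennreal (Z_FF \<tau>) * (\<integral>\<^sup>+s. (\<integral>\<^sup>+\<omega>. W s \<omega> \<partial>M) \<partial>lborel))"
    by (rule mult.left_commute)
  also have "\<dots> = ennreal \<kappa> * liouville_partition_eps \<gamma> \<mu> n (\<lambda>i. ?A (z i)) \<alpha> \<tau> M Y (r * \<epsilon>)"
    by (simp only: liouville_partition_eps_def W_def)
  finally show ?thesis unfolding \<kappa>_def r_def .
qed

text \<open>
  Since \<open>K\<close> is invertible, the limit of \<open>g\<close> exists if and only if that of \<open>f\<close> does, so the
  identity is compatible with the value \<open>0\<close> for a missing limit.
\<close>
lemma Lim_scaled:
  fixes f g :: "real \<Rightarrow> ennreal"
  assumes eq: "\<And>\<epsilon>. \<epsilon> > 0 \<Longrightarrow> g \<epsilon> = K * f (r * \<epsilon>)" and r: "r > 0" and K: "K \<noteq> 0" "K \<noteq> \<top>"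
  shows "(if \<exists>L. (g \<longlongrightarrow> L) (at_right 0) then Lim (at_right 0) g else 0)
    = K * (if \<exists>L. (f \<longlongrightarrow> L) (at_right 0) then Lim (at_right 0) f else 0)"
proof -
  have scale: "filterlim (\<lambda>\<epsilon>. s * \<epsilon>) (at_right 0) (at_right (0::real))" if "s > 0" for s
    using filterlim_times_pos[of "\<lambda>x. x" 0 "at_right 0" s] that filterlim_ident by fastforce
  have fg: "(g \<longlongrightarrow> K * L) (at_right 0)" if "(f \<longlongrightarrow> L) (at_right 0)" for L
  proof -
    have "((\<lambda>\<epsilon>. K * f (r * \<epsilon>)) \<longlongrightarrow> K * L) (at_right 0)"
      using K by (intro ennreal_tendsto_cmult filterlim_compose[OF that scale[OF r]]) (auto simp: less_top)
    moreover have "\<forall>\<^sub>F \<epsilon> in at_right 0. K * f (r * \<epsilon>) = g \<epsilon>"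
      by (rule eventually_mono[OF eventually_at_right_less]) (simp add: eq)
    ultimately show ?thesis by (rule Lim_transform_eventually)
  qed
  have inv: "inverse K * K = 1"
    using K by (simp add: mult.commute ennreal_divide_self less_top flip: divide_ennreal_def)
  have inv_top: "inverse K < \<top>"
    using K by (simp flip: less_top)
  have gf: "(f \<longlongrightarrow> inverse K * L) (at_right 0)" if "(g \<longlongrightarrow> L) (at_right 0)" for L
  proof -
    have "((\<lambda>\<epsilon>. inverse K * g (1 / r * \<epsilon>)) \<longlongrightarrow> inverse K * L) (at_right 0)"
      using r by (intro ennreal_tendsto_cmult inv_top filterlim_compose[OF that scale]) simp
    moreover have "\<forall>\<^sub>F \<epsilon> in at_right 0. inverse K * g (1 / r * \<epsilon>) = f \<epsilon>"
      by (rule eventually_mono[OF eventually_at_right_less]) (use r in \<open>simp add: eq inv flip: mult.assoc\<close>)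
    ultimately show ?thesis by (rule Lim_transform_eventually)
  qed
  show ?thesis
  proof (cases "\<exists>L. (f \<longlongrightarrow> L) (at_right 0)")
    case True
    then obtain L where L: "(f \<longlongrightarrow> L) (at_right 0)" by blast
    have "Lim (at_right 0) f = L" "Lim (at_right 0) g = K * L"
      using L fg[OF L] by (intro tendsto_Lim; simp)+
    then show ?thesis using L fg[OF L] by auto
  next
    case False
    then have "\<nexists>L. (g \<longlongrightarrow> L) (at_right 0)" using gf by blast
    with False show ?thesis by simp
  qed
qed

theorem theorem4p6:
  fixes \<tau> :: complex and \<gamma> \<mu> :: real and n :: nat
    and z :: "nat \<Rightarrow> plane" and \<alpha> :: "nat \<Rightarrow> real" and a b c d :: int
    and M :: "'w measure" and X :: "'w \<Rightarrow> (plane \<Rightarrow> real) \<Rightarrow> real" and Y :: "real \<Rightarrow> plane \<Rightarrow> 'w \<Rightarrow> real"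
    and M' :: "'v measure" and X' :: "'v \<Rightarrow> (plane \<Rightarrow> real) \<Rightarrow> real" and Y' :: "real \<Rightarrow> plane \<Rightarrow> 'v \<Rightarrow> real"
  assumes "Im \<tau> > 0" and "0 < \<gamma>" and "\<gamma> < 2" and "\<mu> > 0"
    and "\<And>i j. i < n \<Longrightarrow> j < n \<Longrightarrow> i \<noteq> j \<Longrightarrow> z i - z j \<notin> int_lattice"
    and "a * d - b * c = 1"
    and "gff \<tau> M X" and "circle_average \<tau> M X Y"
    and "gff (moebius_map a b c d \<tau>) M' X'" and "circle_average (moebius_map a b c d \<tau>) M' X' Y'"
  shows "liouville_partition \<gamma> \<mu> n z \<alpha> (moebius_map a b c d \<tau>) M' Y' =
    ennreal (\<Prod>i<n. cmod (deriv (moebius_map a b c d) \<tau>) powr (- conformal_weight \<gamma> (\<alpha> i))) *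
    liouville_partition \<gamma> \<mu> n (\<lambda>i. torus_map a b c d (z i)) \<alpha> \<tau> M Y"
proof -
  have nz: "of_int c * \<tau> + of_int d \<noteq> 0"
    by (rule moebius_denominator_nonzero) fact+
  then have "deriv (moebius_map a b c d) \<tau> \<noteq> 0"
    using assms by (subst deriv_moebius_map) auto
  then have pos: "(\<Prod>i<n. cmod (deriv (moebius_map a b c d) \<tau>) powr (- conformal_weight \<gamma> (\<alpha> i))) > 0"
    by (intro prod_pos) simp
  show ?thesis
    unfolding liouville_partition_def
  proof (rule Lim_scaled)
    show "liouville_partition_eps \<gamma> \<mu> n z \<alpha> (moebius_map a b c d \<tau>) M' Y' \<epsilon> =
      ennreal (\<Prod>i<n. cmod (deriv (moebius_map a b c d) \<tau>) powr (- conformal_weight \<gamma> (\<alpha> i))) *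
      liouville_partition_eps \<gamma> \<mu> n (\<lambda>i. torus_map a b c d (z i)) \<alpha> \<tau> M Y
        (cmod (of_int c * \<tau> + of_int d) * \<epsilon>)" if "\<epsilon> > 0" for \<epsilon>
      by (rule liouville_partition_eps_transport) fact+
    show "cmod (of_int c * \<tau> + of_int d) > 0" using nz by simp
  qed (use pos in \<open>simp_all only: ennreal_eq_0_iff ennreal_neq_top not_le not_False_eq_True\<close>)
qed

end
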